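(* Let $G$ be any finite graph and $n\in\mathbb{N}$. Then the cubical map $\Phi\colon X_n(G)\to\mathcal{T}_{\Delta(G)}$ (defined in the context) is a local isometry and hence $\pi_1$-injective. Thus the reduced graph braid group $RB_n(G)$ embeds in the right-angled Artin group $A_{\Delta(G)}$.
   Context: $G$ is a finite graph viewed as a simplicial complex. For $x\in G$ the carrier $c(x)$ is the smallest dimensional simplex (vertex or closed edge) containing $x$. The reduced unordered $n$-point configuration space of $G$ is $$X_n(G)=\{\{x_1,\ldots,x_n\}: x_i\in G,\ c(x_i)\cap c(x_j)=\emptyset\text{ for }i\neq j\},$$ the quotient by the symmetric group $S_n$ of the corresponding subspace of $G^n$. It is a cubed complex (a complex glued from unit Euclidean cubes): its $k$-dimensional cubes correspond to collections $\{c_1,\ldots,c_n\}$ of mutually disjoint closed simplices of $G$, $k$ of which are edges and $n-k$ of which are vertices, the cube being $\{\{x_1,\ldots,x_n\}:x_i\in c_i\}\cong c_1\times\cdots\times c_n$. The reduced braid group is $RB_n(G)=\pi_1(X_n(G))$ (with respect to any chosen basepoint). For a finite simple graph $\Delta$ (no loops or multiple edges) with vertex set $\mathcal V$ and edge set $\mathcal E$, the right-angled Artin group is $A_\Delta=\langle \mathcal V\mid uv=vu \text{ if }(u,v)\in\mathcal E\rangle$. Let $T(\mathcal V)=(\mathbb{R}/\mathbb{Z})^{\mathcal V}$ be the cubed torus with one vertex and one oriented edge labelled by each $v\in\mathcal V$, with one $k$-cube for each set of $k$ distinct edges. $\mathcal{T}_\Delta$ is the subcomplex of $T(\mathcal V)$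 obtained by deleting the interior of every cube corresponding to a set of vertices which does not span a complete graph in $\Delta$; equivalently, it is the union of the subtori $T(U)$ over $U\subset\mathcal V$ spanning a complete graph. One has $\pi_1(\mathcal{T}_\Delta)\cong A_\Delta$, with generators represented by the labelled oriented edges. $\Delta(G)$ is the graph with vertex set $\{\overline{x}: x\text{ an edge of }G\}$, where two vertices are joined by an edge whenever the corresponding closed edges of $G$ are disjoint. Choose an orientation of each edge of $G$; this induces an orientation of each edge of $X_n(G)$. The map $\Phi$ sends the cube of $X_n(G)$ given by mutually disjoint edges $x_1,\ldots,x_k$ and vertices $u_1,\ldots,u_{n-k}$ of $G$ onto the cube of $\mathcal{T}_{\Delta(G)}$ spanned by the edges $\overline{x}_1,\ldots,\overline{x}_k$, respecting the orientations of all edges. Cubed complexes carry the intrinsic length metric. A local isometry is a map $f\colon X\to Y$ such that every $p\in X$ has an open ball neighbourhood on which $f$ restricts to an isometry onto its image. $\pi_1$-injective means inducing an injection on fundamental groups. *)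

theory Defs
  imports "HOL-Analysis.Analysis" "HOL-Algebra.Group"
begin

section \<open>Topological preliminaries\<close>

definition quotient_topology :: "'a topology \<Rightarrow> ('a \<Rightarrow> 'b) \<Rightarrow> 'b topology" where
  "quotient_topology X f =
     topology (\<lambda>U. U \<subseteq> f ` topspace X \<and> openin X {x \<in> topspace X. f x \<in> U})"

lemma openin_quotient_topology:
  "openin (quotient_topology X f) U \<longleftrightarrow>
     U \<subseteq> f ` topspace X \<and> openin X {x \<in> topspace X. f x \<in> U}"
proof -
  have "istopology (\<lambda>U. U \<subseteq> f ` topspace X \<and> openin X {x \<in> topspace X. f x \<in> U})"
    unfolding istopology_def
  proof (rule conjI; intro allI impI)
    fix S T
    assume S: "S \<subseteq> f ` topspace X \<and> openin X {x \<in> topspace X. f x \<in> S}"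
      and T: "T \<subseteq> f ` topspace X \<and> openin X {x \<in> topspace X. f x \<in> T}"
    have "{x \<in> topspace X. f x \<in> S \<inter> T} =
        {x \<in> topspace X. f x \<in> S} \<inter> {x \<in> topspace X. f x \<in> T}" by auto
    with S T show "S \<inter> T \<subseteq> f ` topspace X \<and> openin X {x \<in> topspace X. f x \<in> S \<inter> T}"
      by auto
  next
    fix K
    assume K: "\<forall>S\<in>K. S \<subseteq> f ` topspace X \<and> openin X {x \<in> topspace X. f x \<in> S}"
    have "{x \<in> topspace X. f x \<in> \<Union> K} = (\<Union>S\<in>K. {x \<in> topspace X. f x \<in> S})" by auto
    with K show "\<Union> K \<subseteq> f ` topspace X \<and> openin X {x \<in> topspace X. f x \<in> \<Union> K}"
      by auto
  qed
  then show ?thesis by (simp add: quotient_topology_def)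
qed

lemma topspace_quotient_topology [simp]:
  "topspace (quotient_topology X f) = f ` topspace X"
proof -
  have "{x \<in> topspace X. f x \<in> f ` topspace X} = topspace X" by auto
  then have "openin (quotient_topology X f) (f ` topspace X)"
    by (simp add: openin_quotient_topology)
  then show ?thesis
    by (metis openin_quotient_topology openin_subset openin_topspace subset_antisym)
qed

lemma quotient_map_quotient_topology: "quotient_map X (quotient_topology X f) f"
  by (auto simp: quotient_map_def openin_quotient_topology)


section \<open>Fundamental groups\<close>

definition loop_at :: "'a topology \<Rightarrow> 'a \<Rightarrow> (real \<Rightarrow> 'a) \<Rightarrow> bool" where
  "loop_at X x0 p \<longleftrightarrow> pathin X p \<and> p 0 = x0 \<and> p 1 = x0"

definition loop_homotopic :: "'a topology \<Rightarrow> 'a \<Rightarrow> (real \<Rightarrow> 'a) \<Rightarrow> (real \<Rightarrow> 'a) \<Rightarrow> bool" where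
  "loop_homotopic X x0 = homotopic_with (\<lambda>r. r 0 = x0 \<and> r 1 = x0) (top_of_set {0..1}) X"

definition loop_class :: "'a topology \<Rightarrow> 'a \<Rightarrow> (real \<Rightarrow> 'a) \<Rightarrow> (real \<Rightarrow> 'a) set" where
  "loop_class X x0 p = {q. loop_at X x0 q \<and> loop_homotopic X x0 p q}"

text \<open>Same formula as \<^const>\<open>joinpaths\<close>, which is restricted to topological type classes.\<close>

definition loop_concat :: "(real \<Rightarrow> 'a) \<Rightarrow> (real \<Rightarrow> 'a) \<Rightarrow> real \<Rightarrow> 'a" where
  "loop_concat p q = (\<lambda>t. if t \<le> 1/2 then p (2 * t) else q (2 * t - 1))"

definition pi1 :: "'a topology \<Rightarrow> 'a \<Rightarrow> (real \<Rightarrow> 'a) set monoid" where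
  "pi1 X x0 =
     \<lparr>carrier = {loop_class X x0 p | p. loop_at X x0 p},
      mult = (\<lambda>A B. \<Union>p\<in>A. \<Union>q\<in>B. loop_class X x0 (loop_concat p q)),
      one = loop_class X x0 (\<lambda>_. x0)\<rparr>"

definition pi1_map ::
  "'b topology \<Rightarrow> ('a \<Rightarrow> 'b) \<Rightarrow> 'a \<Rightarrow> (real \<Rightarrow> 'a) set \<Rightarrow> (real \<Rightarrow> 'b) set" where
  "pi1_map Y f x0 A = (\<Union>p\<in>A. loop_class Y (f x0) (f \<circ> p))"

definition pi1_injective :: "'a topology \<Rightarrow> 'b topology \<Rightarrow> ('a \<Rightarrow> 'b) \<Rightarrow> bool" where
  "pi1_injective X Y f \<longleftrightarrow> continuous_map X Y f \<and>
     (\<forall>x0\<in>topspace X. pi1_map Y f x0 \<in> mon (pi1 X x0) (pi1 Y (f x0)))"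


section \<open>Cubed complexes and their length metric\<close>

text \<open>
  A cubed complex is presented by its set of cubes. A cube is a pair of a finite set \<open>I\<close> of
  coordinates and a characteristic map defined on the unit cube with coordinates in \<open>I\<close>.
\<close>

type_synonym ('i, 'p) cubing = "('i set \<times> (('i \<Rightarrow> real) \<Rightarrow> 'p)) set"

definition unit_cube :: "'i set \<Rightarrow> ('i \<Rightarrow> real) set" where
  "unit_cube I = (I \<rightarrow>\<^sub>E {0..1})"

text \<open>
  \<open>cube_chain Q p q l\<close>: there is a string of points from \<open>p\<close> to \<open>q\<close>, any two consecutive ones
  joined by a straight segment inside a single cube, of total Euclidean length \<open>l\<close>. The
  intrinsic length metric is the infimum of these lengths; it is infinite between
  different components.
\<close>

inductive cube_chain :: "('i, 'p) cubing \<Rightarrow> 'p \<Rightarrow> 'p \<Rightarrow> real \<Rightarrow> bool" for Q where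
  "cube_chain Q p p 0"
| "\<lbrakk>(I, h) \<in> Q; a \<in> unit_cube I; b \<in> unit_cube I; cube_chain Q (h b) q l\<rbrakk>
   \<Longrightarrow> cube_chain Q (h a) q (L2_set (\<lambda>i. a i - b i) I + l)"

definition cube_dist :: "('i, 'p) cubing \<Rightarrow> 'p \<Rightarrow> 'p \<Rightarrow> ennreal" where
  "cube_dist Q p q = (INF l\<in>{l. cube_chain Q p q l}. ennreal l)"

definition local_isometry ::
  "'p set \<Rightarrow> ('p \<Rightarrow> 'p \<Rightarrow> ennreal) \<Rightarrow> 'q set \<Rightarrow> ('q \<Rightarrow> 'q \<Rightarrow> ennreal) \<Rightarrow> ('p \<Rightarrow> 'q) \<Rightarrow> bool" where
  "local_isometry M d N d' f \<longleftrightarrow> f ` M \<subseteq> N \<and>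
     (\<forall>p\<in>M. \<exists>r>0. \<forall>x\<in>M. \<forall>y\<in>M.
        d p x < ennreal r \<longrightarrow> d p y < ennreal r \<longrightarrow> d' (f x) (f y) = d x y)"


section \<open>Finite graphs as simplicial complexes\<close>

record 'a ugraph =
  verts :: "'a set"
  edges :: "'a set set"

definition finite_graph :: "'a ugraph \<Rightarrow> bool" where
  "finite_graph G \<longleftrightarrow> finite (verts G) \<and> (\<forall>e\<in>edges G. e \<subseteq> verts G \<and> card e = 2)"

definition simplices :: "'a ugraph \<Rightarrow> 'a set set" where
  "simplices G = {{v} | v. v \<in> verts G} \<union> edges G"

text \<open>Points of the geometric realization are given by barycentric coordinates.\<close>

definition realization :: "'a ugraph \<Rightarrow> ('a \<Rightarrow> real) set" where
  "realization G = {x. (\<forall>v. 0 \<le> x v) \<and> {v. x v \<noteq> 0} \<in> simplices G \<and>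
     (\<Sum>v | x v \<noteq> 0. x v) = 1}"

definition closed_simplex :: "'a ugraph \<Rightarrow> 'a set \<Rightarrow> ('a \<Rightarrow> real) set" where
  "closed_simplex G \<sigma> = {x \<in> realization G. {v. x v \<noteq> 0} \<subseteq> \<sigma>}"

definition carrier_simplex :: "'a ugraph \<Rightarrow> ('a \<Rightarrow> real) \<Rightarrow> ('a \<Rightarrow> real) set" where
  "carrier_simplex G x =
     closed_simplex G (ARG_MIN card \<sigma>. \<sigma> \<in> simplices G \<and> x \<in> closed_simplex G \<sigma>)"

definition vertex_point :: "'a \<Rightarrow> 'a \<Rightarrow> real" where
  "vertex_point v = indicator {v}"

text \<open>An orientation maps each edge to the pair (initial vertex, terminal vertex).\<close>

definition orientation :: "'a ugraph \<Rightarrow> ('a set \<Rightarrow> 'a \<times> 'a) \<Rightarrow> bool" where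
  "orientation G ori \<longleftrightarrow> (\<forall>e\<in>edges G. e = {fst (ori e), snd (ori e)})"

definition edge_point :: "'a \<times> 'a \<Rightarrow> real \<Rightarrow> 'a \<Rightarrow> real" where
  "edge_point uv t = (\<lambda>w. (1 - t) * vertex_point (fst uv) w + t * vertex_point (snd uv) w)"


section \<open>Reduced configuration spaces\<close>

definition ordered_conf :: "nat \<Rightarrow> 'a ugraph \<Rightarrow> (nat \<Rightarrow> 'a \<Rightarrow> real) set" where
  "ordered_conf n G = {x \<in> {..<n} \<rightarrow>\<^sub>E realization G.
     \<forall>i<n. \<forall>j<n. i \<noteq> j \<longrightarrow> carrier_simplex G (x i) \<inter> carrier_simplex G (x j) = {}}"

text \<open>
  The points of an ordered configuration are distinct, so its orbit under the symmetric group
  is determined by the set of these points.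
\<close>

definition conf_space :: "nat \<Rightarrow> 'a ugraph \<Rightarrow> ('a \<Rightarrow> real) set topology" where
  "conf_space n G =
     quotient_topology
       (subtopology (product_topology (\<lambda>_. top_of_set (realization G)) {..<n}) (ordered_conf n G))
       (\<lambda>x. x ` {..<n})"

definition conf_cells :: "nat \<Rightarrow> 'a ugraph \<Rightarrow> 'a set set set" where
  "conf_cells n G = {C. C \<subseteq> simplices G \<and> finite C \<and> card C = n \<and>
     (\<forall>\<sigma>\<in>C. \<forall>\<tau>\<in>C. \<sigma> \<noteq> \<tau> \<longrightarrow> closed_simplex G \<sigma> \<inter> closed_simplex G \<tau> = {})}"

definition conf_chart ::
  "'a ugraph \<Rightarrow> ('a set \<Rightarrow> 'a \<times> 'a) \<Rightarrow> 'a set set \<Rightarrow> ('a set \<Rightarrow> real) \<Rightarrow> ('a \<Rightarrow> real) set" where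
  "conf_chart G ori C a =
     vertex_point ` {v. {v} \<in> C} \<union> (\<lambda>e. edge_point (ori e) (a e)) ` (C \<inter> edges G)"

text \<open>
  The orientation only serves to parametrize the edges by \<open>[0,1]\<close>; reversing an edge composes
  the charts with an isometry of the cube and does not affect the metric.
\<close>

definition conf_cubing ::
  "nat \<Rightarrow> 'a ugraph \<Rightarrow> ('a set \<Rightarrow> 'a \<times> 'a) \<Rightarrow> ('a set, ('a \<Rightarrow> real) set) cubing" where
  "conf_cubing n G ori = {(C \<inter> edges G, conf_chart G ori C) | C. C \<in> conf_cells n G}"

definition reduced_braid_group ::
  "nat \<Rightarrow> 'a ugraph \<Rightarrow> ('a \<Rightarrow> real) set \<Rightarrow> (real \<Rightarrow> ('a \<Rightarrow> real) set) set monoid" where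
  "reduced_braid_group n G x0 = pi1 (conf_space n G) x0"


section \<open>Right-angled Artin groups\<close>

text \<open>The letter \<open>(s, True)\<close> stands for the generator \<open>s\<close> and \<open>(s, False)\<close> for its inverse.\<close>

type_synonym 's word = "('s \<times> bool) list"

inductive word_step :: "'s set \<Rightarrow> ('s word \<times> 's word) set \<Rightarrow> 's word \<Rightarrow> 's word \<Rightarrow> bool"
  for S R where
  "\<lbrakk>s \<in> S; u \<in> lists (S \<times> UNIV); w \<in> lists (S \<times> UNIV)\<rbrakk>
   \<Longrightarrow> word_step S R (u @ [(s, b), (s, \<not> b)] @ w) (u @ w)"
| "\<lbrakk>(l, r) \<in> R; u \<in> lists (S \<times> UNIV); w \<in> lists (S \<times> UNIV)\<rbrakk>
   \<Longrightarrow> word_step S R (u @ l @ w) (u @ r @ w)"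

definition word_class :: "'s set \<Rightarrow> ('s word \<times> 's word) set \<Rightarrow> 's word \<Rightarrow> 's word set" where
  "word_class S R u = {w. equivclp (word_step S R) u w}"

definition presented_group :: "'s set \<Rightarrow> ('s word \<times> 's word) set \<Rightarrow> 's word set monoid" where
  "presented_group S R =
     \<lparr>carrier = word_class S R ` lists (S \<times> UNIV),
      mult = (\<lambda>A B. \<Union>u\<in>A. \<Union>w\<in>B. word_class S R (u @ w)),
      one = word_class S R []\<rparr>"

definition raag :: "'v ugraph \<Rightarrow> 'v word set monoid" where
  "raag \<Delta> = presented_group (verts \<Delta>)
     {([(u, True), (v, True)], [(v, True), (u, True)]) | u v. {u, v} \<in> edges \<Delta>}"


section \<open>The cubed complex of a right-angled Artin group\<close>

definition RZ :: "real \<Rightarrow> real set" where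
  "RZ t = {s. s - t \<in> \<int>}"

definition torus :: "'v set \<Rightarrow> ('v \<Rightarrow> real set) topology" where
  "torus V = product_topology (\<lambda>_. quotient_topology euclideanreal RZ) V"

definition subtorus :: "'v set \<Rightarrow> 'v set \<Rightarrow> ('v \<Rightarrow> real set) set" where
  "subtorus V U = {p \<in> topspace (torus V). \<forall>v\<in>V - U. p v = RZ 0}"

definition cliques :: "'v ugraph \<Rightarrow> 'v set set" where
  "cliques \<Delta> = {U. U \<subseteq> verts \<Delta> \<and> (\<forall>u\<in>U. \<forall>v\<in>U. u \<noteq> v \<longrightarrow> {u, v} \<in> edges \<Delta>)}"

definition raag_complex :: "'v ugraph \<Rightarrow> ('v \<Rightarrow> real set) topology" where
  "raag_complex \<Delta> = subtopology (torus (verts \<Delta>)) (\<Union>U\<in>cliques \<Delta>. subtorus (verts \<Delta>) U)"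

definition torus_chart :: "'v set \<Rightarrow> 'v set \<Rightarrow> ('v \<Rightarrow> real) \<Rightarrow> 'v \<Rightarrow> real set" where
  "torus_chart V U a = (\<lambda>v\<in>V. if v \<in> U then RZ (a v) else RZ 0)"

definition raag_cubing :: "'v ugraph \<Rightarrow> ('v, 'v \<Rightarrow> real set) cubing" where
  "raag_cubing \<Delta> = {(U, torus_chart (verts \<Delta>) U) | U. U \<in> cliques \<Delta>}"


section \<open>The map \<open>\<Phi>\<close>\<close>

definition disjointness_graph :: "'a ugraph \<Rightarrow> 'a set ugraph" where
  "disjointness_graph G =
     \<lparr>verts = edges G,
      edges = {{e, f} | e f. e \<in> edges G \<and> f \<in> edges G \<and>
                 closed_simplex G e \<inter> closed_simplex G f = {}}\<rparr>"

text \<open>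
  The coordinate of the image at an edge \<open>e\<close> is the position of the configuration point moving
  in the interior of \<open>e\<close>, if there is one, and the base point otherwise. That this is the map
  described cube by cube is \<open>Phi_conf_chart\<close> below.
\<close>

definition Phi ::
  "'a ugraph \<Rightarrow> ('a set \<Rightarrow> 'a \<times> 'a) \<Rightarrow> ('a \<Rightarrow> real) set \<Rightarrow> 'a set \<Rightarrow> real set" where
  "Phi G ori S = (\<lambda>e\<in>edges G.
     if \<exists>t. 0 < t \<and> t < 1 \<and> edge_point (ori e) t \<in> S
     then RZ (THE t. 0 < t \<and> t < 1 \<and> edge_point (ori e) t \<in> S)
     else RZ 0)"

lemma support_edge_point:
  assumes "fst uv \<noteq> snd uv"
  shows "{w. edge_point uv t w \<noteq> 0} =
     (if t = 0 then {fst uv} else if t = 1 then {snd uv} else {fst uv, snd uv})"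
  using assms by (auto simp: edge_point_def vertex_point_def indicator_def split: if_splits)

lemma edge_point_inj:
  assumes "fst uv \<noteq> snd uv" "edge_point uv s = edge_point uv t"
  shows "s = t"
  using fun_cong[OF assms(2), of "snd uv"] assms(1)
  by (simp add: edge_point_def vertex_point_def indicator_def)

lemma Phi_conf_chart:
  assumes G: "finite_graph G" and ori: "orientation G ori"
    and a: "a \<in> unit_cube (C \<inter> edges G)"
  shows "Phi G ori (conf_chart G ori C a) = torus_chart (edges G) (C \<inter> edges G) a"
proof -
  have RZ1: "RZ 1 = RZ 0"
    unfolding RZ_def by (auto simp: Ints_1 intro: Ints_add[of "_ - 1" 1, simplified])
  have ends: "fst (ori e) \<noteq> snd (ori e) \<and> e = {fst (ori e), snd (ori e)}"
    if "e \<in> edges G" for e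
  proof -
    have "e = {fst (ori e), snd (ori e)}" "card e = 2"
      using that G ori by (auto simp: finite_graph_def orientation_def)
    then show ?thesis by (metis card_2_iff card_1_singleton_iff insert_absorb2 is_singletonI
          is_singleton_altdef numeral_eq_one_iff semiring_norm(85))
  qed
  have key: "0 < t \<and> t < 1 \<and> edge_point (ori e) t \<in> conf_chart G ori C a \<longleftrightarrow>
      e \<in> C \<and> t = a e \<and> 0 < a e \<and> a e < 1" if e: "e \<in> edges G" for e t
  proof
    assume *: "0 < t \<and> t < 1 \<and> edge_point (ori e) t \<in> conf_chart G ori C a"
    then have supp: "{w. edge_point (ori e) t w \<noteq> 0} = e"
      using support_edge_point[of "ori e" t] ends[OF e] by auto
    consider v where "edge_point (ori e) t = vertex_point v"
      | f where "f \<in> C" "f \<in> edges G" "edge_point (ori e) t = edge_point (ori f) (a f)"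
      using * by (auto simp: conf_chart_def)
    then show "e \<in> C \<and> t = a e \<and> 0 < a e \<and> a e < 1"
    proof cases
      case 1
      then have "e = {v}" using supp by (auto simp: vertex_point_def indicator_def)
      then show ?thesis using ends[OF e] by (metis insert_iff singletonD)
    next
      case 2
      have "e = {w. edge_point (ori f) (a f) w \<noteq> 0}" using supp 2 by simp
      also have "\<dots> = (if a f = 0 then {fst (ori f)} else if a f = 1 then {snd (ori f)}
          else {fst (ori f), snd (ori f)})"
        using ends[OF 2(2)] by (simp add: support_edge_point)
      finally have "e = f"
        using ends[OF e] ends[OF 2(2)] by (metis insert_iff singletonD)
      then show ?thesis using * 2 edge_point_inj ends[OF e] by blast
    qed
  qed (use e in \<open>auto simp: conf_chart_def\<close>)
  show ?thesis
  proof
    fix e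
    show "Phi G ori (conf_chart G ori C a) e = torus_chart (edges G) (C \<inter> edges G) a e"
    proof (cases "e \<in> edges G")
      case True
      show ?thesis
      proof (cases "e \<in> C \<and> 0 < a e \<and> a e < 1")
        case inner: True
        then show ?thesis using True by (simp add: Phi_def torus_chart_def key)
      next
        case False
        have "e \<in> C \<Longrightarrow> 0 \<le> a e \<and> a e \<le> 1" using a True by (auto simp: unit_cube_def PiE_iff)
        then have "e \<in> C \<Longrightarrow> a e = 0 \<or> a e = 1" using False by linarith
        then show ?thesis using True False by (auto simp: Phi_def torus_chart_def key RZ1)
      qed
    qed (simp add: Phi_def torus_chart_def)
  qed
qed

end

theory Submission
  imports Defs
begin

text \<open>
  A configuration is described relative to a corner, that is, a set \<open>S\<close> of \<open>n\<close> vertices: every edge \<open>e\<close>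
  that leaves \<open>S\<close> carries a height, the distance which the point starting in \<open>S\<close> has moved along \<open>e\<close>,
  and the edges with nonzero height are pairwise disjoint. The configurations with all heights below
  \<open>1\<close> form the open star of \<open>S\<close>, and rounding each point to a nearest vertex shows that the open stars
  cover the configuration space.

  \<open>\<Phi>\<close> does not increase distances, because it maps cubes isometrically onto cubes
  (\<open>Phi_chain\<close>). The converse inequality holds locally, because near the image of the star of \<open>S\<close> the
  target can be folded back onto that star: keep the coordinates of edges that leave \<open>S\<close> and point
  away from \<open>S\<close>, and collapse all others to \<open>0\<close>. Folding does not increase the length of a segment, and
  it lands in the configuration space because edges of a common cube of the target are disjoint and
  hence can be travelled simultaneously; this is the fact that the link of a vertex of the source
  embeds as a full subcomplex of the link of the vertex of the target. As folding inverts \<open>\<Phi>\<close> near \<open>S\<close>,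
  distances agree (\<open>fold_back_segment\<close>, \<open>star_chain\<close>, \<open>local_isometry_Phi\<close>).

  For the fundamental groups, a path in the target spells a word: whenever the coordinate of a
  generator crosses the midpoint of its circle, this generator or its inverse is written down. Close
  points differ in crossings of commuting generators only, so the class of the word in the
  right-angled Artin group is invariant under homotopies (\<open>jump_cocycle\<close>, \<open>path_word_homotopy\<close>).
  Conversely, every word traces a path in the configuration space from any given corner: a letter \<open>e\<close>
  or its inverse moves a point across \<open>e\<close> if exactly one end of \<open>e\<close> is occupied, and has no effect otherwise.
  On corners, every generator thus acts by the transposition of the two ends of an edge, which respects
  the commutation relations; and words with the same class trace homotopic paths (\<open>edge_path_weq\<close>).
  This is the canonical completion and retraction of Haglund and Wise, made explicit for \<open>\<Phi>\<close>. Every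
  path of configurations is homotopic to one traced by a word (\<open>straighten\<close>), and \<open>\<Phi>\<close> reads off
  exactly this word (\<open>reading_edge_path\<close>). Hence two loops whose images spell equal elements of the Artin group are
  homotopic (\<open>Phi_loops_injective\<close>). Both injectivity statements follow, as homotopic loops in
  the target spell equal elements.
\<close>

section \<open>Words in right-angled Artin groups\<close>

definition raag_relators :: "'v ugraph \<Rightarrow> ('v word \<times> 'v word) set" where
  "raag_relators \<Delta> =
     {([(u, True), (v, True)], [(v, True), (u, True)]) | u v. {u, v} \<in> edges \<Delta>}"

definition power_word :: "'v \<Rightarrow> int \<Rightarrow> 'v word" where
  "power_word v k = (if k = 1 then [(v, True)] else if k = - 1 then [(v, False)] else [])"

locale finite_raag =
  fixes \<Delta> :: "'v ugraph"
  assumes finite_verts: "finite (verts \<Delta>)"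
    and edges_verts: "e \<in> edges \<Delta> \<Longrightarrow> e \<subseteq> verts \<Delta>"
begin

abbreviation "V \<equiv> verts \<Delta>"
abbreviation "W \<equiv> lists (verts \<Delta> \<times> (UNIV :: bool set))"

definition weq :: "'v word \<Rightarrow> 'v word \<Rightarrow> bool" (infix "\<simeq>" 50) where
  "u \<simeq> w \<longleftrightarrow> equivclp (word_step V (raag_relators \<Delta>)) u w"

lemma weq_refl [simp]: "u \<simeq> u"
  by (simp add: weq_def)

lemma weq_sym: "u \<simeq> w \<Longrightarrow> w \<simeq> u"
  by (simp add: weq_def equivclp_sym)

lemma weq_trans [trans]: "u \<simeq> v \<Longrightarrow> v \<simeq> w \<Longrightarrow> u \<simeq> w"
  unfolding weq_def by (rule equivclp_trans)

lemma word_class_eq_iff: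
  "word_class V (raag_relators \<Delta>) u = word_class V (raag_relators \<Delta>) w \<longleftrightarrow> u \<simeq> w"
proof
  assume "word_class V (raag_relators \<Delta>) u = word_class V (raag_relators \<Delta>) w"
  moreover have "w \<in> word_class V (raag_relators \<Delta>) w" by (simp add: word_class_def)
  ultimately show "u \<simeq> w" by (metis mem_Collect_eq weq_def word_class_def)
next
  assume *: "u \<simeq> w"
  have "u \<simeq> x \<longleftrightarrow> w \<simeq> x" for x using * weq_sym weq_trans by metis
  then show "word_class V (raag_relators \<Delta>) u = word_class V (raag_relators \<Delta>) w"
    by (simp add: word_class_def weq_def[symmetric])
qed

lemma word_step_context:
  assumes "word_step V (raag_relators \<Delta>) x y" "u \<in> W" "w \<in> W"
  shows "word_step V (raag_relators \<Delta>) (u @ x @ w) (u @ y @ w)"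
  using assms(1)
proof cases
  case (1 s u' w' b)
  then have "word_step V (raag_relators \<Delta>) ((u @ u') @ [(s, b), (s, \<not> b)] @ (w' @ w)) ((u @ u') @ (w' @ w))"
    using assms by (intro word_step.intros(1)) auto
  then show ?thesis using 1 by simp
next
  case (2 l r u' w')
  then have "word_step V (raag_relators \<Delta>) ((u @ u') @ l @ (w' @ w)) ((u @ u') @ r @ (w' @ w))"
    using assms by (intro word_step.intros(2)) auto
  then show ?thesis using 2 by simp
qed

lemma weq_context:
  assumes "x \<simeq> y" "u \<in> W" "w \<in> W"
  shows "u @ x @ w \<simeq> u @ y @ w"
  using assms(1) unfolding weq_def
proof (induction rule: equivclp_induct)
  case (step y z)
  then show ?case
    using word_step_context assms(2,3)
    by (meson equivclp_sym equivclp_trans r_into_equivclp)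
qed simp

lemma weq_append:
  assumes "x \<simeq> x'" "y \<simeq> y'" "x' \<in> W" "y \<in> W"
  shows "x @ y \<simeq> x' @ y'"
proof -
  have "x @ y \<simeq> x' @ y" using weq_context[OF assms(1), of "[]" y] assms by simp
  also have "\<dots> \<simeq> x' @ y'" using weq_context[OF assms(2), of x' "[]"] assms by simp
  finally show ?thesis .
qed

lemma weq_cancel:
  assumes "v \<in> V" shows "[(v, b), (v, \<not> b)] \<simeq> []"
  using word_step.intros(1)[of v V "[]" "[]" "raag_relators \<Delta>" b] assms
  by (auto simp: weq_def)

text \<open>
  The relators only let two generators commute; the other sign combinations are consequences.
\<close>

lemma weq_commute:
  assumes uv: "{u, v} \<in> edges \<Delta>"
  shows "[(u, b), (v, c)] \<simeq> [(v, c), (u, b)]"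
proof -
  have u: "u \<in> V" and v: "v \<in> V" using edges_verts[OF uv] by auto
  \<comment> \<open>Conjugating a commutation by one of its letters inverts that letter.\<close>
  have inv: "[(u, \<not> b), (v, c)] \<simeq> [(v, c), (u, \<not> b)]"
    if "[(u, b), (v, c)] \<simeq> [(v, c), (u, b)]" "u \<in> V" "v \<in> V" for u v :: 'v and b c
  proof -
    have "[(u, \<not> b), (v, c)] \<simeq> [(u, \<not> b), (v, c), (u, b), (u, \<not> b)]"
      using weq_context[OF weq_sym[OF weq_cancel[of u b]], of "[(u, \<not> b), (v, c)]" "[]"] that by simp
    also have "\<dots> \<simeq> [(u, \<not> b), (u, b), (v, c), (u, \<not> b)]"
      using weq_context[OF weq_sym[OF that(1)], of "[(u, \<not> b)]" "[(u, \<not> b)]"] that by simp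
    also have "\<dots> \<simeq> [(v, c), (u, \<not> b)]"
      using weq_context[OF weq_cancel[of u "\<not> b"], of "[]" "[(v, c), (u, \<not> b)]"] that by simp
    finally show ?thesis .
  qed
  have "word_step V (raag_relators \<Delta>) ([] @ [(u, True), (v, True)] @ []) ([] @ [(v, True), (u, True)] @ [])"
    by (rule word_step.intros(2)) (use uv in \<open>auto simp: raag_relators_def\<close>)
  then have TT: "[(u, True), (v, True)] \<simeq> [(v, True), (u, True)]"
    by (auto simp: weq_def)
  have FT: "[(u, False), (v, True)] \<simeq> [(v, True), (u, False)]"
    using inv[OF TT u v] by simp
  have TF: "[(u, True), (v, False)] \<simeq> [(v, False), (u, True)]"
    using inv[OF weq_sym[OF TT] v u] weq_sym by simp
  have FF: "[(u, False), (v, False)] \<simeq> [(v, False), (u, False)]"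
    using inv[OF weq_sym[OF FT] v u] weq_sym by simp
  show ?thesis using TT FT TF FF by (cases b; cases c) auto
qed

lemma power_word_in [simp]: "v \<in> V \<Longrightarrow> power_word v k \<in> W"
  by (simp add: power_word_def)

lemma power_word_add:
  assumes "v \<in> V" "\<bar>i\<bar> \<le> 1" "\<bar>j\<bar> \<le> 1" "\<bar>i + j\<bar> \<le> 1"
  shows "power_word v i @ power_word v j \<simeq> power_word v (i + j)"
proof -
  have "i = -1 \<or> i = 0 \<or> i = 1" "j = -1 \<or> j = 0 \<or> j = 1" using assms by auto
  then show ?thesis
    using weq_cancel[OF assms(1), of True] weq_cancel[OF assms(1), of False] assms(4)
    by (auto simp: power_word_def)
qed

lemma power_word_commute:
  assumes "{u, v} \<in> edges \<Delta>"
  shows "power_word u i @ power_word v j \<simeq> power_word v j @ power_word u i"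
  using weq_commute[OF assms] by (simp add: power_word_def)

lemma concat_in_W: "(\<And>v. v \<in> set vs \<Longrightarrow> f v \<in> W) \<Longrightarrow> concat (map f vs) \<in> W"
  by (induction vs) auto

lemma commute_concat:
  assumes "u \<in> W" "\<And>v. v \<in> set vs \<Longrightarrow> f v \<in> W \<and> u @ f v \<simeq> f v @ u"
  shows "u @ concat (map f vs) \<simeq> concat (map f vs) @ u"
  using assms(2)
proof (induction vs)
  case (Cons v vs)
  have W: "concat (map f vs) \<in> W" "f v \<in> W" using Cons by (auto intro!: concat_in_W)
  have "u @ concat (map f (v # vs)) \<simeq> f v @ u @ concat (map f vs)"
    using weq_context[of "u @ f v" "f v @ u" "[]" "concat (map f vs)"] Cons W by simp
  also have "\<dots> \<simeq> f v @ concat (map f vs) @ u"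
    using weq_context[of "u @ concat (map f vs)" "concat (map f vs) @ u" "f v" "[]"] Cons W by simp
  finally show ?case by simp
qed simp

text \<open>
  Words enter below as products over all generators, one crossing number for each of them. This lemma
  turns the additivity of the crossing numbers into multiplicativity of the words.
\<close>

lemma concat_merge:
  assumes "distinct vs"
    and "\<And>v. v \<in> set vs \<Longrightarrow> f v \<in> W \<and> g v \<in> W \<and> h v \<in> W \<and> f v @ g v \<simeq> h v"
    and "\<And>u v. u \<in> set vs \<Longrightarrow> v \<in> set vs \<Longrightarrow> u \<noteq> v \<Longrightarrow> g u @ f v \<simeq> f v @ g u"
  shows "concat (map f vs) @ concat (map g vs) \<simeq> concat (map h vs)"
  using assms
proof (induction vs)
  case (Cons v vs)
  have W: "f v \<in> W" "g v \<in> W" "h v \<in> W" "concat (map f vs) \<in> W" "concat (map g vs) \<in> W"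
    "concat (map h vs) \<in> W"
    using Cons.prems(2) by (simp_all add: concat_in_W)
  have comm: "g v @ concat (map f vs) \<simeq> concat (map f vs) @ g v"
    using W(2) by (rule commute_concat) (use Cons.prems(1) in \<open>auto intro!: Cons.prems(2,3) simp: Cons.prems(2)\<close>)
  have "f v @ concat (map f vs) @ g v @ concat (map g vs)
      \<simeq> f v @ g v @ concat (map f vs) @ concat (map g vs)"
    using weq_context[OF weq_sym[OF comm], of "f v" "concat (map g vs)"] W by simp
  also have "\<dots> \<simeq> h v @ concat (map f vs) @ concat (map g vs)"
    using weq_context[of "f v @ g v" "h v" "[]" "concat (map f vs) @ concat (map g vs)"] W Cons.prems by simp
  also have "\<dots> \<simeq> h v @ concat (map h vs)"
    using weq_context[of "concat (map f vs) @ concat (map g vs)" "concat (map h vs)" "h v" "[]"]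
      W Cons by simp
  finally show ?case by simp
qed simp

lemma raag_carrier: "carrier (raag \<Delta>) = word_class V (raag_relators \<Delta>) ` W"
  by (simp add: raag_def presented_group_def raag_relators_def)

lemma raag_mult:
  assumes "u \<in> W" "w \<in> W"
  shows "word_class V (raag_relators \<Delta>) u \<otimes>\<^bsub>raag \<Delta>\<^esub> word_class V (raag_relators \<Delta>) w
    = word_class V (raag_relators \<Delta>) (u @ w)"
proof -
  have *: "word_class V (raag_relators \<Delta>) (u' @ w') = word_class V (raag_relators \<Delta>) (u @ w)"
    if "u' \<in> word_class V (raag_relators \<Delta>) u" "w' \<in> word_class V (raag_relators \<Delta>) w" for u' w'
  proof -
    have "u \<simeq> u'" "w \<simeq> w'" using that by (auto simp: word_class_def weq_def)
    moreover have "x \<in> W \<longleftrightarrow> y \<in> W" if "x \<simeq> y" for x y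
      using that unfolding weq_def
    proof (induction rule: equivclp_induct)
      case (step y z)
      have "a \<in> W \<and> b \<in> W" if "word_step V (raag_relators \<Delta>) a b" for a b
        using that
      proof cases
        case (2 l r u w)
        then show ?thesis using edges_verts by (fastforce simp: raag_relators_def)
      qed auto
      then show ?case using step by blast
    qed simp
    ultimately have "u @ w \<simeq> u' @ w'" using assms by (intro weq_append) auto
    then show ?thesis by (simp add: word_class_eq_iff weq_sym)
  qed
  have "u \<in> word_class V (raag_relators \<Delta>) u" "w \<in> word_class V (raag_relators \<Delta>) w"
    by (simp_all add: word_class_def)
  then have ne: "word_class V (raag_relators \<Delta>) u \<noteq> {}" "word_class V (raag_relators \<Delta>) w \<noteq> {}"
    by blast+
  have "word_class V (raag_relators \<Delta>) u \<otimes>\<^bsub>raag \<Delta>\<^esub> word_class V (raag_relators \<Delta>) w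
      = (\<Union>u'\<in>word_class V (raag_relators \<Delta>) u. \<Union>w'\<in>word_class V (raag_relators \<Delta>) w.
          word_class V (raag_relators \<Delta>) (u' @ w'))"
    by (simp add: raag_def presented_group_def raag_relators_def[symmetric])
  also have "\<dots> = (\<Union>u'\<in>word_class V (raag_relators \<Delta>) u. \<Union>w'\<in>word_class V (raag_relators \<Delta>) w.
          word_class V (raag_relators \<Delta>) (u @ w))"
    by (intro SUP_cong refl *)
  also have "\<dots> = word_class V (raag_relators \<Delta>) (u @ w)"
    using ne by simp
  finally show ?thesis .
qed

end

section \<open>Crossings on the circle\<close>

lemma RZ_eq_iff: "RZ s = RZ t \<longleftrightarrow> s - t \<in> \<int>"
proof
  assume "RZ s = RZ t"
  moreover have "s \<in> RZ s" by (simp add: RZ_def)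
  ultimately show "s - t \<in> \<int>" by (simp add: RZ_def)
next
  assume *: "s - t \<in> \<int>"
  have "r - s \<in> \<int> \<longleftrightarrow> r - t \<in> \<int>" for r
    using Ints_add[OF _ *, of "r - s"] Ints_diff[OF _ *, of "r - t"] by auto
  then show "RZ s = RZ t" by (auto simp: RZ_def)
qed

definition circle_rep :: "real set \<Rightarrow> real" where
  "circle_rep A = (THE t. 0 \<le> t \<and> t < 1 \<and> RZ t = A)"

lemma RZ_frac [simp]: "RZ (frac t) = RZ t"
  by (simp add: RZ_eq_iff frac_def)

lemma frac_eq_iff: "frac s = frac t \<longleftrightarrow> s - t \<in> \<int>"
proof
  assume "frac s = frac t"
  then have "s - t = of_int (\<lfloor>s\<rfloor> - \<lfloor>t\<rfloor>)" by (simp add: frac_def algebra_simps)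
  then show "s - t \<in> \<int>" by (metis Ints_of_int)
next
  assume "s - t \<in> \<int>"
  then obtain k where "s = t + of_int k" by (metis Ints_cases diff_add_cancel add.commute)
  then show "frac s = frac t" by (simp add: frac_def)
qed

lemma circle_rep_RZ [simp]: "circle_rep (RZ t) = frac t"
proof -
  have "s = frac t" if "0 \<le> s" "s < 1" "RZ s = RZ t" for s
    using that frac_eq[of s] frac_eq_iff[of s t] by (simp add: RZ_eq_iff)
  then show ?thesis
    unfolding circle_rep_def by (intro the_equality) (auto simp: frac_lt_1)
qed

text \<open>
  The bound keeps three pairwise near points inside an arc that is short enough to compare their
  crossings of the midpoint.
\<close>

definition near :: "real set \<Rightarrow> real set \<Rightarrow> bool" where
  "near A B \<longleftrightarrow> (\<exists>s t. A = RZ s \<and> B = RZ t \<and> \<bar>s - t\<bar> < 1 / 8)"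

lemma near_sym: "near A B \<Longrightarrow> near B A"
  unfolding near_def by (metis abs_minus_commute)

lemma near_circle_rep:
  assumes "near A B"
  shows "0 \<le> circle_rep A" "circle_rep A < 1" "0 \<le> circle_rep B" "circle_rep B < 1"
    "\<bar>circle_rep A - circle_rep B\<bar> < 1 / 8 \<or> \<bar>circle_rep A - circle_rep B\<bar> > 7 / 8"
proof -
  obtain s t where st: "A = RZ s" "B = RZ t" "\<bar>s - t\<bar> < 1 / 8" using assms by (auto simp: near_def)
  then show r: "0 \<le> circle_rep A" "circle_rep A < 1" "0 \<le> circle_rep B" "circle_rep B < 1" by (auto simp: frac_lt_1)
  define k where "k = \<lfloor>s\<rfloor> - \<lfloor>t\<rfloor>"
  have eq: "circle_rep A - circle_rep B = (s - t) - of_int k" using st by (simp add: frac_def k_def)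
  then have "\<bar>of_int k :: real\<bar> < 9 / 8" using r st(3) by linarith
  then have "k = -1 \<or> k = 0 \<or> k = 1" by linarith
  then have "circle_rep A - circle_rep B = s - t + 1 \<or> circle_rep A - circle_rep B = s - t \<or> circle_rep A - circle_rep B = s - t - 1"
    using eq by auto
  then show "\<bar>circle_rep A - circle_rep B\<bar> < 1 / 8 \<or> \<bar>circle_rep A - circle_rep B\<bar> > 7 / 8" using st(3) by linarith
qed

text \<open>
  The sign with which the short arc from \<open>A\<close> to \<open>B\<close> passes the midpoint of the circle. The bound on the
  difference of representatives excludes points whose short arc passes through the base point instead.
\<close>

definition crossing :: "real set \<Rightarrow> real set \<Rightarrow> int" where
  "crossing A B =
     (if circle_rep A < 1 / 2 \<and> 1 / 2 \<le> circle_rep B \<and> circle_rep B - circle_rep A < 1 / 2 then 1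
      else if circle_rep B < 1 / 2 \<and> 1 / 2 \<le> circle_rep A \<and> circle_rep A - circle_rep B < 1 / 2 then - 1 else 0)"

lemma crossing_refl [simp]: "crossing A A = 0"
  by (simp add: crossing_def)

lemma abs_crossing_le: "\<bar>crossing A B\<bar> \<le> 1"
  by (simp add: crossing_def)

lemma crossing_nonzero:
  assumes "near A B" "crossing A B \<noteq> 0"
  shows "A \<noteq> RZ 0" "B \<noteq> RZ 0"
  using near_circle_rep[OF assms(1)] assms(2) by (auto simp: crossing_def split: if_splits)

text \<open>
  On the middle half of the circle the representative is continuous, and the crossing number becomes
  the increment of a function.
\<close>

definition middle :: "real set \<Rightarrow> bool" where
  "middle A \<longleftrightarrow> 1 / 4 < circle_rep A \<and> circle_rep A < 3 / 4"

lemma crossing_middle: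
  assumes "middle A" "middle B"
  shows "crossing A B = of_bool (1 / 2 \<le> circle_rep B) - of_bool (1 / 2 \<le> circle_rep A)"
  using assms by (auto simp: crossing_def middle_def)

lemma crossing_nonzero_middle:
  assumes AB: "near A B" "crossing A B \<noteq> 0" and C: "near A C" "near B C"
  shows "middle A \<and> middle B \<and> middle C"
proof -
  have "\<bar>circle_rep A - circle_rep B\<bar> < 1 / 8"
    using near_circle_rep(5)[OF AB(1)] AB(2) by (auto simp: crossing_def split: if_splits)
  moreover have "circle_rep A < 1 / 2 \<and> 1 / 2 \<le> circle_rep B \<or> circle_rep B < 1 / 2 \<and> 1 / 2 \<le> circle_rep A"
    using AB(2) by (auto simp: crossing_def split: if_splits)
  ultimately have ab: "3 / 8 < circle_rep A" "circle_rep A < 5 / 8" "3 / 8 < circle_rep B" "circle_rep B < 5 / 8"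
    by linarith+
  then have "\<bar>circle_rep A - circle_rep C\<bar> < 1 / 8" using near_circle_rep[OF C(1)] by linarith
  then show ?thesis using ab unfolding middle_def by linarith
qed

text \<open>
  If one of the crossing numbers is nonzero, then all three points lie in the middle half, where crossing
  numbers are increments; otherwise there is nothing to add.
\<close>

lemma crossing_cocycle:
  assumes "near A B" "near B C" "near A C"
  shows "crossing A B + crossing B C = crossing A C"
proof (cases "crossing A B = 0 \<and> crossing B C = 0 \<and> crossing A C = 0")
  case False
  then have "middle A \<and> middle B \<and> middle C"
    using assms crossing_nonzero_middle[of A B C] crossing_nonzero_middle[of B C A]
      crossing_nonzero_middle[of A C B] near_sym by blast
  then show ?thesis by (simp add: crossing_middle)
qed simp

section \<open>The word along a path in the complex of the Artin group\<close>

lemma pathin_mem: "pathin X p \<Longrightarrow> t \<in> {0..1} \<Longrightarrow> p t \<in> topspace X"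
  unfolding pathin_def continuous_map_def by auto

lemma pathin_loop_concat:
  assumes "pathin X p" "pathin X q" "p 1 = q 0"
  shows "pathin X (loop_concat p q)"
  unfolding pathin_def loop_concat_def
proof (rule continuous_map_cases_le)
  let ?I = "top_of_set {0..1::real}"
  have "continuous_map (subtopology ?I {t \<in> topspace ?I. t \<le> 1 / 2}) ?I (\<lambda>t. 2 * t)"
    by (auto simp: subtopology_subtopology intro!: continuous_intros)
  from continuous_map_compose[OF this assms(1)[unfolded pathin_def]]
  show "continuous_map (subtopology ?I {t \<in> topspace ?I. t \<le> 1 / 2}) X (\<lambda>t. p (2 * t))"
    by (simp add: o_def)
  have "continuous_map (subtopology ?I {t \<in> topspace ?I. 1 / 2 \<le> t}) ?I (\<lambda>t. 2 * t - 1)"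
    by (auto simp: subtopology_subtopology intro!: continuous_intros)
  from continuous_map_compose[OF this assms(2)[unfolded pathin_def]]
  show "continuous_map (subtopology ?I {t \<in> topspace ?I. 1 / 2 \<le> t}) X (\<lambda>t. q (2 * t - 1))"
    by (simp add: o_def)
qed (use assms(3) in \<open>auto intro!: continuous_intros simp: field_simps\<close>)

context finite_raag
begin

abbreviation "T \<equiv> raag_complex \<Delta>"

definition vertex_list :: "'v list" where
  "vertex_list = (SOME vs. distinct vs \<and> set vs = V)"

lemma vertex_list: "distinct vertex_list" "set vertex_list = V"
  using someI_ex[OF finite_distinct_list[OF finite_verts, unfolded conj_commute[of "_ = _"]]]
  by (auto simp: vertex_list_def conj_commute)

definition close :: "('v \<Rightarrow> real set) \<Rightarrow> ('v \<Rightarrow> real set) \<Rightarrow> bool" where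
  "close x y \<longleftrightarrow> (\<forall>v\<in>V. near (x v) (y v))"

text \<open>
  The generators crossed between two close points of the complex commute, so the order of the factors only selects a
  representative of the class.
\<close>

definition jump :: "('v \<Rightarrow> real set) \<Rightarrow> ('v \<Rightarrow> real set) \<Rightarrow> 'v word" where
  "jump x y = concat (map (\<lambda>v. power_word v (crossing (x v) (y v))) vertex_list)"

lemma jump_in [simp]: "jump x y \<in> W"
  unfolding jump_def by (intro concat_in_W) (simp add: vertex_list)

lemma jump_refl [simp]: "jump x x = []"
  by (simp add: jump_def power_word_def)

lemma topspace_T_clique:
  assumes "x \<in> topspace T" "u \<in> V" "v \<in> V" "x u \<noteq> RZ 0" "x v \<noteq> RZ 0" "u \<noteq> v"
  shows "{u, v} \<in> edges \<Delta>"
proof -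
  obtain U where U: "U \<in> cliques \<Delta>" "x \<in> subtorus V U"
    using assms(1) by (auto simp: raag_complex_def)
  then have "u \<in> U" "v \<in> U" using assms by (auto simp: subtorus_def)
  then show ?thesis using U(1) assms(6) by (simp add: cliques_def)
qed

text \<open>
  Every coordinate crossed on the way to \<open>y\<close> or from \<open>y\<close> differs from the base point at \<open>y\<close>. The
  support of a point of the complex is a clique, so all generators involved commute.
\<close>

lemma jump_cocycle:
  assumes "y \<in> topspace T" and xyz: "close x y" "close y z" "close x z"
  shows "jump x y @ jump y z \<simeq> jump x z"
  unfolding jump_def
proof (rule concat_merge)
  fix v assume v: "v \<in> set vertex_list"
  then have "near (x v) (y v)" "near (y v) (z v)" "near (x v) (z v)"
    using xyz by (auto simp: close_def vertex_list)
  then have "crossing (x v) (y v) + crossing (y v) (z v) = crossing (x v) (z v)"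
    by (rule crossing_cocycle)
  then show "power_word v (crossing (x v) (y v)) \<in> W \<and> power_word v (crossing (y v) (z v)) \<in> W \<and>
      power_word v (crossing (x v) (z v)) \<in> W \<and>
      power_word v (crossing (x v) (y v)) @ power_word v (crossing (y v) (z v))
      \<simeq> power_word v (crossing (x v) (z v))"
    using v power_word_add[of v "crossing (x v) (y v)" "crossing (y v) (z v)"]
      abs_crossing_le[of "x v" "y v"] abs_crossing_le[of "y v" "z v"] abs_crossing_le[of "x v" "z v"]
    by (simp add: vertex_list)
next
  fix u v assume uv: "u \<in> set vertex_list" "v \<in> set vertex_list" "u \<noteq> v"
  show "power_word u (crossing (y u) (z u)) @ power_word v (crossing (x v) (y v))
      \<simeq> power_word v (crossing (x v) (y v)) @ power_word u (crossing (y u) (z u))"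
  proof (cases "crossing (y u) (z u) = 0 \<or> crossing (x v) (y v) = 0")
    case True then show ?thesis by (auto simp: power_word_def)
  next
    case False
    have "near (y u) (z u)" "near (x v) (y v)" using xyz uv by (auto simp: close_def vertex_list)
    then have "y u \<noteq> RZ 0" "y v \<noteq> RZ 0" using False crossing_nonzero by blast+
    then have "{u, v} \<in> edges \<Delta>" using topspace_T_clique[OF assms(1)] uv by (auto simp: vertex_list)
    then show ?thesis by (rule power_word_commute)
  qed
qed (simp add: vertex_list)

definition jump_trace :: "(nat \<Rightarrow> 'v \<Rightarrow> real set) \<Rightarrow> nat \<Rightarrow> 'v word" where
  "jump_trace x m = concat (map (\<lambda>i. jump (x i) (x (Suc i))) [0..<m])"

lemma trace_0 [simp]: "jump_trace x 0 = []"
  by (simp add: jump_trace_def)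

lemma trace_Suc: "jump_trace x (Suc m) = jump_trace x m @ jump (x m) (x (Suc m))"
  by (simp add: jump_trace_def)

lemma trace_in [simp]: "jump_trace x m \<in> W"
  by (induction m) (simp_all add: trace_Suc del: append_in_lists_conv add: append_in_lists_conv)

lemma trace_add: "jump_trace x (m + k) = jump_trace x m @ jump_trace (\<lambda>i. x (m + i)) k"
  by (induction k) (simp_all add: trace_Suc)

lemma trace_cong: "(\<And>i. i \<le> m \<Longrightarrow> x i = y i) \<Longrightarrow> jump_trace x m = jump_trace y m"
  by (induction m) (simp_all add: trace_Suc)

lemma trace_close:
  assumes "\<And>i. i \<le> m \<Longrightarrow> x i \<in> topspace T" "\<And>i j. i \<le> m \<Longrightarrow> j \<le> m \<Longrightarrow> close (x i) (x j)"
  shows "jump_trace x m \<simeq> jump (x 0) (x m)"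
  using assms
proof (induction m)
  case (Suc m)
  have "jump_trace x (Suc m) \<simeq> jump (x 0) (x m) @ jump (x m) (x (Suc m))"
    unfolding trace_Suc using Suc by (intro weq_append) auto
  also have "\<dots> \<simeq> jump (x 0) (x (Suc m))" using Suc.prems by (intro jump_cocycle) auto
  finally show ?case .
qed simp

text \<open>
  Subdividing does not change the word: within a block of \<open>M\<close> mutually close points the jumps
  telescope to the jump between the ends of the block.
\<close>

lemma trace_refine:
  assumes "\<And>i. i \<le> N * M \<Longrightarrow> x i \<in> topspace T"
    and "\<And>k i j. k < N \<Longrightarrow> i \<le> M \<Longrightarrow> j \<le> M \<Longrightarrow> close (x (k * M + i)) (x (k * M + j))"
  shows "jump_trace x (N * M) \<simeq> jump_trace (\<lambda>k. x (k * M)) N"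
  using assms
proof (induction N)
  case (Suc N)
  have 1: "jump_trace x (N * M) \<simeq> jump_trace (\<lambda>k. x (k * M)) N" using Suc by auto
  have "jump_trace (\<lambda>i. x (N * M + i)) M \<simeq> jump (x (N * M + 0)) (x (N * M + M))"
    using Suc.prems by (intro trace_close) auto
  then have 2: "jump_trace (\<lambda>i. x (N * M + i)) M \<simeq> jump (x (N * M)) (x (Suc N * M))"
    by (simp add: add.commute)
  have "jump_trace x (Suc N * M) = jump_trace x (N * M) @ jump_trace (\<lambda>i. x (N * M + i)) M"
    using trace_add[of x "N * M" M] by (simp add: add.commute)
  also have "\<dots> \<simeq> jump_trace (\<lambda>k. x (k * M)) (Suc N)"
    unfolding trace_Suc using 1 2 by (intro weq_append) auto
  finally show ?case .
qed simp

text \<open>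
  A discrete homotopy: in every square between two neighbouring chains of points, both ways around give
  the same class.
\<close>

lemma trace_ladder:
  assumes "\<And>i. i \<le> m \<Longrightarrow> x i \<in> topspace T \<and> y i \<in> topspace T \<and> close (x i) (y i)"
    and "\<And>i. i < m \<Longrightarrow> close (x i) (x (Suc i)) \<and> close (y i) (y (Suc i)) \<and> close (x i) (y (Suc i))"
  shows "jump_trace x m @ jump (x m) (y m) \<simeq> jump (x 0) (y 0) @ jump_trace y m"
  using assms
proof (induction m)
  case (Suc m)
  have IH: "jump_trace x m @ jump (x m) (y m) \<simeq> jump (x 0) (y 0) @ jump_trace y m" using Suc by auto
  have sq: "jump (x m) (x (Suc m)) @ jump (x (Suc m)) (y (Suc m))
      \<simeq> jump (x m) (y m) @ jump (y m) (y (Suc m))"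
  proof -
    have "jump (x m) (x (Suc m)) @ jump (x (Suc m)) (y (Suc m)) \<simeq> jump (x m) (y (Suc m))"
      using Suc.prems by (intro jump_cocycle) auto
    moreover have "jump (x m) (y m) @ jump (y m) (y (Suc m)) \<simeq> jump (x m) (y (Suc m))"
      using Suc.prems by (intro jump_cocycle) auto
    ultimately show ?thesis using weq_trans weq_sym by blast
  qed
  have "jump_trace x (Suc m) @ jump (x (Suc m)) (y (Suc m))
      \<simeq> jump_trace x m @ jump (x m) (y m) @ jump (y m) (y (Suc m))"
    using weq_context[OF sq, of "jump_trace x m" "[]"] by (simp add: trace_Suc)
  also have "\<dots> \<simeq> jump (x 0) (y 0) @ jump_trace y m @ jump (y m) (y (Suc m))"
    using weq_context[OF IH, of "[]" "jump (y m) (y (Suc m))"] by simp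
  finally show ?case by (simp add: trace_Suc)
qed simp

definition mesh :: "(real \<Rightarrow> 'v \<Rightarrow> real set) \<Rightarrow> nat \<Rightarrow> bool" where
  "mesh p N \<longleftrightarrow> N > 0 \<and> (\<forall>s\<in>{0..1}. \<forall>t\<in>{0..1}. \<bar>s - t\<bar> \<le> 1 / N \<longrightarrow> close (p s) (p t))"

definition grid_word :: "(real \<Rightarrow> 'v \<Rightarrow> real set) \<Rightarrow> nat \<Rightarrow> 'v word" where
  "grid_word p N = jump_trace (\<lambda>i. p (i / N)) N"

lemma grid_word_in [simp]: "grid_word p N \<in> W"
  by (simp add: grid_word_def)

lemma mesh_mono: "mesh p N \<Longrightarrow> N \<le> M \<Longrightarrow> mesh p M"
proof -
  assume *: "mesh p N" "N \<le> M"
  then have "1 / real M \<le> 1 / real N" by (auto simp: mesh_def intro!: divide_left_mono mult_pos_pos)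
  then show "mesh p M" using * unfolding mesh_def by force
qed

lemma grid_word_refine:
  assumes p: "pathin T p" and N: "mesh p N" and M: "M > 0"
  shows "grid_word p (N * M) \<simeq> grid_word p N"
proof -
  have N0: "N > 0" using N by (simp add: mesh_def)
  have "jump_trace (\<lambda>i. p (real i / real (N * M))) (N * M) \<simeq> jump_trace (\<lambda>k. p (real (k * M) / real (N * M))) N"
  proof (rule trace_refine)
    fix i assume "i \<le> N * M"
    then have "real i \<le> real (N * M)" by (simp only: of_nat_le_iff)
    then have "real i / real (N * M) \<in> {0..1}" using N0 M by simp
    then show "p (real i / real (N * M)) \<in> topspace T" using pathin_mem[OF p] by blast
  next
    fix k i j assume kij: "k < N" "i \<le> M" "j \<le> M"
    have *: "real (k * M + i') / real (N * M) \<in> {0..1}" if "i' \<le> M" for i'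
    proof -
      have "k * M + i' \<le> (k + 1) * M" using that by simp
      also have "\<dots> \<le> N * M" using kij by (intro mult_right_mono) auto
      finally have "real (k * M + i') \<le> real (N * M)" by (simp only: of_nat_le_iff)
      then show ?thesis using N0 M by simp
    qed
    have "\<bar>real (k * M + i) / real (N * M) - real (k * M + j) / real (N * M)\<bar> = \<bar>real i - real j\<bar> / real (N * M)"
      using N0 M by (simp add: diff_divide_distrib[symmetric])
    also have "\<dots> \<le> M / real (N * M)"
      using kij N0 M by (intro divide_right_mono) auto
    also have "\<dots> = 1 / N" using M by simp
    finally show "close (p (real (k * M + i) / real (N * M))) (p (real (k * M + j) / real (N * M)))"
      using N * kij unfolding mesh_def by blast
  qed
  moreover have "real (k * M) / real (N * M) = k / N" for k using M by simp
  ultimately show ?thesis by (simp add: grid_word_def)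
qed

lemma grid_word_unique:
  assumes "pathin T p" "mesh p N" "mesh p M"
  shows "grid_word p N \<simeq> grid_word p M"
  using grid_word_refine[OF assms(1,2), of M] grid_word_refine[OF assms(1,3), of N] assms(2,3)
  by (metis mesh_def mult.commute weq_sym weq_trans)

lemma arc_open: "openin (quotient_topology euclideanreal RZ) {RZ t | t. \<bar>t - a\<bar> < 1 / 16}"
proof -
  have "{x. RZ x \<in> {RZ t | t. \<bar>t - a\<bar> < 1 / 16}} = (\<Union>k\<in>\<int>. {x. \<bar>x - k - a\<bar> < 1 / 16})"
  proof -
    have "(\<exists>t. RZ x = RZ t \<and> \<bar>t - a\<bar> < 1 / 16) \<longleftrightarrow> (\<exists>k\<in>\<int>. \<bar>x - k - a\<bar> < 1 / 16)" for x
    proof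
      assume "\<exists>t. RZ x = RZ t \<and> \<bar>t - a\<bar> < 1 / 16"
      then obtain t where "x - t \<in> \<int>" "\<bar>t - a\<bar> < 1 / 16" by (auto simp: RZ_eq_iff)
      then show "\<exists>k\<in>\<int>. \<bar>x - k - a\<bar> < 1 / 16" by (intro bexI[of _ "x - t"]) auto
    next
      assume "\<exists>k\<in>\<int>. \<bar>x - k - a\<bar> < 1 / 16"
      then obtain k where "k \<in> \<int>" "\<bar>x - k - a\<bar> < 1 / 16" by auto
      then show "\<exists>t. RZ x = RZ t \<and> \<bar>t - a\<bar> < 1 / 16"
        by (intro exI[of _ "x - k"]) (auto simp: RZ_eq_iff)
    qed
    then show ?thesis by auto
  qed
  moreover have "open {x::real. \<bar>x - k - a\<bar> < 1 / 16}" for k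
    by (intro open_Collect_less continuous_intros)
  ultimately have "open {x. RZ x \<in> {RZ t | t. \<bar>t - a\<bar> < 1 / 16}}" by auto
  moreover have "{RZ t | t. \<bar>t - a\<bar> < 1 / 16} \<subseteq> range RZ" by blast
  ultimately show ?thesis
    by (simp only: openin_quotient_topology topspace_euclidean open_openin simp_thms UNIV_I)
qed

text \<open>
  Arcs of length \<open>1 / 8\<close> are open in the circle; a Lebesgue number for the cover of \<open>K\<close> by their preimages
  works for one coordinate, and there are finitely many coordinates.
\<close>

lemma uniformly_close:
  fixes K :: "'x::metric_space set"
  assumes K: "compact K" and h: "continuous_map (top_of_set K) T h"
  obtains d where "d > 0" "\<And>x y. x \<in> K \<Longrightarrow> y \<in> K \<Longrightarrow> dist x y < d \<Longrightarrow> close (h x) (h y)"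
proof -
  have "\<exists>d>0. \<forall>x\<in>K. \<forall>y\<in>K. dist x y < d \<longrightarrow> near (h x v) (h y v)" if v: "v \<in> V" for v
  proof -
    have hv: "continuous_map (top_of_set K) (quotient_topology euclideanreal RZ) (\<lambda>x. h x v)"
      using h v unfolding raag_complex_def torus_def continuous_map_in_subtopology
      by (auto dest: continuous_map_product_then_coordinatewise)
    define C where C: "C = {B. open B \<and> (\<exists>a. \<forall>x\<in>K \<inter> B. h x v \<in> {RZ t | t. \<bar>t - a\<bar> < 1 / 16})}"
    have cover: "K \<subseteq> \<Union> C"
    proof
      fix x assume x: "x \<in> K"
      then have "h x v \<in> range RZ" using hv by (auto simp: continuous_map_def)
      then obtain a where a: "h x v = RZ a" by auto
      have "openin (top_of_set K) {y \<in> K. h y v \<in> {RZ t | t. \<bar>t - a\<bar> < 1 / 16}}"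
        using openin_continuous_map_preimage[OF hv arc_open[of a]] by simp
      then obtain B where B: "open B" "{y \<in> K. h y v \<in> {RZ t | t. \<bar>t - a\<bar> < 1 / 16}} = K \<inter> B"
        by (auto simp: openin_open)
      have "B \<in> C" unfolding C using B by blast
      moreover have "x \<in> B" using B(2) x a by force
      ultimately show "x \<in> \<Union> C" by blast
    qed
    have "{} \<in> C" by (auto simp: C)
    then have "C \<noteq> {}" by blast
    moreover have "open B" if "B \<in> C" for B using that by (simp add: C)
    ultimately obtain d where d: "d > 0" "\<And>T. \<lbrakk>T \<subseteq> K; diameter T < d\<rbrakk> \<Longrightarrow> \<exists>B\<in>C. T \<subseteq> B"
      using Lebesgue_number_lemma[OF K _ cover] by metis
    have "near (h x v) (h y v)" if xy: "x \<in> K" "y \<in> K" "dist x y < d" for x y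
    proof -
      have "diameter {x, y} \<le> dist x y"
        by (simp only: diameter_def insert_not_empty if_False) (rule cSUP_least, auto simp: dist_commute)
      then have "diameter {x, y} < d" using xy by linarith
      moreover have "{x, y} \<subseteq> K" using xy by simp
      ultimately obtain B where B: "B \<in> C" "{x, y} \<subseteq> B" using d(2) by metis
      then obtain a where a: "\<And>z. z \<in> K \<inter> B \<Longrightarrow> h z v \<in> {RZ t | t. \<bar>t - a\<bar> < 1 / 16}"
        by (auto simp: C)
      obtain s t where "h x v = RZ s" "\<bar>s - a\<bar> < 1 / 16" "h y v = RZ t" "\<bar>t - a\<bar> < 1 / 16"
        using a[of x] a[of y] xy B(2) by auto
      moreover from this have "\<bar>s - t\<bar> < 1 / 8" by linarith
      ultimately show ?thesis unfolding near_def by blast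
    qed
    then show ?thesis using d(1) by blast
  qed
  then obtain d where d: "\<And>v. v \<in> V \<Longrightarrow> d v > 0"
    "\<And>v x y. v \<in> V \<Longrightarrow> x \<in> K \<Longrightarrow> y \<in> K \<Longrightarrow> dist x y < d v \<Longrightarrow> near (h x v) (h y v)"
    by metis
  show thesis
  proof (rule that[of "Min (insert 1 (d ` V))"])
    show "Min (insert 1 (d ` V)) > 0" using finite_verts d(1) by simp
    show "close (h x) (h y)" if "x \<in> K" "y \<in> K" "dist x y < Min (insert 1 (d ` V))" for x y
      using that finite_verts d(2) by (auto simp: close_def)
  qed
qed

lemma mesh_exists:
  assumes "pathin T p" obtains N where "mesh p N"
proof -
  obtain d where d: "d > 0" "\<And>x y. x \<in> {0..1} \<Longrightarrow> y \<in> {0..1} \<Longrightarrow> dist x y < d \<Longrightarrow> close (p x) (p y)"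
    using uniformly_close[of "{0..1::real}" p] assms by (auto simp: pathin_def)
  obtain m where "1 / real (Suc m) < d" using nat_approx_posE[OF d(1)] .
  then obtain N where N: "N > 0" "1 / real N < d" by blast
  have "mesh p N"
    unfolding mesh_def
  proof (intro conjI ballI impI d(2))
    show "dist s t < d" if "\<bar>s - t\<bar> \<le> 1 / real N" for s t
      using that N(2) by (simp add: dist_real_def)
  qed (use N in auto)
  then show thesis by (rule that)
qed

text \<open>
  All sufficiently fine grids give the same class, see \<open>grid_word_unique\<close>.
\<close>

definition path_word :: "(real \<Rightarrow> 'v \<Rightarrow> real set) \<Rightarrow> 'v word" where
  "path_word p = grid_word p (SOME N. mesh p N)"

lemma path_word_in [simp]: "path_word p \<in> W"
  by (simp add: path_word_def)

lemma path_word_grid: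
  assumes "pathin T p" "mesh p N" shows "path_word p \<simeq> grid_word p N"
  unfolding path_word_def using assms by (metis grid_word_unique someI)

text \<open>
  A grid on the square that is fine for \<open>h\<close> turns the homotopy into a sequence of ladders. The outermost
  rungs are trivial because the end points do not move.
\<close>

lemma path_word_homotopy:
  fixes h :: "real \<times> real \<Rightarrow> 'v \<Rightarrow> real set"
  assumes h: "continuous_map (top_of_set ({0..1} \<times> {0..1})) T h"
    and ends: "\<And>s. s \<in> {0..1} \<Longrightarrow> h (s, 0) = x0 \<and> h (s, 1) = x1"
  shows "path_word (\<lambda>t. h (0, t)) \<simeq> path_word (\<lambda>t. h (1, t))"
proof -
  obtain d where d: "d > 0" "\<And>x y. x \<in> {0..1} \<times> {0..1} \<Longrightarrow> y \<in> {0..1} \<times> {0..1} \<Longrightarrow> dist x y < d \<Longrightarrow> close (h x) (h y)"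
    using uniformly_close[OF _ h] by (auto simp: compact_Times)
  obtain m where "1 / real (Suc m) < d / 2" using nat_approx_posE[OF half_gt_zero[OF d(1)]] .
  then obtain N where N: "N > 0" "1 / real N < d / 2" by blast
  have cl: "close (h (s, t)) (h (s', t'))"
    if "s \<in> {0..1}" "t \<in> {0..1}" "s' \<in> {0..1}" "t' \<in> {0..1}" "\<bar>s - s'\<bar> \<le> 1 / N" "\<bar>t - t'\<bar> \<le> 1 / N" for s t s' t'
  proof -
    have "dist (s, t) (s', t') \<le> \<bar>s - s'\<bar> + \<bar>t - t'\<bar>"
      unfolding dist_prod_def dist_real_def fst_conv snd_conv
      using sqrt_sum_squares_le_sum_abs[of "\<bar>s - s'\<bar>" "\<bar>t - t'\<bar>"] by simp
    then have "dist (s, t) (s', t') < d" using that N by linarith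
    then show ?thesis using d(2) that by auto
  qed
  have mem: "h (s, t) \<in> topspace T" if "s \<in> {0..1}" "t \<in> {0..1}" for s t
    using h that by (auto simp: continuous_map_def)
  have frac: "real i / N \<in> {0..1}" if "i \<le> N" for i using that N by auto
  have step: "\<bar>real i / N - real (Suc i) / N\<bar> \<le> 1 / N" for i
    by (simp add: diff_divide_distrib[symmetric])
  have ladder: "grid_word (\<lambda>t. h (s, t)) N \<simeq> grid_word (\<lambda>t. h (s', t)) N"
    if s: "s \<in> {0..1}" "s' \<in> {0..1}" "\<bar>s - s'\<bar> \<le> 1 / N" for s s'
  proof -
    have "jump_trace (\<lambda>i. h (s, i / N)) N @ jump (h (s, N / N)) (h (s', N / N))
        \<simeq> jump (h (s, 0 / N)) (h (s', 0 / N)) @ jump_trace (\<lambda>i. h (s', i / N)) N"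
      by (rule trace_ladder[of N "\<lambda>i. h (s, i / N)" "\<lambda>i. h (s', i / N)", simplified of_nat_0])
        (use s step in \<open>auto intro!: mem cl frac simp del: of_nat_Suc\<close>)
    then show ?thesis using N ends s by (simp add: grid_word_def)
  qed
  have pw: "path_word (\<lambda>t. h (s, t)) \<simeq> grid_word (\<lambda>t. h (s, t)) N" if "s \<in> {0..1}" for s
  proof (rule path_word_grid)
    have "continuous_map (top_of_set {0..1}) (top_of_set ({0..1} \<times> {0..1})) (\<lambda>t. (s, t))"
      using that by (auto intro!: continuous_intros)
    from continuous_map_compose[OF this h] show "pathin T (\<lambda>t. h (s, t))"
      by (simp add: pathin_def o_def)
    show "mesh (\<lambda>t. h (s, t)) N" unfolding mesh_def using N that by (auto intro!: cl)
  qed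
  have "grid_word (\<lambda>t. h (0, t)) N \<simeq> grid_word (\<lambda>t. h (i / N, t)) N" if "i \<le> N" for i
    using that
  proof (induction i)
    case (Suc i)
    then have "grid_word (\<lambda>t. h (0, t)) N \<simeq> grid_word (\<lambda>t. h (i / N, t)) N" by simp
    also have "\<dots> \<simeq> grid_word (\<lambda>t. h (Suc i / N, t)) N"
      by (rule ladder) (use Suc step in \<open>auto intro!: frac simp del: of_nat_Suc\<close>)
    finally show ?case .
  qed simp
  from this[of N] have "grid_word (\<lambda>t. h (0, t)) N \<simeq> grid_word (\<lambda>t. h (1, t)) N" using N by simp
  then show ?thesis using pw[of 0] pw[of 1] by (auto intro: weq_trans weq_sym)
qed

text \<open>
  The grid with \<open>2 N\<close> steps on the concatenation consists of the grids with \<open>N\<close> steps on both paths.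
\<close>

lemma path_word_concat:
  assumes p: "pathin T p" and q: "pathin T q" and pq: "p 1 = q 0"
  shows "path_word (loop_concat p q) \<simeq> path_word p @ path_word q"
proof -
  have c: "pathin T (loop_concat p q)" using assms by (rule pathin_loop_concat)
  obtain N1 N2 N3 where "mesh p N1" "mesh q N2" "mesh (loop_concat p q) N3"
    using mesh_exists p q c by metis
  then have N: "mesh p (N1 + N2 + N3)" "mesh q (N1 + N2 + N3)"
    "mesh (loop_concat p q) ((N1 + N2 + N3) + (N1 + N2 + N3))"
    by (auto intro: mesh_mono)
  define N where "N = N1 + N2 + N3"
  have N0: "N > 0" using N(1) by (simp add: mesh_def N_def)
  have "jump_trace (\<lambda>i. loop_concat p q (i / (N + N))) (N + N) =
      jump_trace (\<lambda>i. p (i / N)) N @ jump_trace (\<lambda>i. q (i / N)) N"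
    unfolding trace_add
  proof (intro arg_cong2[where f="(@)"] trace_cong)
    fix i assume "i \<le> N"
    then have "real i / (N + N) \<le> 1/2" "2 * (real i / (N + N)) = i / N"
      using N0 by (auto simp: field_simps)
    then show "loop_concat p q (real i / (N + N)) = p (i / N)" by (simp add: loop_concat_def)
  next
    fix i assume "i \<le> N"
    have eq: "2 * (real (N + i) / (N + N)) - 1 = i / N" using N0 by (simp add: field_simps)
    show "loop_concat p q (real (N + i) / (N + N)) = q (i / N)"
    proof (cases "i = 0")
      case True
      have "real (N + i) / (N + N) = 1/2" using True N0 by (simp add: field_simps)
      then show ?thesis using True pq N0 by (simp add: loop_concat_def)
    next
      case False
      then have "real (N + i) / (N + N) > 1/2" using N0 by (simp add: field_simps)
      then show ?thesis using eq by (simp add: loop_concat_def)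
    qed
  qed
  then have "grid_word (loop_concat p q) (N + N) = grid_word p N @ grid_word q N"
    by (simp add: grid_word_def)
  moreover have "path_word (loop_concat p q) \<simeq> grid_word (loop_concat p q) (N + N)"
    using N(3) path_word_grid[OF c] by (simp add: N_def)
  moreover have "grid_word p N @ grid_word q N \<simeq> path_word p @ path_word q"
    using N weq_sym[OF path_word_grid[OF p]] weq_sym[OF path_word_grid[OF q]]
    by (intro weq_append) (auto simp: N_def)
  ultimately show ?thesis using weq_trans by simp
qed

end

section \<open>Configurations seen from a corner\<close>

abbreviation supp :: "('b \<Rightarrow> real) \<Rightarrow> 'b set" where
  "supp q \<equiv> {v. q v \<noteq> 0}"

lemma supp_vertex_point [simp]: "supp (vertex_point v) = {v}"
  by (auto simp: vertex_point_def indicator_def)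

lemma edge_point_apply:
  "edge_point (s, w) t v = (if v = s then 1 - t else 0) + (if v = w then t else 0)"
  by (auto simp: edge_point_def vertex_point_def indicator_def)

lemma edge_point_0 [simp]: "edge_point (s, w) 0 = vertex_point s"
  by (auto simp: edge_point_def)

lemma edge_point_swap: "edge_point (w, s) (1 - t) = edge_point (s, w) t"
  by (auto simp: edge_point_def fun_eq_iff)

locale oriented_graph =
  fixes G :: "'a ugraph" and ori :: "'a set \<Rightarrow> 'a \<times> 'a" and n :: nat
  assumes finite_graph: "finite_graph G" and orientation: "orientation G ori"
begin

abbreviation "E \<equiv> edges G"
abbreviation "X \<equiv> topspace (conf_space n G)"

lemma edge_subset: "e \<in> E \<Longrightarrow> e \<subseteq> verts G"
  using finite_graph by (auto simp: finite_graph_def)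

lemma edge_card: "e \<in> E \<Longrightarrow> card e = 2"
  using finite_graph by (auto simp: finite_graph_def)

lemma edge_ends:
  assumes "e \<in> E"
  shows "e = {fst (ori e), snd (ori e)}" "fst (ori e) \<noteq> snd (ori e)"
proof -
  show e: "e = {fst (ori e), snd (ori e)}" using orientation assms by (auto simp: orientation_def)
  show "fst (ori e) \<noteq> snd (ori e)"
  proof
    assume "fst (ori e) = snd (ori e)"
    then have "card e = 1" by (subst e) simp
    then show False using edge_card[OF assms] by simp
  qed
qed

lemma edge_pair:
  assumes "e \<in> E" obtains u w where "e = {u, w}" "u \<noteq> w" "ori e = (u, w)"
  using edge_ends[OF assms] prod.collapse[of "ori e"] by metis

lemma finite_verts: "finite (verts G)"
  using finite_graph by (simp add: finite_graph_def)

lemma finite_E: "finite E"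
proof (rule finite_subset)
  show "E \<subseteq> Pow (verts G)" using edge_subset by auto
qed (simp add: finite_verts)

lemma simplexD:
  assumes "\<sigma> \<in> simplices G"
  shows "finite \<sigma>" "\<sigma> \<noteq> {}" "\<sigma> \<subseteq> verts G"
proof -
  have "e \<noteq> {}" if "e \<in> E" for e using edge_card[OF that] by auto
  then show "finite \<sigma>" "\<sigma> \<noteq> {}" "\<sigma> \<subseteq> verts G"
    using assms edge_subset finite_subset[OF _ finite_verts] by (auto simp: simplices_def)
qed

lemma vertex_point_realization [simp]: "v \<in> verts G \<Longrightarrow> vertex_point v \<in> realization G"
  unfolding realization_def by (auto simp: simplices_def) (auto simp: vertex_point_def)

lemma edge_point_realization:
  assumes "{s, w} \<in> E" "0 \<le> t" "t \<le> 1"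
  shows "edge_point (s, w) t \<in> realization G"
proof -
  have sw: "s \<noteq> w" using edge_card[OF assms(1)] by auto
  have "s \<in> verts G" "w \<in> verts G" using edge_subset[OF assms(1)] by auto
  then have "supp (edge_point (s, w) t) \<in> simplices G"
    using support_edge_point[of "(s, w)" t] sw assms by (auto simp: simplices_def)
  moreover have "(\<Sum>v\<in>supp (edge_point (s, w) t). edge_point (s, w) t v) = (\<Sum>v\<in>{s, w}. edge_point (s, w) t v)"
    by (rule sum.mono_neutral_left) (auto simp: edge_point_apply split: if_splits)
  ultimately show ?thesis using sw assms by (auto simp: realization_def edge_point_apply)
qed

lemma supp_simplex: "q \<in> realization G \<Longrightarrow> supp q \<in> simplices G"
  by (simp add: realization_def)

lemma closed_simplex_disjoint_iff:
  assumes "\<sigma> \<in> simplices G" "\<tau> \<in> simplices G"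
  shows "closed_simplex G \<sigma> \<inter> closed_simplex G \<tau> = {} \<longleftrightarrow> \<sigma> \<inter> \<tau> = {}"
proof
  assume *: "closed_simplex G \<sigma> \<inter> closed_simplex G \<tau> = {}"
  have "vertex_point v \<in> closed_simplex G \<sigma> \<inter> closed_simplex G \<tau>" if "v \<in> \<sigma> \<inter> \<tau>" for v
    using that simplexD(3)[OF assms(1)] by (auto simp: closed_simplex_def)
  then show "\<sigma> \<inter> \<tau> = {}" using * by blast
next
  assume "\<sigma> \<inter> \<tau> = {}"
  then show "closed_simplex G \<sigma> \<inter> closed_simplex G \<tau> = {}"
    using simplexD(2)[OF supp_simplex] unfolding closed_simplex_def by blast
qed

text \<open>
  The simplices containing \<open>q\<close> all contain its support, which is itself a simplex and therefore the one
  with the fewest vertices.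
\<close>

lemma carrier_simplex_eq:
  assumes q: "q \<in> realization G"
  shows "carrier_simplex G q = closed_simplex G (supp q)"
proof -
  let ?P = "\<lambda>\<sigma>. \<sigma> \<in> simplices G \<and> q \<in> closed_simplex G \<sigma>"
  have P: "?P (supp q)" using q by (simp add: supp_simplex closed_simplex_def)
  have m: "?P (arg_min card ?P)" "card (arg_min card ?P) \<le> card (supp q)"
    using arg_min_nat_lemma[of ?P, OF P, of card] P by auto
  then have "supp q \<subseteq> arg_min card ?P" "finite (arg_min card ?P)"
    by (auto simp: closed_simplex_def dest: simplexD)
  then have "supp q = arg_min card ?P" using m by (simp add: card_seteq)
  then show ?thesis by (simp add: carrier_simplex_def)
qed

lemma X_eq: "X = (\<lambda>x. x ` {..<n}) ` ordered_conf n G"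
  by (auto simp: conf_space_def ordered_conf_def PiE_iff)

lemma ordered_conf_iff:
  "f \<in> ordered_conf n G \<longleftrightarrow> f \<in> {..<n} \<rightarrow>\<^sub>E realization G \<and>
     (\<forall>i<n. \<forall>j<n. i \<noteq> j \<longrightarrow> supp (f i) \<inter> supp (f j) = {})"
proof -
  have "carrier_simplex G (f i) \<inter> carrier_simplex G (f j) = {} \<longleftrightarrow> supp (f i) \<inter> supp (f j) = {}"
    if "f \<in> {..<n} \<rightarrow>\<^sub>E realization G" "i < n" "j < n" for i j
  proof -
    have "f i \<in> realization G" "f j \<in> realization G" using that by auto
    then show ?thesis
      by (simp add: carrier_simplex_eq closed_simplex_disjoint_iff supp_simplex)
  qed
  then show ?thesis unfolding ordered_conf_def by (simp cong: conj_cong)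
qed

lemma ordered_conf_inj:
  assumes "f \<in> ordered_conf n G" shows "inj_on f {..<n}"
proof (rule inj_onI)
  fix i j assume *: "i \<in> {..<n}" "j \<in> {..<n}" "f i = f j"
  have "f i \<in> realization G" using assms * by (auto simp: ordered_conf_iff)
  then have "supp (f i) \<noteq> {}" by (rule simplexD(2)[OF supp_simplex])
  then show "i = j" using assms * by (fastforce simp: ordered_conf_iff)
qed

lemma X_iff:
  "x \<in> X \<longleftrightarrow> finite x \<and> card x = n \<and> x \<subseteq> realization G \<and>
     (\<forall>q\<in>x. \<forall>q'\<in>x. q \<noteq> q' \<longrightarrow> supp q \<inter> supp q' = {})"
proof
  assume "x \<in> X"
  then obtain f where f: "f \<in> ordered_conf n G" "x = f ` {..<n}" by (auto simp: X_eq)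
  have r: "f i \<in> realization G" if "i < n" for i using f that by (auto simp: ordered_conf_iff)
  have d: "supp (f i) \<inter> supp (f j) = {}" if "i < n" "j < n" "i \<noteq> j" for i j
    using f(1) that by (simp add: ordered_conf_iff)
  show "finite x \<and> card x = n \<and> x \<subseteq> realization G \<and>
     (\<forall>q\<in>x. \<forall>q'\<in>x. q \<noteq> q' \<longrightarrow> supp q \<inter> supp q' = {})"
  proof (intro conjI ballI impI)
    show "supp q \<inter> supp q' = {}" if q: "q \<in> x" "q' \<in> x" "q \<noteq> q'" for q q'
    proof -
      obtain i j where "i < n" "j < n" "q = f i" "q' = f j" using q f(2) by blast
      then show ?thesis using d[of i j] \<open>q \<noteq> q'\<close> by blast
    qed
    show "finite x" "x \<subseteq> realization G" using f(2) r by auto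
    show "card x = n" using f(2) card_image[OF ordered_conf_inj[OF f(1)]] by simp
  qed
next
  assume x: "finite x \<and> card x = n \<and> x \<subseteq> realization G \<and>
     (\<forall>q\<in>x. \<forall>q'\<in>x. q \<noteq> q' \<longrightarrow> supp q \<inter> supp q' = {})"
  then have fin: "finite x" "card x = n" and xr: "x \<subseteq> realization G"
    and d: "\<And>q q'. q \<in> x \<Longrightarrow> q' \<in> x \<Longrightarrow> q \<noteq> q' \<Longrightarrow> supp q \<inter> supp q' = {}" by simp_all
  obtain f where f: "bij_betw f {..<n} x"
    using ex_bij_betw_nat_finite[OF fin(1)] fin(2) by (auto simp: lessThan_atLeast0)
  then have mem: "f i \<in> x" if "i < n" for i using that by (auto simp: bij_betw_def)
  have inj: "f i \<noteq> f j" if "i < n" "j < n" "i \<noteq> j" for i j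
    using f that by (auto simp: bij_betw_def inj_on_def)
  have "f i \<in> realization G" if "i < n" for i using mem[OF that] xr by auto
  moreover have "supp (f i) \<inter> supp (f j) = {}" if "i < n" "j < n" "i \<noteq> j" for i j
    using d mem inj that by simp
  ultimately have "restrict f {..<n} \<in> ordered_conf n G" by (simp add: ordered_conf_iff)
  moreover have "x = restrict f {..<n} ` {..<n}" using f by (auto simp: bij_betw_def)
  ultimately show "x \<in> X" unfolding X_eq by blast
qed

definition corners :: "'a set set" where
  "corners = {S. S \<subseteq> verts G \<and> card S = n}"

lemma corner_finite: "S \<in> corners \<Longrightarrow> finite S"
  using finite_verts by (auto simp: corners_def dest: finite_subset)

lemma finite_corners: "finite corners"
  using finite_verts by (auto simp: corners_def)

text \<open>
  The edges along which exactly one point of the vertex configuration \<open>S\<close> can move.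
\<close>

definition leaving :: "'a set \<Rightarrow> 'a set set" where
  "leaving S = {e \<in> E. e \<inter> S \<noteq> {} \<and> \<not> e \<subseteq> S}"

lemma leavingE:
  assumes "e \<in> leaving S"
  obtains s w where "e = {s, w}" "s \<in> S" "w \<notin> S" "e \<in> E"
proof -
  have e: "e \<in> E" "e \<inter> S \<noteq> {}" "\<not> e \<subseteq> S" using assms by (auto simp: leaving_def)
  obtain u w where uw: "e = {u, w}" using edge_pair[OF e(1)] by metis
  then consider "u \<in> S" "w \<notin> S" | "w \<in> S" "u \<notin> S" using e by auto
  then show thesis
  proof cases
    case 1 then show thesis using that[of u w] uw e(1) by simp
  next
    case 2 then show thesis using that[of w u] uw e(1) by (simp add: insert_commute)
  qed
qed

lemma leaving_unique:
  assumes "e \<in> leaving S" "s \<in> e" "s \<in> S" "s' \<in> e" "s' \<in> S" shows "s = s'"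
  using assms(1) by (rule leavingE) (use assms in blast)

lemma leavingI: "{s, w} \<in> E \<Longrightarrow> s \<in> S \<Longrightarrow> w \<notin> S \<Longrightarrow> {s, w} \<in> leaving S"
  by (auto simp: leaving_def)

lemma finite_leaving [simp]: "finite (leaving S)"
  using finite_E by (auto simp: leaving_def)

lemma leaving_E: "e \<in> leaving S \<Longrightarrow> e \<in> E"
  by (simp add: leaving_def)

text \<open>
  Coordinates on the closed star of the corner \<open>S\<close>. Disjointness of the support says that all the moves can
  be carried out at the same time.
\<close>

definition heights :: "'a set \<Rightarrow> ('a set \<Rightarrow> real) set" where
  "heights S = {a. (\<forall>e. 0 \<le> a e \<and> a e \<le> 1) \<and> supp a \<subseteq> leaving S \<and> disjoint (supp a)}"

definition star_heights :: "'a set \<Rightarrow> ('a set \<Rightarrow> real) set" where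
  "star_heights S = {a \<in> heights S. \<forall>e. a e < 1}"

lemma star_heightsD: "a \<in> star_heights S \<Longrightarrow> a \<in> heights S"
  by (simp add: star_heights_def)

lemma heightsD:
  assumes "a \<in> heights S"
  shows "0 \<le> a e" "a e \<le> 1" "a e \<noteq> 0 \<Longrightarrow> e \<in> leaving S"
    "a e \<noteq> 0 \<Longrightarrow> a f \<noteq> 0 \<Longrightarrow> e \<noteq> f \<Longrightarrow> e \<inter> f = {}"
  using assms by (auto simp: heights_def pairwise_def disjnt_def)

lemma heightsI:
  assumes "\<And>e. 0 \<le> a e" "\<And>e. a e \<le> 1" "\<And>e. a e \<noteq> 0 \<Longrightarrow> e \<in> leaving S"
    "\<And>e f. a e \<noteq> 0 \<Longrightarrow> a f \<noteq> 0 \<Longrightarrow> e \<noteq> f \<Longrightarrow> e \<inter> f = {}"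
  shows "a \<in> heights S"
  using assms by (auto simp: heights_def pairwise_def disjnt_def)

text \<open>
  Barycentric coordinates of the point that starts at \<open>s\<close>. For admissible heights at most one summand is
  nonzero; the sum keeps the formula linear in \<open>a\<close>, so that continuity is evident.
\<close>

definition star_point :: "'a set \<Rightarrow> ('a set \<Rightarrow> real) \<Rightarrow> 'a \<Rightarrow> 'a \<Rightarrow> real" where
  "star_point S a s v = (if v = s then 1 - (\<Sum>e | e \<in> leaving S \<and> s \<in> e. a e)
     else if v \<notin> S \<and> {s, v} \<in> E then a {s, v} else 0)"

definition config :: "'a set \<Rightarrow> ('a set \<Rightarrow> real) \<Rightarrow> ('a \<Rightarrow> real) set" where
  "config S a = star_point S a ` S"

lemma star_point_edge:
  assumes e: "{s, w} \<in> E" "s \<in> S" "w \<notin> S"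
    and others: "\<And>e. e \<in> leaving S \<Longrightarrow> s \<in> e \<Longrightarrow> e \<noteq> {s, w} \<Longrightarrow> a e = 0"
  shows "star_point S a s = edge_point (s, w) (a {s, w})"
proof
  fix v
  have sw: "s \<noteq> w" using e by auto
  have L: "{s, w} \<in> leaving S" using e by (rule leavingI)
  have "(\<Sum>e | e \<in> leaving S \<and> s \<in> e. a e) = (\<Sum>e\<in>{{s, w}}. a e)"
    by (rule sum.mono_neutral_right) (use L others in auto)
  moreover have "a {s, v} = 0" if "v \<notin> S" "{s, v} \<in> E" "v \<noteq> w"
    using that others[of "{s, v}"] leavingI[of s v S] e by (auto simp: doubleton_eq_iff)
  ultimately show "star_point S a s v = edge_point (s, w) (a {s, w}) v"
    using sw e by (auto simp: star_point_def edge_point_apply)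
qed

lemma star_point_vertex:
  assumes "s \<in> S" "\<And>e. e \<in> leaving S \<Longrightarrow> s \<in> e \<Longrightarrow> a e = 0"
  shows "star_point S a s = vertex_point s"
proof
  fix v
  have "a {s, v} = 0" if "v \<notin> S" "{s, v} \<in> E" using that assms leavingI[of s v S] by auto
  then show "star_point S a s v = vertex_point s v"
    using assms by (auto simp: star_point_def vertex_point_def)
qed

lemma star_point_cases:
  assumes a: "a \<in> heights S" and s: "s \<in> S"
  obtains (vertex) "star_point S a s = vertex_point s" "\<And>e. s \<in> e \<Longrightarrow> a e = 0"
    | (edge) w where "{s, w} \<in> E" "w \<notin> S" "a {s, w} \<noteq> 0" "star_point S a s = edge_point (s, w) (a {s, w})"
      "\<And>e. s \<in> e \<Longrightarrow> e \<noteq> {s, w} \<Longrightarrow> a e = 0"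
proof (cases "\<exists>e. s \<in> e \<and> a e \<noteq> 0")
  case False
  then have z: "a e = 0" if "s \<in> e" for e using that by blast
  show ?thesis by (rule vertex) (use z s in \<open>auto intro: star_point_vertex\<close>)
next
  case True
  then obtain e where e: "s \<in> e" "a e \<noteq> 0" by blast
  then have "e \<in> leaving S" using heightsD[OF a] by blast
  then obtain w where w: "e = {s, w}" "w \<notin> S" "e \<in> E"
    using e s by (auto elim!: leavingE)
  have others: "a e' = 0" if "s \<in> e'" "e' \<noteq> {s, w}" for e'
    using heightsD(4)[OF a, of e' e] that e w by blast
  show ?thesis
  proof (rule edge)
    show "{s, w} \<in> E" "w \<notin> S" "a {s, w} \<noteq> 0" using w e by auto
    show "star_point S a s = edge_point (s, w) (a {s, w})"
      by (rule star_point_edge) (use w s others in auto)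
  qed (rule others)
qed

lemma star_point_realization:
  assumes "S \<subseteq> verts G" "a \<in> heights S" "s \<in> S"
  shows "star_point S a s \<in> realization G"
  using assms(2,3)
proof (cases rule: star_point_cases)
  case vertex then show ?thesis using assms by auto
next
  case (edge w) then show ?thesis using heightsD[OF assms(2)] by (auto intro!: edge_point_realization)
qed

text \<open>
  A point starting at \<open>s\<close> only reaches the other end of the edge it moves on, which is outside \<open>S\<close>. Two
  points could thus only meet at a common end of their edges, but these are disjoint.
\<close>

lemma supp_star_point_disjoint:
  assumes a: "a \<in> heights S" and s: "s \<in> S" "s' \<in> S" "s \<noteq> s'"
  shows "supp (star_point S a s) \<inter> supp (star_point S a s') = {}"
proof -
  have sub: "v = r \<or> (\<exists>e. r \<in> e \<and> v \<in> e \<and> a e \<noteq> 0 \<and> e \<inter> S = {r} \<and> v \<notin> S)"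
    if "r \<in> S" "star_point S a r v \<noteq> 0" for r v
    using a that(1)
  proof (cases rule: star_point_cases)
    case vertex then show ?thesis using that by (auto simp: vertex_point_def indicator_def split: if_splits)
  next
    case (edge w)
    have "v = r \<or> v = w" using that(2) edge(4) by (auto simp: edge_point_apply split: if_splits)
    moreover have "{r, w} \<inter> S = {r}" using edge(2) that(1) by auto
    ultimately show ?thesis using edge(2,3) by blast
  qed
  have False if v: "star_point S a s v \<noteq> 0" "star_point S a s' v \<noteq> 0" for v
  proof (cases "v \<in> S")
    case True
    then show False using sub[OF s(1) v(1)] sub[OF s(2) v(2)] s(3) by blast
  next
    case False
    then obtain e e' where "v \<in> e" "a e \<noteq> 0" "e \<inter> S = {s}" "v \<in> e'" "a e' \<noteq> 0" "e' \<inter> S = {s'}"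
      using sub[OF s(1) v(1)] sub[OF s(2) v(2)] s by blast
    then show False using heightsD(4)[OF a, of e e'] s(3) by blast
  qed
  then show ?thesis by blast
qed

lemma supp_star_point_nonempty: "S \<subseteq> verts G \<Longrightarrow> a \<in> heights S \<Longrightarrow> s \<in> S \<Longrightarrow> supp (star_point S a s) \<noteq> {}"
  using simplexD(2)[OF supp_simplex[OF star_point_realization]] .

lemma inj_on_star_point:
  assumes "S \<subseteq> verts G" "a \<in> heights S" shows "inj_on (star_point S a) S"
proof (rule inj_onI, rule ccontr)
  fix s s' assume s: "s \<in> S" "s' \<in> S" "star_point S a s = star_point S a s'" "s \<noteq> s'"
  then have "supp (star_point S a s) = {}" using supp_star_point_disjoint[OF assms(2) s(1,2,4)] by simp
  then show False using supp_star_point_nonempty[OF assms s(1)] by simp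
qed

lemma config_in_X:
  assumes "S \<in> corners" "a \<in> heights S" shows "config S a \<in> X"
proof -
  have S: "S \<subseteq> verts G" "card S = n" "finite S" using corner_finite[OF assms(1)] assms(1) by (simp_all add: corners_def)
  show ?thesis
    unfolding X_iff config_def
  proof (intro conjI ballI impI)
    show "finite (star_point S a ` S)" using S by simp
    show "card (star_point S a ` S) = n" using card_image[OF inj_on_star_point[OF S(1) assms(2)]] S by simp
    show "star_point S a ` S \<subseteq> realization G" using star_point_realization[OF S(1) assms(2)] by auto
    fix q q' assume "q \<in> star_point S a ` S" "q' \<in> star_point S a ` S" "q \<noteq> q'"
    then obtain s s' where "s \<in> S" "s' \<in> S" "s \<noteq> s'" "q = star_point S a s" "q' = star_point S a s'" by blast
    then show "supp q \<inter> supp q' = {}" using supp_star_point_disjoint[OF assms(2)] by simp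
  qed
qed

text \<open>
  The matching leaves no vertex of \<open>S\<close> for a second end: the point matched with \<open>s\<close> has support \<open>{s}\<close> or
  \<open>{s, w}\<close> with \<open>w\<close> outside \<open>S\<close>, since a vertex of \<open>S\<close> belongs to its own partner only. So the
  configuration arises from \<open>S\<close> by moving points along leaving edges.
\<close>

lemma star_configuration:
  assumes x: "x \<in> X" and S: "S \<in> corners" and f: "bij_betw f S x"
    and pos: "\<And>s. s \<in> S \<Longrightarrow> f s s > 0"
  obtains a where "a \<in> star_heights S" "x = config S a" "\<And>s. s \<in> S \<Longrightarrow> star_point S a s = f s"
proof -
  have xr: "x \<subseteq> realization G"
    and dis: "\<And>q q'. q \<in> x \<Longrightarrow> q' \<in> x \<Longrightarrow> q \<noteq> q' \<Longrightarrow> supp q \<inter> supp q' = {}"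
    using x by (simp_all add: X_iff)
  have fx: "f s \<in> x" if "s \<in> S" for s using f that by (auto simp: bij_betw_def)
  have fr: "f s \<in> realization G" if "s \<in> S" for s using fx[OF that] xr by auto
  have nn: "0 \<le> f s v" if "s \<in> S" for s v using fr[OF that] by (simp add: realization_def)
  have uniq: "s = s'" if "s \<in> S" "s' \<in> S" "f s v \<noteq> 0" "f s' v \<noteq> 0" for s s' v
  proof -
    have "f s = f s'" using dis[OF fx[OF that(1)] fx[OF that(2)]] that(3,4) by blast
    then show ?thesis using f that by (auto simp: bij_betw_def inj_on_def)
  qed
  have shape: "(supp (f s) = {s} \<and> f s = vertex_point s) \<or>
      (\<exists>w. supp (f s) = {s, w} \<and> {s, w} \<in> E \<and> w \<notin> S \<and> f s s + f s w = 1 \<and> f s = edge_point (s, w) (f s w))"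
    if s: "s \<in> S" for s
  proof -
    have mem: "s \<in> supp (f s)" using pos[OF s] by simp
    have sum1: "(\<Sum>v\<in>supp (f s). f s v) = 1" using fr[OF s] by (simp add: realization_def)
    consider (v) v where "supp (f s) = {v}" | (e) "supp (f s) \<in> E"
      using supp_simplex[OF fr[OF s]] by (auto simp: simplices_def)
    then show ?thesis
    proof cases
      case v
      then have v': "supp (f s) = {s}" using mem by auto
      then have "f s s = 1" using sum1 by (simp add: v')
      moreover have "f s u = 0" if "u \<noteq> s" for u using v' that by auto
      ultimately have "f s = vertex_point s" by (auto simp: vertex_point_def indicator_def)
      then show ?thesis using v' by blast
    next
      case e
      then obtain w where w: "supp (f s) = {s, w}" "s \<noteq> w"
        using edge_pair[OF e] mem by (metis doubleton_eq_iff insertE singletonD)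
      have 1: "f s s + f s w = 1" using sum1 w by simp
      have "w \<notin> S"
      proof
        assume "w \<in> S"
        moreover have "f s w \<noteq> 0" using w by auto
        ultimately show False using uniq[of s w w] pos[of w] s w(2) by force
      qed
      moreover have "f s = edge_point (s, w) (f s w)"
      proof
        fix u
        have "f s u = 0" if "u \<noteq> s" "u \<noteq> w" using w that by auto
        then show "f s u = edge_point (s, w) (f s w) u" using 1 w(2) by (auto simp: edge_point_apply)
      qed
      ultimately show ?thesis using w 1 e by auto
    qed
  qed
  \<comment> \<open>At most one term is nonzero, it belongs to the point in the interior of \<open>e\<close>.\<close>
  define a where "a e = (\<Sum>s\<in>S. if supp (f s) = e \<and> e \<in> E then 1 - f s s else 0)" for e
  have a_at: "a e = 1 - f s s" if "s \<in> S" "supp (f s) = e" "e \<in> E" for s e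
  proof -
    have "a e = (\<Sum>s'\<in>S. if s' = s then 1 - f s s else 0)"
      unfolding a_def
    proof (rule sum.cong)
      fix s' assume s': "s' \<in> S"
      have "supp (f s') = e \<longleftrightarrow> s' = s"
      proof
        assume eq: "supp (f s') = e"
        have "s \<in> supp (f s)" using pos[OF that(1)] by simp
        then have "s \<in> supp (f s')" by (simp only: eq that(2))
        then show "s' = s" using uniq[OF s' that(1), of s] pos[OF that(1)] by simp
      qed (simp only: that(2))
      then show "(if supp (f s') = e \<and> e \<in> E then 1 - f s' s' else 0) = (if s' = s then 1 - f s s else 0)"
        using that by auto
    qed simp
    then show ?thesis using that corner_finite[OF S] by simp
  qed
  have a_nz: "\<exists>s\<in>S. supp (f s) = e \<and> e \<in> E" if "a e \<noteq> 0" for e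
  proof (rule ccontr)
    assume none: "\<not> (\<exists>s\<in>S. supp (f s) = e \<and> e \<in> E)"
    have "a e = 0" unfolding a_def by (intro sum.neutral ballI if_not_P) (use none in blast)
    then show False using that by simp
  qed
  have le1: "f s s \<le> 1" if "s \<in> S" for s
    using shape[OF that]
  proof (elim disjE exE conjE)
    assume "f s = vertex_point s"
    then have "f s s = vertex_point s s" by (simp only:)
    then show ?thesis by (simp add: vertex_point_def)
  next
    fix w assume "f s s + f s w = 1"
    then show ?thesis using nn[OF that, of w] by linarith
  qed
  have a_range: "0 \<le> a e \<and> a e < 1" for e
  proof (cases "a e = 0")
    case False
    then obtain s where s: "s \<in> S" "supp (f s) = e" "e \<in> E" using a_nz by metis
    show ?thesis using a_at[OF s] pos[OF s(1)] le1[OF s(1)] by simp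
  qed simp
  have a_heights: "a \<in> heights S"
  proof (rule heightsI)
    fix e assume "a e \<noteq> 0"
    then obtain s where s: "s \<in> S" "supp (f s) = e" "e \<in> E" using a_nz by metis
    have "e \<noteq> {s}" using edge_card[OF s(3)] by auto
    then obtain w where "supp (f s) = {s, w}" "w \<notin> S" using shape[OF s(1)] s(2) by metis
    then show "e \<in> leaving S" using leavingI[of s w S] s by simp
  next
    fix e e' assume "a e \<noteq> 0" "a e' \<noteq> 0" and ne: "e \<noteq> e'"
    then obtain s s' where s: "s \<in> S" "supp (f s) = e" "s' \<in> S" "supp (f s') = e'" using a_nz by metis
    show "e \<inter> e' = {}"
    proof (rule ccontr)
      assume "e \<inter> e' \<noteq> {}"
      then obtain v where "f s v \<noteq> 0" "f s' v \<noteq> 0" using s(2,4) by blast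
      then have "s = s'" using uniq[OF s(1,3)] by simp
      then show False using ne s(2,4) by simp
    qed
  next
    show "0 \<le> a e" "a e \<le> 1" for e using a_range[of e] by simp_all
  qed
  have star_point: "star_point S a s = f s" if s: "s \<in> S" for s
  proof -
    have only: "supp (f s) = e \<and> e \<in> E" if e: "s \<in> e" "a e \<noteq> 0" for e
    proof -
      obtain r where r: "r \<in> S" "supp (f r) = e" "e \<in> E" using a_nz[OF \<open>a e \<noteq> 0\<close>] by blast
      have "f r s \<noteq> 0" using r(2) e(1) by blast
      then have "r = s" using uniq[OF r(1) s, of s] pos[OF s] by simp
      then show ?thesis using r by simp
    qed
    from shape[OF s] show ?thesis
    proof (elim disjE conjE exE)
      assume v: "supp (f s) = {s}" "f s = vertex_point s"
      have "a e = 0" if "s \<in> e" for e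
      proof (rule ccontr)
        assume "a e \<noteq> 0"
        then have "e = {s}" "e \<in> E" using only[OF that] v(1) by simp_all
        then show False using edge_card[of e] by simp
      qed
      then show ?thesis using v star_point_vertex[of s S a] s by simp
    next
      fix w assume w: "supp (f s) = {s, w}" "{s, w} \<in> E" "w \<notin> S" "f s s + f s w = 1"
        "f s = edge_point (s, w) (f s w)"
      have "a {s, w} = f s w" using a_at[OF s w(1,2)] w(4) by simp
      moreover have "star_point S a s = edge_point (s, w) (a {s, w})"
      proof (rule star_point_edge[OF w(2) s w(3)])
        fix e assume "s \<in> e" "e \<noteq> {s, w}"
        then show "a e = 0" using only[of e] w(1) by blast
      qed
      ultimately show ?thesis using w by simp
    qed
  qed
  show thesis
  proof (rule that)
    show "a \<in> star_heights S" using a_heights a_range by (simp add: star_heights_def)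
    have "star_point S a ` S = f ` S" using star_point by (rule image_cong[OF refl])
    then show "x = config S a" using f by (simp add: config_def bij_betw_def)
  qed (rule star_point)
qed

text \<open>
  A point on an edge has weight at least \<open>1 / 2\<close> at one of the two ends; these ends form the corner.
\<close>

lemma rounded_configuration:
  assumes x: "x \<in> X"
  obtains S a where "S \<in> corners" "a \<in> star_heights S" "x = config S a" "\<And>e. a e \<le> 1 / 2"
proof -
  have xr: "x \<subseteq> realization G" and xf: "finite x" "card x = n"
    and dis: "\<And>q q'. q \<in> x \<Longrightarrow> q' \<in> x \<Longrightarrow> q \<noteq> q' \<Longrightarrow> supp q \<inter> supp q' = {}"
    using x by (simp_all add: X_iff)
  have "\<exists>v. q v \<ge> 1 / 2" if q: "q \<in> x" for q
  proof (rule ccontr)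
    assume *: "\<nexists>v. q v \<ge> 1 / 2"
    have r: "q \<in> realization G" using xr q by auto
    have fin: "finite (supp q)" and c: "supp q \<noteq> {}" using simplexD[OF supp_simplex[OF r]] by auto
    have "card (supp q) \<le> 2"
      using supp_simplex[OF r] edge_card by (auto simp: simplices_def)
    have "(\<Sum>v\<in>supp q. q v) < (\<Sum>v\<in>supp q. 1 / 2)"
      using fin c * by (intro sum_strict_mono) (auto simp: not_le)
    also have "\<dots> \<le> 1" using \<open>card (supp q) \<le> 2\<close> by simp
    finally show False using r by (simp add: realization_def)
  qed
  then obtain g where g: "\<And>q. q \<in> x \<Longrightarrow> q (g q) \<ge> 1 / 2" by metis
  have inj: "inj_on g x"
  proof (rule inj_onI)
    fix q q' assume q: "q \<in> x" "q' \<in> x" "g q = g q'"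
    have "q (g q) \<noteq> 0" "q' (g q) \<noteq> 0" using g[OF q(1)] g[OF q(2)] q(3) by auto
    then show "q = q'" using dis[OF q(1,2)] by blast
  qed
  define S where "S = g ` x"
  have vv: "g q \<in> verts G" if "q \<in> x" for q
  proof -
    have "q \<in> realization G" using that xr by auto
    then have "supp q \<subseteq> verts G" by (rule simplexD(3)[OF supp_simplex])
    moreover have "g q \<in> supp q" using g[OF that] by auto
    ultimately show ?thesis by blast
  qed
  have S: "S \<in> corners" using xf inj vv by (auto simp: corners_def S_def card_image)
  have "bij_betw g x S" using inj by (simp add: S_def bij_betw_def)
  then have bij: "bij_betw (inv_into x g) S x" by (rule bij_betw_inv_into)
  have f: "inv_into x g s s \<ge> 1 / 2" if "s \<in> S" for s
    using g[of "inv_into x g s"] that by (auto simp: S_def f_inv_into_f inv_into_into inj)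
  have f0: "inv_into x g s s > 0" if "s \<in> S" for s
    using f[OF that] by linarith
  obtain a where a: "a \<in> star_heights S" "x = config S a" "\<And>s. s \<in> S \<Longrightarrow> star_point S a s = inv_into x g s"
    using star_configuration[OF x S bij f0] by blast
  have "a e \<le> 1 / 2" for e
  proof (cases "a e = 0")
    case False
    have b: "a \<in> heights S" using a by (simp add: star_heights_def)
    then obtain s w where e: "e = {s, w}" "s \<in> S" "w \<notin> S" using heightsD(3)[OF b False] by (auto elim: leavingE)
    from b e(2) have "star_point S a s s = 1 - a e"
    proof (cases rule: star_point_cases)
      case vertex then show ?thesis using False e by auto
    next
      case (edge w')
      have "e = {s, w'}" using edge(5)[of e] False e by blast
      moreover have "s \<noteq> w'" using edge e by auto
      ultimately show ?thesis using edge by (simp add: edge_point_apply)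
    qed
    then show ?thesis using a(3)[OF e(2)] f[OF e(2)] by simp
  qed simp
  then show thesis using that S a by blast
qed

definition cell :: "'a set \<Rightarrow> 'a set set \<Rightarrow> 'a set set" where
  "cell S U = U \<union> (\<lambda>v. {v}) ` (S - \<Union> U)"

text \<open>
  Heights are measured from the corner, chart coordinates from the initial vertex of the edge.
\<close>

definition orient :: "'a set \<Rightarrow> ('a set \<Rightarrow> real) \<Rightarrow> 'a set \<Rightarrow> real" where
  "orient S a e = (if fst (ori e) \<in> S then a e else 1 - a e)"

lemma cell_edges:
  assumes "U \<subseteq> E" shows "cell S U \<inter> E = U"
  using assms edge_card by (force simp: cell_def)

text \<open>
  An edge of \<open>U\<close> contains exactly one vertex of \<open>S\<close>, so sending a vertex to its simplex is a bijection from
  \<open>S\<close> onto the cell.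
\<close>

lemma cell_in_cells:
  assumes S: "S \<in> corners" and U: "U \<subseteq> leaving S" "disjoint U"
  shows "cell S U \<in> conf_cells n G"
proof -
  have Sv: "S \<subseteq> verts G" "card S = n" "finite S" using corner_finite[OF S] S by (simp_all add: corners_def)
  have dis: "e \<inter> f = {}" if "e \<in> U" "f \<in> U" "e \<noteq> f" for e f
    using U(2) that by (auto simp: pairwise_def disjnt_def)
  have simp: "cell S U \<subseteq> simplices G" using U(1) Sv by (auto simp: cell_def simplices_def leaving_def)
  have disj: "\<sigma> \<inter> \<tau> = {}" if "\<sigma> \<in> cell S U" "\<tau> \<in> cell S U" "\<sigma> \<noteq> \<tau>" for \<sigma> \<tau>
    using that unfolding cell_def by (elim UnE imageE) (use dis in auto)
  define g where "g s = (if s \<in> \<Union> U then (THE e. e \<in> U \<and> s \<in> e) else {s})" for s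
  have gU: "g s = e" if "e \<in> U" "s \<in> e" for s e
    using that dis unfolding g_def by (auto intro!: the_equality)
  have g0: "g s = {s}" if "s \<notin> \<Union> U" for s using that by (auto simp: g_def)
  have "bij_betw g S (cell S U)"
  proof (rule bij_betwI')
    fix s s' assume s: "s \<in> S" "s' \<in> S"
    have mem: "r \<in> g r" for r
    proof (cases "r \<in> \<Union> U")
      case True
      then obtain e where "e \<in> U" "r \<in> e" by blast
      then show ?thesis using gU by simp
    qed (simp add: g0)
    show "(g s = g s') = (s = s')"
    proof
      assume *: "g s = g s'"
      show "s = s'"
      proof (cases "s \<in> \<Union> U")
        case True
        then obtain e where e: "e \<in> U" "s \<in> e" by auto
        then have "s' \<in> e" using gU[OF e] * mem[of s'] by simp
        moreover have "e \<in> leaving S" using e U by blast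
        ultimately show ?thesis using leaving_unique[of e S s s'] e s by simp
      next
        case False
        then show ?thesis using g0[OF False] mem[of s'] * by simp
      qed
    qed simp
  next
    fix s assume "s \<in> S"
    show "g s \<in> cell S U"
    proof (cases "s \<in> \<Union> U")
      case True
      then obtain e where "e \<in> U" "s \<in> e" by blast
      then show ?thesis using gU by (simp add: cell_def)
    qed (use \<open>s \<in> S\<close> g0 in \<open>simp add: cell_def\<close>)
  next
    fix \<sigma> assume "\<sigma> \<in> cell S U"
    then consider "\<sigma> \<in> U" | v where "v \<in> S" "v \<notin> \<Union> U" "\<sigma> = {v}" by (auto simp: cell_def)
    then show "\<exists>s\<in>S. \<sigma> = g s"
    proof cases
      case 1
      then obtain s where "s \<in> \<sigma>" "s \<in> S" using U(1) by (auto simp: leaving_def)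
      then show ?thesis using gU 1 by blast
    qed (use g0 in blast)
  qed
  then have "card (cell S U) = n" "finite (cell S U)"
    using Sv bij_betw_same_card bij_betw_finite by fastforce+
  then show ?thesis
    unfolding conf_cells_def using simp disj closed_simplex_disjoint_iff by (auto simp: subset_iff)
qed

lemma config_chart:
  assumes a: "a \<in> heights S" and U: "U \<subseteq> leaving S" "disjoint U" and supp: "supp a \<subseteq> U"
  shows "config S a = conf_chart G ori (cell S U) (restrict (orient S a) U)"
    "restrict (orient S a) U \<in> unit_cube U"
proof -
  have UE: "U \<subseteq> E" using U by (auto simp: leaving_def)
  have V: "{v. {v} \<in> cell S U} = S - \<Union> U"
    using UE edge_card by (force simp: cell_def)
  have still: "star_point S a s = vertex_point s" if "s \<in> S - \<Union> U" for s
    using that supp by (intro star_point_vertex) auto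
  have move: "star_point S a s = edge_point (ori e) (orient S a e)" if e: "e \<in> U" "s \<in> e" "s \<in> S" for s e
  proof -
    obtain w where w: "e = {s, w}" "w \<notin> S" "e \<in> E"
      using U(1) e by (auto elim!: leavingE dest!: subsetD)
    have oth: "a e' = 0" if "s \<in> e'" "e' \<noteq> {s, w}" for e'
    proof (rule ccontr)
      assume "a e' \<noteq> 0"
      then have "e' \<in> U" using supp by blast
      then have "disjnt e' e" using pairwiseD[OF U(2) _ e(1)] that(2) w(1) by simp
      then show False using that(1) e(2) by (auto simp: disjnt_def)
    qed
    have p: "star_point S a s = edge_point (s, w) (a e)" using star_point_edge[of s w S a] w e oth by auto
    have "ori e = (s, w) \<or> ori e = (w, s)"
      using edge_ends(1)[OF w(3)] w(1) by (metis doubleton_eq_iff prod.collapse)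
    then show ?thesis
      using p e(3) w(2) edge_point_swap[of w s "a e"] by (auto simp: orient_def)
  qed
  have "star_point S a ` (S - \<Union> U) = vertex_point ` (S - \<Union> U)"
    by (rule image_cong[OF refl]) (rule still)
  moreover have "star_point S a ` (S \<inter> \<Union> U) = (\<lambda>e. edge_point (ori e) (orient S a e)) ` U"
  proof (intro equalityI subsetI)
    fix q assume "q \<in> star_point S a ` (S \<inter> \<Union> U)"
    then obtain s e where "s \<in> S" "e \<in> U" "s \<in> e" "q = star_point S a s" by blast
    then show "q \<in> (\<lambda>e. edge_point (ori e) (orient S a e)) ` U" using move[of e s] by simp
  next
    fix q assume "q \<in> (\<lambda>e. edge_point (ori e) (orient S a e)) ` U"
    then obtain e where e: "e \<in> U" "q = edge_point (ori e) (orient S a e)" by (rule imageE)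
    then obtain s where s: "s \<in> e" "s \<in> S" using U(1) by (auto simp: leaving_def)
    then have "q = star_point S a s" using move[OF e(1)] e(2) by simp
    then show "q \<in> star_point S a ` (S \<inter> \<Union> U)" using e(1) s by blast
  qed
  moreover have "S = (S - \<Union> U) \<union> (S \<inter> \<Union> U)" by blast
  ultimately have "star_point S a ` S = vertex_point ` (S - \<Union> U) \<union> (\<lambda>e. edge_point (ori e) (orient S a e)) ` U"
    by (metis image_Un)
  then show "config S a = conf_chart G ori (cell S U) (restrict (orient S a) U)"
    by (simp add: config_def conf_chart_def V cell_edges[OF UE])
  show "restrict (orient S a) U \<in> unit_cube U"
    using heightsD[OF a] by (auto simp: unit_cube_def orient_def)
qed

lemma Phi_config:
  assumes a: "a \<in> heights S"
  shows "Phi G ori (config S a) = (\<lambda>e\<in>E. RZ (if fst (ori e) \<in> S then a e else - a e))"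
proof -
  have U: "supp a \<subseteq> leaving S" "disjoint (supp a)" using a by (auto simp: heights_def)
  then have UE: "supp a \<subseteq> E" by (auto simp: leaving_def)
  have "Phi G ori (config S a) = torus_chart E (supp a) (restrict (orient S a) (supp a))"
    using Phi_conf_chart[OF finite_graph orientation, of "restrict (orient S a) (supp a)" "cell S (supp a)"]
      config_chart[OF a U order_refl] by (simp add: cell_edges[OF UE])
  also have "\<dots> = (\<lambda>e\<in>E. RZ (if fst (ori e) \<in> S then a e else - a e))"
    by (auto simp: torus_chart_def orient_def RZ_eq_iff fun_eq_iff)
  finally show ?thesis .
qed

end

section \<open>Topology of the configuration space\<close>

text \<open>
  Symmetric functions of the points of a configuration. The weights at single vertices do not
  determine it: on a cycle of length four, two points at the midpoints of opposite edges give all weights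
  \<open>1 / 2\<close> for both choices of these edges. The products over pairs of vertices detect which edges are occupied. The map
  into real functions thus defined turns out to be an embedding.
\<close>

definition moments :: "('b \<Rightarrow> real) set \<Rightarrow> 'b set \<Rightarrow> real" where
  "moments x \<sigma> = (\<Sum>q\<in>x. \<Prod>v\<in>\<sigma>. q v)"

lemma continuous_map_euclidean_fun:
  fixes f :: "'b \<Rightarrow> 'c \<Rightarrow> real"
  shows "continuous_map X euclidean f \<longleftrightarrow> (\<forall>i. continuous_map X euclideanreal (\<lambda>x. f x i))"
  by (simp add: euclidean_product_topology[symmetric] continuous_map_componentwise_UNIV)

lemma Hausdorff_euclidean_fun: "Hausdorff_space (euclidean :: ('c \<Rightarrow> real) topology)"
  by (simp add: euclidean_product_topology[symmetric] Hausdorff_space_product_topology)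

context oriented_graph
begin

abbreviation "Y \<equiv> moments ` X"

lemma star_point_other_corner: "v \<in> S \<Longrightarrow> v \<noteq> s \<Longrightarrow> star_point S a s v = 0"
  by (simp add: star_point_def)

lemma star_point_self_pos:
  assumes a: "a \<in> star_heights S" and s: "s \<in> S" shows "star_point S a s s > 0"
  using star_heightsD[OF a] s
proof (cases rule: star_point_cases)
  case vertex then show ?thesis by (simp add: vertex_point_def)
next
  case (edge w)
  then have "s \<noteq> w" using s by auto
  moreover have "a {s, w} < 1" using a by (simp add: star_heights_def)
  ultimately show ?thesis using edge(4) by (simp add: edge_point_apply)
qed

lemma moments_config:
  assumes "S \<in> corners" "a \<in> heights S"
  shows "moments (config S a) = (\<lambda>\<sigma>. \<Sum>s\<in>S. \<Prod>v\<in>\<sigma>. star_point S a s v)"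
proof -
  have "inj_on (star_point S a) S" using inj_on_star_point[of S a] assms by (simp add: corners_def)
  then show ?thesis by (simp add: moments_def config_def sum.reindex fun_eq_iff)
qed

lemma continuous_star_point: "continuous_on UNIV (\<lambda>a. star_point S a s v)"
proof -
  have "continuous_on UNIV (\<lambda>a. 1 - (\<Sum>e | e \<in> leaving S \<and> s \<in> e. a e) :: real)"
    by (intro continuous_on_diff continuous_on_const continuous_on_sum continuous_on_product_coordinates)
  moreover have "continuous_on UNIV (\<lambda>a. a {s, v} :: real)" by simp
  ultimately show ?thesis
    unfolding star_point_def by (cases "v = s"; cases "v \<in> S"; cases "{s, v} \<in> E") simp_all
qed

lemma continuous_moments_config:
  assumes "S \<in> corners" shows "continuous_on (heights S) (\<lambda>a. moments (config S a))"
proof -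
  have c: "continuous_on (heights S) (\<lambda>a. star_point S a s v)" for s v
    by (rule continuous_on_subset[OF continuous_star_point]) simp
  have "continuous_on (heights S) (\<lambda>a \<sigma>. \<Sum>s\<in>S. \<Prod>v\<in>\<sigma>. star_point S a s v)"
    by (intro continuous_on_coordinatewise_then_product continuous_intros c)
  then show ?thesis by (rule continuous_on_eq) (simp add: moments_config assms)
qed

lemma moments_corner:
  assumes S: "S \<in> corners" and a: "a \<in> heights S" and s: "s \<in> S"
  shows "moments (config S a) {s} = star_point S a s s"
proof -
  have "(\<Sum>r\<in>S. star_point S a r s) = (\<Sum>r\<in>{s}. star_point S a r s)"
  proof (rule sum.mono_neutral_right)
    show "\<forall>r\<in>S - {s}. star_point S a r s = 0" by (intro ballI star_point_other_corner[OF s]) auto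
  qed (use corner_finite[OF S] s in auto)
  then show ?thesis by (simp add: moments_config S a)
qed

lemma moments_corner_pair:
  assumes S: "S \<in> corners" and a: "a \<in> heights S" and s: "s \<in> S" "v \<noteq> s"
  shows "moments (config S a) {s, v} = star_point S a s s * star_point S a s v"
proof -
  have "(\<Sum>r\<in>S. star_point S a r s * star_point S a r v) = (\<Sum>r\<in>{s}. star_point S a r s * star_point S a r v)"
  proof (rule sum.mono_neutral_right)
    have "star_point S a r s = 0" if "r \<in> S - {s}" for r using star_point_other_corner[OF s(1), of r] that by blast
    then show "\<forall>r\<in>S - {s}. star_point S a r s * star_point S a r v = 0" by simp
  qed (use corner_finite[OF S] s in auto)
  then show ?thesis using s by (simp add: moments_config S a)
qed

definition foot :: "'a set \<Rightarrow> 'a set \<Rightarrow> 'a" where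
  "foot S e = (THE s. s \<in> e \<and> s \<in> S)"

lemma foot_eq: "e \<in> leaving S \<Longrightarrow> s \<in> e \<Longrightarrow> s \<in> S \<Longrightarrow> foot S e = s"
  unfolding foot_def using leaving_unique by (intro the_equality) auto

text \<open>
  If \<open>y\<close> comes from heights \<open>a\<close> below \<open>1\<close>, then \<open>y e = (1 - a e) * a e\<close>, and the denominator is
  \<open>1 - a e\<close> whenever \<open>a e\<close> is nonzero.
\<close>

definition recover :: "'a set \<Rightarrow> ('a set \<Rightarrow> real) \<Rightarrow> 'a set \<Rightarrow> real" where
  "recover S y e = (if e \<in> leaving S then y e / y {foot S e} else 0)"

lemma recover_moments:
  assumes S: "S \<in> corners" and a: "a \<in> star_heights S"
  shows "recover S (moments (config S a)) = a"
proof
  fix e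
  have b: "a \<in> heights S" using a by (rule star_heightsD)
  show "recover S (moments (config S a)) e = a e"
  proof (cases "e \<in> leaving S")
    case True
    then obtain s w where e: "e = {s, w}" "s \<in> S" "w \<notin> S" "e \<in> E" by (rule leavingE)
    have sw: "w \<noteq> s" using e by auto
    have "star_point S a s w = a e" using e sw by (simp add: star_point_def)
    moreover have "foot S e = s" using True e by (intro foot_eq) auto
    ultimately show ?thesis
      using True moments_corner_pair[OF S b e(2) sw] moments_corner[OF S b e(2)]
        star_point_self_pos[OF a e(2)] e(1) by (simp add: recover_def)
  next
    case False
    then show ?thesis using heightsD(3)[OF b, of e] by (auto simp: recover_def)
  qed
qed

definition Star :: "'a set \<Rightarrow> ('a set \<Rightarrow> real) set" where
  "Star S = (\<lambda>a. moments (config S a)) ` star_heights S"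

text \<open>
  Positivity of the first moments gives every \<open>s\<close> in \<open>S\<close> a point with positive weight at \<open>s\<close>. If two
  vertices of \<open>S\<close> shared this point, then all other points would vanish at both, and the pair moment
  would equal the product of the first moments.
\<close>

lemma star_from_moments:
  assumes S: "S \<in> corners" and x: "x \<in> X"
    and pos: "\<And>s. s \<in> S \<Longrightarrow> moments x {s} > 0"
    and apart: "\<And>s s'. s \<in> S \<Longrightarrow> s' \<in> S \<Longrightarrow> s \<noteq> s' \<Longrightarrow> moments x {s, s'} < moments x {s} * moments x {s'}"
  obtains a where "a \<in> star_heights S" "x = config S a"
proof -
  have xf: "finite x" "card x = n"
    and dis: "\<And>q q'. q \<in> x \<Longrightarrow> q' \<in> x \<Longrightarrow> q \<noteq> q' \<Longrightarrow> supp q \<inter> supp q' = {}"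
    using x by (simp_all add: X_iff)
  have "\<exists>q\<in>x. q s > 0" if s: "s \<in> S" for s
  proof (rule ccontr)
    assume "\<not> (\<exists>q\<in>x. q s > 0)"
    then have "(\<Sum>q\<in>x. q s) \<le> 0" by (intro sum_nonpos) (simp add: not_less)
    then show False using pos[OF s] by (simp add: moments_def)
  qed
  then obtain f where f: "\<And>s. s \<in> S \<Longrightarrow> f s \<in> x" "\<And>s. s \<in> S \<Longrightarrow> f s s > 0" by metis
  have "inj_on f S"
  proof (rule inj_onI, rule ccontr)
    fix s s' assume s: "s \<in> S" "s' \<in> S" "f s = f s'" "s \<noteq> s'"
    have z: "q s = 0" "q s' = 0" if q: "q \<in> x" "q \<noteq> f s" for q
    proof -
      have d: "supp q \<inter> supp (f s) = {}" using dis[OF q(1) f(1)[OF s(1)] q(2)] .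
      have "f s s \<noteq> 0" "f s s' \<noteq> 0" using f(2)[OF s(1)] f(2)[OF s(2)] s(3) by auto
      then show "q s = 0" "q s' = 0" using d by blast+
    qed
    have only: "(\<Sum>q\<in>x. g q) = g (f s)" if g: "\<And>q. q \<in> x \<Longrightarrow> q \<noteq> f s \<Longrightarrow> g q = 0" for g :: "('a \<Rightarrow> real) \<Rightarrow> real"
    proof -
      have "(\<Sum>q\<in>x. g q) = (\<Sum>q\<in>{f s}. g q)"
        by (rule sum.mono_neutral_right) (use xf f(1)[OF s(1)] g in auto)
      then show ?thesis by simp
    qed
    have "moments x {s} = f s s" "moments x {s'} = f s s'" "moments x {s, s'} = f s s * f s s'"
      using only[of "\<lambda>q. q s"] only[of "\<lambda>q. q s'"] only[of "\<lambda>q. q s * q s'"] z s(4)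
      by (simp_all add: moments_def)
    then show False using apart[OF s(1,2,4)] by simp
  qed
  moreover have "f ` S = x"
  proof (rule card_subset_eq)
    show "card (f ` S) = card x" using card_image[OF \<open>inj_on f S\<close>] S xf by (simp add: corners_def)
  qed (use xf f in auto)
  ultimately have bij: "bij_betw f S x" by (simp add: bij_betw_def)
  show thesis
  proof (rule star_configuration[OF x S bij f(2)])
    fix a assume "a \<in> star_heights S" "x = config S a"
    then show thesis by (rule that)
  qed
qed

lemma Star_pos:
  assumes S: "S \<in> corners" and y: "y \<in> Star S" and s: "s \<in> S" shows "y {s} > 0"
proof -
  obtain a where a: "a \<in> star_heights S" "y = moments (config S a)" using y by (auto simp: Star_def)
  then show ?thesis
    using star_point_self_pos[OF a(1) s] moments_corner[OF S star_heightsD[OF a(1)] s] by simp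
qed

lemma Star_apart:
  assumes S: "S \<in> corners" and y: "y \<in> Star S" and s: "s \<in> S" "s' \<in> S" "s \<noteq> s'"
  shows "y {s, s'} < y {s} * y {s'}"
proof -
  obtain a where a: "a \<in> star_heights S" "y = moments (config S a)" using y by (auto simp: Star_def)
  have "s' \<noteq> s" using s(3) by simp
  from moments_corner_pair[OF S star_heightsD[OF a(1)] s(1) this]
  have "y {s, s'} = 0" using s a(2) by (simp add: star_point_other_corner)
  then show ?thesis using Star_pos[OF S y] s by simp
qed

lemma Star_iff:
  assumes S: "S \<in> corners"
  shows "y \<in> Star S \<longleftrightarrow> y \<in> Y \<and> (\<forall>s\<in>S. y {s} > 0) \<and>
    (\<forall>s\<in>S. \<forall>s'\<in>S. s \<noteq> s' \<longrightarrow> y {s, s'} < y {s} * y {s'})"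
proof
  assume y: "y \<in> Star S"
  then have "y \<in> Y" using config_in_X[OF S star_heightsD] by (auto simp: Star_def)
  then show "y \<in> Y \<and> (\<forall>s\<in>S. y {s} > 0) \<and>
    (\<forall>s\<in>S. \<forall>s'\<in>S. s \<noteq> s' \<longrightarrow> y {s, s'} < y {s} * y {s'})"
    using Star_pos[OF S y] Star_apart[OF S y] by simp
next
  assume y: "y \<in> Y \<and> (\<forall>s\<in>S. y {s} > 0) \<and>
    (\<forall>s\<in>S. \<forall>s'\<in>S. s \<noteq> s' \<longrightarrow> y {s, s'} < y {s} * y {s'})"
  then have "y \<in> Y" by (rule conjunct1)
  then obtain x where x: "y = moments x" "x \<in> X" by (rule imageE)
  show "y \<in> Star S"
  proof (rule star_from_moments[OF S x(2)])
    fix a assume "a \<in> star_heights S" "x = config S a"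
    then show "y \<in> Star S" using x(1) by (simp add: Star_def)
  qed (use x(1) y in simp_all)
qed

lemma Star_subset: "S \<in> corners \<Longrightarrow> Star S \<subseteq> Y"
  by (rule subsetI) (simp add: Star_iff)

text \<open>
  The characterization of a star by moments consists of finitely many strict inequalities.
\<close>

lemma Star_open:
  assumes S: "S \<in> corners" obtains B where "open B" "Star S = Y \<inter> B"
proof -
  define B where "B = (\<Inter>s\<in>S. {y. y {s} > (0::real)}) \<inter>
    (\<Inter>s\<in>S. \<Inter>s'\<in>S - {s}. {y. y {s, s'} < y {s} * y {s'}})"
  have c: "continuous_on UNIV (\<lambda>y. y \<sigma> :: real)" for \<sigma> :: "'a set" by simp
  have "open B"
    unfolding B_def
    by (intro open_Int open_INT ballI finite_Diff corner_finite[OF S] open_Collect_less continuous_intros c)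
  moreover have "Star S = Y \<inter> B"
    unfolding set_eq_iff Star_iff[OF S] B_def by auto
  ultimately show thesis by (rule that)
qed

lemma rounded_Star:
  assumes "y \<in> Y" obtains S where "S \<in> corners" "y \<in> Star S"
proof -
  obtain x where x: "x \<in> X" "y = moments x" using assms by blast
  obtain S a where "S \<in> corners" "a \<in> star_heights S" "x = config S a"
    using rounded_configuration[OF x(1)] by metis
  then show thesis using that[of S] x(2) by (simp add: Star_def)
qed

lemma inj_moments: "inj_on moments X"
proof (rule inj_onI)
  fix x x' assume x: "x \<in> X" "x' \<in> X" "moments x = moments x'"
  obtain S a where S: "S \<in> corners" "a \<in> star_heights S" "x = config S a"
    using rounded_configuration[OF x(1)] by metis
  have "moments x' \<in> Star S"
    unfolding x(3)[symmetric] S(3) Star_def by (rule imageI) (rule S(2))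
  note star = Star_pos[OF S(1) this] Star_apart[OF S(1) this]
  obtain a' where a': "a' \<in> star_heights S" "x' = config S a'"
    by (rule star_from_moments[OF S(1) x(2) star])
  have "a = a'" using recover_moments[OF S(1,2)] recover_moments[OF S(1) a'(1)] S a' x(3) by metis
  then show "x = x'" using S a' by simp
qed

lemma compact_heights: "compact (heights S)"
proof -
  have "compactin (product_topology (\<lambda>_. euclideanreal) UNIV) (PiE UNIV (\<lambda>_::'a set. {0..1::real}))"
    by (simp add: compactin_PiE)
  then have K: "compact (PiE UNIV (\<lambda>_::'a set. {0..1::real}))"
    by (simp add: euclidean_product_topology)
  have c: "continuous_on UNIV (\<lambda>a. a e :: real)" for e :: "'a set" by simp
  have closed: "closed (heights S)"
  proof -
    have "heights S = (\<Inter>e. {a. 0 \<le> a e} \<inter> {a. a e \<le> 1}) \<inter> (\<Inter>e\<in>-leaving S. {a. a e = 0}) \<inter>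
       (\<Inter>e. \<Inter>f\<in>{f. e \<noteq> f \<and> e \<inter> f \<noteq> {}}. {a. a e * a f = 0})" (is "_ = ?R")
    proof (intro equalityI subsetI)
      fix a assume "a \<in> heights S" then show "a \<in> ?R" using heightsD[of a S] by fastforce
    next
      fix a assume "a \<in> ?R"
      then have a: "\<And>e. 0 \<le> a e" "\<And>e. a e \<le> 1" "\<And>e. e \<notin> leaving S \<Longrightarrow> a e = 0"
        "\<And>e f. e \<noteq> f \<Longrightarrow> e \<inter> f \<noteq> {} \<Longrightarrow> a e * a f = 0"
        by blast+
      show "a \<in> heights S"
      proof (rule heightsI)
        show "e \<in> leaving S" if "a e \<noteq> 0" for e using a(3)[of e] that by metis
        show "e \<inter> f = {}" if "a e \<noteq> 0" "a f \<noteq> 0" "e \<noteq> f" for e f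
          using a(4)[OF that(3)] that(1,2) by (metis mult_eq_0_iff)
      qed (fact a)+
    qed
    moreover have "closed ?R"
      by (intro closed_Int closed_INT ballI closed_Collect_le closed_Collect_eq continuous_intros c)
    ultimately show ?thesis by simp
  qed
  have "heights S \<subseteq> PiE UNIV (\<lambda>_. {0..1})" using heightsD by auto
  then have "heights S = heights S \<inter> PiE UNIV (\<lambda>_. {0..1})" by blast
  then show ?thesis using closed_Int_compact[OF closed K] by simp
qed

lemma continuous_config:
  assumes S: "S \<in> corners"
  shows "continuous_map (top_of_set (heights S)) (conf_space n G) (config S)"
proof -
  obtain h where h: "bij_betw h {..<n} S"
    using ex_bij_betw_nat_finite[OF corner_finite[OF S]] S by (auto simp: corners_def lessThan_atLeast0)
  define H where "H = (\<lambda>a. \<lambda>i\<in>{..<n}. star_point S a (h i))"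
  have hS: "h i \<in> S" if "i < n" for i using h that by (auto simp: bij_betw_def)
  have sv: "S \<subseteq> verts G" using S by (simp add: corners_def)
  let ?P = "product_topology (\<lambda>_. top_of_set (realization G)) {..<n}"
  have mem: "H a \<in> ordered_conf n G" if a: "a \<in> heights S" for a
    unfolding ordered_conf_iff
  proof (intro conjI allI impI)
    show "H a \<in> {..<n} \<rightarrow>\<^sub>E realization G"
      using star_point_realization[OF sv a] hS by (simp add: H_def)
    fix i j assume ij: "i < n" "j < n" "i \<noteq> j"
    then have "h i \<noteq> h j" using h by (auto simp: bij_betw_def inj_on_def)
    then show "supp (H a i) \<inter> supp (H a j) = {}"
      using supp_star_point_disjoint[OF a hS[OF ij(1)] hS[OF ij(2)]] ij by (simp add: H_def)
  qed
  have "continuous_map (top_of_set (heights S)) ?P H"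
    unfolding continuous_map_componentwise
  proof (intro conjI ballI)
    show "H ` topspace (top_of_set (heights S)) \<subseteq> extensional {..<n}" by (auto simp: H_def)
    fix i assume i: "i \<in> {..<n}"
    have "continuous_on (heights S) (\<lambda>a. star_point S a (h i))"
      by (intro continuous_on_coordinatewise_then_product continuous_on_subset[OF continuous_star_point]) simp
    moreover have "(\<lambda>a. star_point S a (h i)) ` heights S \<subseteq> realization G"
      using star_point_realization[OF sv] hS i by auto
    ultimately have "continuous_map (top_of_set (heights S)) (top_of_set (realization G)) (\<lambda>a. star_point S a (h i))"
      by (simp add: continuous_map_in_subtopology image_subset_iff_funcset)
    then show "continuous_map (top_of_set (heights S)) (top_of_set (realization G)) (\<lambda>a. H a i)"
      using i by (simp add: H_def)
  qed
  then have "continuous_map (top_of_set (heights S)) (subtopology ?P (ordered_conf n G)) H"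
    using mem by (auto simp: continuous_map_in_subtopology)
  from continuous_map_compose[OF this quotient_imp_continuous_map[OF quotient_map_quotient_topology]]
  have "continuous_map (top_of_set (heights S)) (conf_space n G) ((\<lambda>x. x ` {..<n}) \<circ> H)"
    by (simp add: conf_space_def)
  moreover have "(\<lambda>x. x ` {..<n}) \<circ> H = config S"
  proof
    fix a
    have "H a ` {..<n} = star_point S a ` (h ` {..<n})" by (auto simp: H_def)
    then show "((\<lambda>x. x ` {..<n}) \<circ> H) a = config S a" using h by (simp add: config_def bij_betw_def)
  qed
  ultimately show ?thesis by simp
qed

lemma X_cover: "X = (\<Union>S\<in>corners. config S ` heights S)"
proof (intro equalityI subsetI)
  fix x assume "x \<in> X"
  then obtain S a where "S \<in> corners" "a \<in> star_heights S" "x = config S a"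
    by (rule rounded_configuration)
  then show "x \<in> (\<Union>S\<in>corners. config S ` heights S)" using star_heightsD by blast
qed (use config_in_X in blast)

lemma compactin_config:
  assumes "S \<in> corners" "closedin (top_of_set (heights S)) K"
  shows "compactin (conf_space n G) (config S ` K)"
proof (rule image_compactin[OF _ continuous_config[OF assms(1)]])
  have "compact_space (top_of_set (heights S))"
    using compact_heights by (simp add: compact_space_subtopology)
  then show "compactin (top_of_set (heights S)) K" using assms(2) by (rule closedin_compact_space)
qed

lemma compact_X: "compact_space (conf_space n G)"
proof -
  have "compactin (conf_space n G) (\<Union>S\<in>corners. config S ` heights S)"
    by (intro compactin_Union finite_imageI finite_corners) (auto intro!: compactin_config)
  then show ?thesis using X_cover by (simp add: compact_space_def)
qed

lemma continuous_moments: "continuous_map (conf_space n G) euclidean moments"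
proof -
  let ?Q = "subtopology (product_topology (\<lambda>_. top_of_set (realization G)) {..<n}) (ordered_conf n G)"
  have "ordered_conf n G \<subseteq> {..<n} \<rightarrow>\<^sub>E realization G" unfolding ordered_conf_def by blast
  then have top: "topspace ?Q = ordered_conf n G" by (simp add: Int_absorb1)
  have c: "continuous_map ?Q euclideanreal (\<lambda>x. x i v)" if i: "i < n" for i v
  proof -
    have "continuous_map ?Q (top_of_set (realization G)) (\<lambda>x. x i)"
      using i by (intro continuous_map_from_subtopology continuous_map_product_projection) simp
    then have "continuous_map ?Q euclidean (\<lambda>x. x i)" by (simp add: continuous_map_in_subtopology)
    then show ?thesis by (simp add: continuous_map_euclidean_fun)
  qed
  have "continuous_map ?Q euclidean (\<lambda>x \<sigma>. \<Sum>i<n. \<Prod>v\<in>\<sigma>. x i v)"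
    unfolding continuous_map_euclidean_fun
  proof
    fix \<sigma> :: "'a set"
    have "continuous_map ?Q euclideanreal (\<lambda>x. \<Prod>v\<in>\<sigma>. x i v)" if "i < n" for i
      using c[OF that] by (cases "finite \<sigma>") (auto intro!: continuous_map_prod)
    then show "continuous_map ?Q euclideanreal (\<lambda>x. \<Sum>i<n. \<Prod>v\<in>\<sigma>. x i v)"
      by (intro continuous_map_sum) auto
  qed
  then have "continuous_map ?Q euclidean (moments \<circ> (\<lambda>x. x ` {..<n}))"
  proof (rule continuous_map_eq)
    fix x assume "x \<in> topspace ?Q"
    then have "inj_on x {..<n}" using top ordered_conf_inj by simp
    then show "(\<lambda>\<sigma>. \<Sum>i<n. \<Prod>v\<in>\<sigma>. x i v) = (moments \<circ> (\<lambda>x. x ` {..<n})) x"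
      by (simp add: moments_def fun_eq_iff sum.reindex)
  qed
  then show ?thesis
    unfolding conf_space_def by (rule continuous_compose_quotient_map[OF quotient_map_quotient_topology])
qed

text \<open>
  A continuous injection of a compact space into a Hausdorff space.
\<close>

lemma homeomorphic_moments: "homeomorphic_map (conf_space n G) (top_of_set Y) moments"
proof (rule continuous_imp_homeomorphic_map)
  show "continuous_map (conf_space n G) (top_of_set Y) moments"
    using continuous_moments by (auto simp: continuous_map_in_subtopology)
  show "Hausdorff_space (top_of_set Y)"
    by (intro Hausdorff_space_subtopology Hausdorff_euclidean_fun)
qed (use compact_X inj_moments in auto)

definition unmoments :: "('a set \<Rightarrow> real) \<Rightarrow> ('a \<Rightarrow> real) set" where
  "unmoments = inv_into X moments"

lemma unmoments_moments [simp]: "x \<in> X \<Longrightarrow> unmoments (moments x) = x"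
  by (simp add: unmoments_def inj_moments)

lemma continuous_unmoments: "continuous_map (top_of_set Y) (conf_space n G) unmoments"
proof -
  obtain g where g: "homeomorphic_maps (conf_space n G) (top_of_set Y) moments g"
    using homeomorphic_moments homeomorphic_map_maps by blast
  then have "continuous_map (top_of_set Y) (conf_space n G) g"
    and gm: "\<And>x. x \<in> X \<Longrightarrow> g (moments x) = x" by (auto simp: homeomorphic_maps_def)
  then show ?thesis
    by (elim continuous_map_eq) auto
qed

lemma Hausdorff_X: "Hausdorff_space (conf_space n G)"
  by (rule Hausdorff_space_injective_preimage[OF Hausdorff_euclidean_fun continuous_moments inj_moments])

lemma continuous_RZ: "continuous_map euclideanreal (quotient_topology euclideanreal RZ) RZ"
  by (rule quotient_imp_continuous_map[OF quotient_map_quotient_topology])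

lemma Phi_config_in_T:
  assumes a: "a \<in> heights S"
  shows "Phi G ori (config S a) \<in> topspace (raag_complex (disjointness_graph G))"
proof -
  have "supp a \<subseteq> E" using heightsD(3)[OF a] leaving_E by blast
  moreover have "{u, v} \<in> edges (disjointness_graph G)" if uv: "a u \<noteq> 0" "a v \<noteq> 0" "u \<noteq> v" for u v
  proof -
    have E: "u \<in> E" "v \<in> E" using uv heightsD(3)[OF a] leaving_E by blast+
    have "closed_simplex G u \<inter> closed_simplex G v = {}"
      using closed_simplex_disjoint_iff[of u v] E heightsD(4)[OF a uv] by (simp add: simplices_def)
    then show ?thesis using E by (auto simp: disjointness_graph_def)
  qed
  ultimately have "supp a \<in> cliques (disjointness_graph G)"
    by (auto simp: cliques_def disjointness_graph_def)
  moreover have "Phi G ori (config S a) \<in> subtorus E (supp a)"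
    by (auto simp: subtorus_def torus_def Phi_config[OF a])
  ultimately show ?thesis
    by (auto simp: raag_complex_def disjointness_graph_def subtorus_def)
qed

lemma continuous_Phi_config:
  "continuous_map (top_of_set (heights S)) (raag_complex (disjointness_graph G)) (\<lambda>a. Phi G ori (config S a))"
proof -
  have "continuous_map (top_of_set (heights S)) (torus E) (\<lambda>a. Phi G ori (config S a))"
    unfolding torus_def continuous_map_componentwise
  proof (intro conjI ballI)
    fix e assume e: "e \<in> E"
    have "continuous_on (heights S) (\<lambda>a. a e)"
      by (rule continuous_on_subset[OF continuous_on_product_coordinates]) simp
    then have "continuous_map (top_of_set (heights S)) euclideanreal (\<lambda>a. if fst (ori e) \<in> S then a e else - a e)"
      by (cases "fst (ori e) \<in> S") (auto intro: continuous_intros)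
    from continuous_map_compose[OF this continuous_RZ]
    show "continuous_map (top_of_set (heights S)) (quotient_topology euclideanreal RZ) (\<lambda>a. Phi G ori (config S a) e)"
      by (rule continuous_map_eq) (simp add: Phi_config e)
  qed (auto simp: Phi_def)
  then show ?thesis
    using Phi_config_in_T by (auto simp: raag_complex_def disjointness_graph_def continuous_map_in_subtopology)
qed

text \<open>
  Continuity may be tested on the closed stars: these are finitely many compact images that cover a
  Hausdorff space, so the preimage of a closed set is a finite union of closed sets.
\<close>

lemma continuous_Phi: "continuous_map (conf_space n G) (raag_complex (disjointness_graph G)) (Phi G ori)"
  unfolding continuous_map_closedin
proof (intro conjI allI impI)
  show "Phi G ori \<in> X \<rightarrow> topspace (raag_complex (disjointness_graph G))"
    using Phi_config_in_T X_cover by auto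
  fix C assume C: "closedin (raag_complex (disjointness_graph G)) C"
  define K where "K S = {a \<in> topspace (top_of_set (heights S)). Phi G ori (config S a) \<in> C}" for S
  have "closedin (top_of_set (heights S)) (K S)" for S
    unfolding K_def by (rule closedin_continuous_map_preimage[OF continuous_Phi_config C])
  then have "closedin (conf_space n G) (config S ` K S)" if "S \<in> corners" for S
    using compactin_imp_closedin[OF Hausdorff_X compactin_config[OF that]] by blast
  then have "closedin (conf_space n G) (\<Union>S\<in>corners. config S ` K S)"
    by (intro closedin_Union finite_imageI finite_corners) auto
  moreover have "{x \<in> X. Phi G ori x \<in> C} = (\<Union>S\<in>corners. config S ` K S)"
    unfolding X_cover K_def by auto
  ultimately show "closedin (conf_space n G) {x \<in> X. Phi G ori x \<in> C}" by simp
qed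

end

section \<open>Local isometry\<close>

lemma cube_chain_nonneg: "cube_chain Q p q l \<Longrightarrow> 0 \<le> l"
  by (induction rule: cube_chain.induct) (auto intro: add_nonneg_nonneg)

lemma cube_chain_trans:
  "cube_chain Q p q l \<Longrightarrow> cube_chain Q q r m \<Longrightarrow> cube_chain Q p r (l + m)"
  by (induction rule: cube_chain.induct) (auto simp: add.assoc intro: cube_chain.intros)

lemma cube_chain_segment:
  assumes "(I, h) \<in> Q" "a \<in> unit_cube I" "b \<in> unit_cube I"
  shows "cube_chain Q (h a) (h b) (L2_set (\<lambda>i. a i - b i) I)"
  using cube_chain.intros(2)[OF assms cube_chain.intros(1)] by simp

lemma L2_set_minus_commute: "L2_set (\<lambda>i. a i - b i) I = L2_set (\<lambda>i. b i - a i :: real) I"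
  by (simp add: L2_set_def power2_commute)

lemma cube_chain_sym: "cube_chain Q p q l \<Longrightarrow> cube_chain Q q p l"
proof (induction rule: cube_chain.induct)
  case (2 I h a b q l)
  have "cube_chain Q (h b) (h a) (L2_set (\<lambda>i. a i - b i) I)"
    using cube_chain_segment[OF 2(1,3,2)] by (subst L2_set_minus_commute)
  with 2(5) have "cube_chain Q q (h a) (l + L2_set (\<lambda>i. a i - b i) I)" by (rule cube_chain_trans)
  then show ?case by (simp add: add.commute)
qed (rule cube_chain.intros)

lemma cube_dist_le: "cube_chain Q p q l \<Longrightarrow> cube_dist Q p q \<le> ennreal l"
  unfolding cube_dist_def by (rule INF_lower) simp

lemma cube_dist_less:
  assumes "cube_dist Q p q < ennreal r" obtains l where "cube_chain Q p q l" "l < r"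
proof -
  obtain l where "cube_chain Q p q l" "ennreal l < ennreal r"
    using assms unfolding cube_dist_def by (auto simp: INF_less_iff)
  then show thesis using that cube_chain_nonneg by (metis ennreal_less_iff)
qed

lemma L2_set_le:
  assumes "finite I" "J \<subseteq> I" "\<And>i. i \<in> J \<Longrightarrow> \<bar>f i\<bar> \<le> \<bar>g i\<bar>"
  shows "L2_set f J \<le> L2_set g I"
proof -
  have "(\<Sum>i\<in>J. (f i)\<^sup>2) \<le> (\<Sum>i\<in>J. (g i)\<^sup>2)"
    using assms(3) by (intro sum_mono) (simp add: abs_le_square_iff)
  also have "\<dots> \<le> (\<Sum>i\<in>I. (g i)\<^sup>2)" using assms(1,2) by (intro sum_mono2) auto
  finally show ?thesis unfolding L2_set_def by (rule real_sqrt_le_mono)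
qed

lemma abs_le_L2_set:
  assumes "finite I" "i \<in> I" shows "\<bar>f i\<bar> \<le> L2_set f I"
  using L2_set_le[of I "{i}" f f] assms by simp

lemma frac_uminus_frac: "frac (- frac t) = frac (- t)"
proof -
  have "- frac t - - t = of_int \<lfloor>t\<rfloor>" by (simp add: frac_def)
  then show ?thesis unfolding frac_eq_iff by (metis Ints_of_int)
qed

context oriented_graph
begin

abbreviation "QX \<equiv> conf_cubing n G ori"
abbreviation "QT \<equiv> raag_cubing (disjointness_graph G)"

lemma verts_disjointness [simp]: "verts (disjointness_graph G) = E"
  by (simp add: disjointness_graph_def)

lemma disjointness_edge_iff:
  assumes "e \<in> E" "f \<in> E"
  shows "{e, f} \<in> edges (disjointness_graph G) \<longleftrightarrow> e \<inter> f = {}"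
proof -
  have *: "closed_simplex G e' \<inter> closed_simplex G f' = {} \<longleftrightarrow> e' \<inter> f' = {}" if "e' \<in> E" "f' \<in> E" for e' f'
    using that by (intro closed_simplex_disjoint_iff) (simp_all add: simplices_def)
  show ?thesis
  proof
    assume "{e, f} \<in> edges (disjointness_graph G)"
    then obtain e' f' where ef: "{e, f} = {e', f'}" "e' \<in> E" "f' \<in> E" "closed_simplex G e' \<inter> closed_simplex G f' = {}"
      unfolding disjointness_graph_def ugraph.select_convs mem_Collect_eq by metis
    have "e' \<inter> f' = {}" using ef(4) *[OF ef(2,3)] by simp
    moreover have "e = e' \<and> f = f' \<or> e = f' \<and> f = e'" using ef(1) by (simp add: doubleton_eq_iff)
    ultimately show "e \<inter> f = {}" by (metis Int_commute)
  next
    assume "e \<inter> f = {}"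
    then have "closed_simplex G e \<inter> closed_simplex G f = {}" using *[OF assms] by simp
    then show "{e, f} \<in> edges (disjointness_graph G)"
      using assms unfolding disjointness_graph_def ugraph.select_convs by blast
  qed
qed

lemma cliques_iff: "U \<in> cliques (disjointness_graph G) \<longleftrightarrow> U \<subseteq> E \<and> disjoint U"
proof -
  have "(\<forall>u\<in>U. \<forall>v\<in>U. u \<noteq> v \<longrightarrow> {u, v} \<in> edges (disjointness_graph G)) \<longleftrightarrow>
      (\<forall>u\<in>U. \<forall>v\<in>U. u \<noteq> v \<longrightarrow> u \<inter> v = {})" if "U \<subseteq> E"
    using that by (intro ball_cong refl) (simp add: disjointness_edge_iff subset_iff)
  then show ?thesis unfolding cliques_def pairwise_def disjnt_def by (simp cong: conj_cong)
qed

lemma cells_disjoint: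
  assumes C: "C \<in> conf_cells n G" and "\<sigma> \<in> C" "\<tau> \<in> C" "\<sigma> \<noteq> \<tau>" shows "\<sigma> \<inter> \<tau> = {}"
proof -
  have "\<sigma> \<in> simplices G" "\<tau> \<in> simplices G" "closed_simplex G \<sigma> \<inter> closed_simplex G \<tau> = {}"
    using assms by (auto simp: conf_cells_def)
  then show ?thesis by (simp add: closed_simplex_disjoint_iff)
qed

lemma Phi_chain:
  assumes "cube_chain QX x y l"
  shows "cube_chain QT (Phi G ori x) (Phi G ori y) l"
  using assms
proof (induction rule: cube_chain.induct)
  case (2 I h a b q l)
  obtain C where C: "C \<in> conf_cells n G" "I = C \<inter> E" "h = conf_chart G ori C"
    using 2(1) by (auto simp: conf_cubing_def)
  have "disjoint I"
    unfolding pairwise_def disjnt_def using cells_disjoint[OF C(1)] C(2) by blast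
  then have "(I, torus_chart E I) \<in> QT"
    unfolding raag_cubing_def using cliques_iff[of I] C(2) by auto
  from cube_chain.intros(2)[OF this 2(2,3)] 2(5)
  show ?case
    using Phi_conf_chart[OF finite_graph orientation] 2(2,3) by (simp add: C(2,3))
qed (rule cube_chain.intros)

text \<open>
  The position on the circle of \<open>e\<close>, oriented such that it increases when the point at the end of \<open>e\<close> in \<open>S\<close>
  moves away from \<open>S\<close>.
\<close>

definition displacement :: "'a set \<Rightarrow> ('a set \<Rightarrow> real set) \<Rightarrow> 'a set \<Rightarrow> real" where
  "displacement S z e = (if fst (ori e) \<in> S then circle_rep (z e) else frac (- circle_rep (z e)))"

text \<open>
  Displacements close to \<open>1\<close> belong to points of the complex that leave the vertex in the opposite
  direction; they are collapsed to \<open>0\<close>. The threshold separates the two ranges in \<open>near_star\<close>.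
\<close>

definition fold_back :: "'a set \<Rightarrow> ('a set \<Rightarrow> real set) \<Rightarrow> 'a set \<Rightarrow> real" where
  "fold_back S z e = (if e \<in> leaving S \<and> displacement S z e < 3 / 4 then displacement S z e else 0)"

text \<open>
  Displacements stay away from the threshold of \<open>fold_back\<close>, where folding tears, as long as \<open>r \<le> 1 / 8\<close>.
\<close>

definition near_star :: "'a set \<Rightarrow> real \<Rightarrow> ('a set \<Rightarrow> real set) \<Rightarrow> bool" where
  "near_star S r z \<longleftrightarrow> (\<forall>e\<in>leaving S. displacement S z e < 1 / 2 + r \<or> 1 - r < displacement S z e)"

lemma displacement_chart:
  assumes "e \<in> E"
  shows "displacement S (torus_chart E U a) e = (if e \<in> U then frac (orient S a e) else 0)"
proof -
  have "frac (- a e) = frac (1 - a e)" by (simp add: frac_eq_iff)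
  then show ?thesis using assms by (simp add: displacement_def torus_chart_def orient_def frac_uminus_frac)
qed

lemma displacement_Phi:
  assumes a: "a \<in> star_heights S" and e: "e \<in> leaving S"
  shows "displacement S (Phi G ori (config S a)) e = a e"
proof -
  have b: "0 \<le> a e" "a e < 1" using a heightsD(1)[OF star_heightsD[OF a]] by (simp_all add: star_heights_def)
  have "frac (a e) = a e" using b by (simp add: frac_eq)
  then show ?thesis
    using leaving_E[OF e] by (simp add: displacement_def Phi_config[OF star_heightsD[OF a]] frac_uminus_frac)
qed

lemma fold_back_Phi:
  assumes a: "a \<in> star_heights S" and small: "\<And>e. a e < 3 / 4"
  shows "fold_back S (Phi G ori (config S a)) = a"
proof
  fix e
  show "fold_back S (Phi G ori (config S a)) e = a e"
    using displacement_Phi[OF a, of e] small[of e] heightsD(3)[OF star_heightsD[OF a], of e]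
    by (cases "e \<in> leaving S") (auto simp: fold_back_def)
qed

lemma near_star_Phi:
  assumes "a \<in> star_heights S" "\<And>e. a e < 1 / 2 + r"
  shows "near_star S r (Phi G ori (config S a))"
  unfolding near_star_def using displacement_Phi[OF assms(1)] assms(2) by simp

text \<open>
  Folding is the identity below its threshold and collapses above it; a segment this short does not pass
  from one side to the other.
\<close>

lemma fold_coordinate:
  fixes c d r l :: real
  assumes c: "0 \<le> c" "c \<le> 1" and d: "0 \<le> d" "d \<le> 1" and cd: "\<bar>c - d\<bar> \<le> l"
    and r: "0 < r" "r + l < 1 / 8" and near: "frac c < 1 / 2 + r \<or> 1 - r < frac c"
  shows "frac d < 1 / 2 + (r + l) \<or> 1 - (r + l) < frac d"
    and "\<bar>(if frac c < 3 / 4 then frac c else 0) - (if frac d < 3 / 4 then frac d else 0)\<bar> \<le> \<bar>c - d\<bar>"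
proof -
  have fc: "frac t = t" if "0 \<le> t" "t < 1" for t :: real using that by (simp add: frac_eq)
  have l: "0 \<le> l" using cd by linarith
  have f1: "frac (1::real) = 0" by simp
  consider "c < 1 / 2 + r" | "1 - r < c"
  proof (cases "c = 1")
    case True then show ?thesis using that(2) r by simp
  next
    case False then show ?thesis using that near fc[of c] c by auto
  qed
  then have "(frac d < 1 / 2 + (r + l) \<or> 1 - (r + l) < frac d) \<and>
    \<bar>(if frac c < 3 / 4 then frac c else 0) - (if frac d < 3 / 4 then frac d else 0)\<bar> \<le> \<bar>c - d\<bar>"
  proof cases
    case 1
    have "d < 1 / 2 + (r + l)" using 1 cd by linarith
    moreover have "c < 3 / 4" "d < 3 / 4" using 1 calculation r l by linarith+
    ultimately show ?thesis using fc[of c] fc[of d] c d by simp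
  next
    case 2
    have d1: "1 - (r + l) < d" using 2 cd by linarith
    have z: "(if frac t < 3 / 4 then frac t else 0) = 0" if "7 / 8 < t" "t \<le> 1" for t :: real
      using that fc[of t] f1 by (cases "t = 1") auto
    have "7 / 8 < c" "7 / 8 < d" using 2 d1 r l by linarith+
    then have "\<bar>(if frac c < 3 / 4 then frac c else 0) - (if frac d < 3 / 4 then frac d else 0)\<bar> = 0"
      using z[of c] z[of d] c d by simp
    moreover have "frac d < 1 / 2 + (r + l) \<or> 1 - (r + l) < frac d"
      using d1 fc[of d] f1 d r l by (cases "d = 1") auto
    ultimately show ?thesis by linarith
  qed
  then show "frac d < 1 / 2 + (r + l) \<or> 1 - (r + l) < frac d"
    and "\<bar>(if frac c < 3 / 4 then frac c else 0) - (if frac d < 3 / 4 then frac d else 0)\<bar> \<le> \<bar>c - d\<bar>"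
    by blast+
qed

text \<open>
  The edges of a cube in the complex are pairwise disjoint, so those among them that leave \<open>S\<close> can be
  moved simultaneously: they span a cube at the corner \<open>S\<close>. Folding maps the segment to one in this cube
  and does not increase the change of any coordinate.
\<close>

lemma fold_back_segment:
  assumes S: "S \<in> corners" and U: "U \<subseteq> E" "disjoint U"
    and a: "a \<in> unit_cube U" and b: "b \<in> unit_cube U"
    and near: "near_star S r (torus_chart E U a)" and r: "0 < r" "r + L2_set (\<lambda>i. a i - b i) U < 1 / 8"
  shows "near_star S (r + L2_set (\<lambda>i. a i - b i) U) (torus_chart E U b)" (is ?N)
    and "\<exists>l'\<le>L2_set (\<lambda>i. a i - b i) U.
      cube_chain QX (config S (fold_back S (torus_chart E U a))) (config S (fold_back S (torus_chart E U b))) l'" (is ?C)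
proof -
  let ?l = "L2_set (\<lambda>i. a i - b i) U"
  let ?z = "torus_chart E U a" and ?w = "torus_chart E U b"
  define U' where "U' = U \<inter> leaving S"
  have finU: "finite U" using U(1) finite_E by (rule finite_subset)
  have range: "0 \<le> orient S c e \<and> orient S c e \<le> 1" if "c \<in> unit_cube U" "e \<in> U" for c e
  proof -
    have "c e \<in> {0..1}" using that by (auto simp: unit_cube_def)
    then show ?thesis by (simp add: orient_def)
  qed
  have diff: "\<bar>orient S a e - orient S b e\<bar> = \<bar>a e - b e\<bar>" for e by (simp add: orient_def abs_minus_commute)
  have le: "\<bar>a e - b e\<bar> \<le> ?l" if "e \<in> U" for e using abs_le_L2_set[OF finU that, of "\<lambda>i. a i - b i"] .
  have key: "(displacement S ?w e < 1 / 2 + (r + ?l) \<or> 1 - (r + ?l) < displacement S ?w e) \<and>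
      \<bar>fold_back S ?z e - fold_back S ?w e\<bar> \<le> \<bar>a e - b e\<bar>" if e: "e \<in> U'" for e
  proof -
    have eU: "e \<in> U" "e \<in> leaving S" "e \<in> E" using e U(1) by (auto simp: U'_def)
    have "frac (orient S a e) < 1 / 2 + r \<or> 1 - r < frac (orient S a e)"
      using near eU displacement_chart[OF eU(3), of S U a] by (auto simp: near_star_def)
    from fold_coordinate[OF _ _ _ _ _ r this, of "orient S b e"]
    have "(frac (orient S b e) < 1 / 2 + (r + ?l) \<or> 1 - (r + ?l) < frac (orient S b e)) \<and>
      \<bar>(if frac (orient S a e) < 3 / 4 then frac (orient S a e) else 0) -
        (if frac (orient S b e) < 3 / 4 then frac (orient S b e) else 0)\<bar> \<le> \<bar>orient S a e - orient S b e\<bar>"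
      using range[OF a eU(1)] range[OF b eU(1)] le[OF eU(1)] diff[of e] by simp
    moreover have "displacement S ?w e = frac (orient S b e)"
      "fold_back S ?z e = (if frac (orient S a e) < 3 / 4 then frac (orient S a e) else 0)"
      "fold_back S ?w e = (if frac (orient S b e) < 3 / 4 then frac (orient S b e) else 0)"
      using eU by (simp_all add: fold_back_def displacement_chart)
    ultimately show ?thesis by (simp only: diff[of e])
  qed
  show ?N
    unfolding near_star_def
  proof
    fix e assume e: "e \<in> leaving S"
    show "displacement S ?w e < 1 / 2 + (r + ?l) \<or> 1 - (r + ?l) < displacement S ?w e"
    proof (cases "e \<in> U")
      case True then show ?thesis using key e by (simp add: U'_def)
    next
      case False
      have "0 < 1 / 2 + (r + ?l)" using r(1) L2_set_nonneg[of "\<lambda>i. a i - b i" U] by linarith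
      then show ?thesis using False leaving_E[OF e] by (simp add: displacement_chart)
    qed
  qed
  have U': "U' \<subseteq> leaving S" "disjoint U'" using U(2) by (auto simp: U'_def pairwise_def)
  have supp: "supp (fold_back S (torus_chart E U c)) \<subseteq> U'" for c
    using leaving_E by (auto simp: fold_back_def displacement_chart U'_def split: if_splits)
  have heights: "fold_back S (torus_chart E U c) \<in> heights S" for c
  proof (rule heightsI)
    fix e f assume "fold_back S (torus_chart E U c) e \<noteq> 0" "fold_back S (torus_chart E U c) f \<noteq> 0" "e \<noteq> f"
    then have "e \<in> U'" "f \<in> U'" using supp[of c] by auto
    then show "e \<inter> f = {}" using U'(2) \<open>e \<noteq> f\<close> by (auto simp: pairwise_def disjnt_def)
  next
    fix e
    show "0 \<le> fold_back S (torus_chart E U c) e" "fold_back S (torus_chart E U c) e \<le> 1"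
      using leaving_E by (auto simp: fold_back_def displacement_chart)
    show "e \<in> leaving S" if "fold_back S (torus_chart E U c) e \<noteq> 0"
      using that by (auto simp: fold_back_def split: if_splits)
  qed
  let ?a = "restrict (orient S (fold_back S ?z)) U'" and ?b = "restrict (orient S (fold_back S ?w)) U'"
  have U'E: "U' \<subseteq> E" using U(1) by (auto simp: U'_def)
  have "(U', conf_chart G ori (cell S U')) \<in> QX"
    unfolding conf_cubing_def using cell_in_cells[OF S U'] cell_edges[OF U'E] by auto
  from cube_chain_segment[OF this, of ?a ?b]
  have "cube_chain QX (config S (fold_back S ?z)) (config S (fold_back S ?w)) (L2_set (\<lambda>i. ?a i - ?b i) U')"
    using config_chart[OF heights U' supp] by simp
  moreover have "L2_set (\<lambda>i. ?a i - ?b i) U' \<le> ?l"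
  proof (rule L2_set_le[OF finU])
    fix e assume e: "e \<in> U'"
    have "\<bar>?a e - ?b e\<bar> = \<bar>fold_back S ?z e - fold_back S ?w e\<bar>"
      using e by (simp add: orient_def abs_minus_commute)
    then show "\<bar>?a e - ?b e\<bar> \<le> \<bar>a e - b e\<bar>" using key[OF e] by simp
  qed (simp add: U'_def)
  ultimately show ?C by blast
qed

lemma fold_back_chain:
  assumes "cube_chain QT z w l" and S: "S \<in> corners"
    and "near_star S r z" "0 < r" "r + l < 1 / 8"
  shows "\<exists>l'\<le>l. cube_chain QX (config S (fold_back S z)) (config S (fold_back S w)) l'"
  using assms(1,3,4,5)
proof (induction arbitrary: r rule: cube_chain.induct)
  case (1 p)
  show ?case using cube_chain.intros(1) by (metis order_refl)
next
  case (2 I h a b q l)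
  let ?m = "L2_set (\<lambda>i. a i - b i) I"
  have I: "h = torus_chart E I" "I \<subseteq> E" "disjoint I"
    using 2(1) cliques_iff[of I] by (auto simp: raag_cubing_def)
  have m: "0 \<le> ?m" by simp
  have l: "0 \<le> l" using 2(4) by (rule cube_chain_nonneg)
  have "r + ?m < 1 / 8" using 2 l by simp
  note seg = fold_back_segment[OF S I(2,3) 2(2,3) 2(6)[unfolded I(1)] 2(7) this]
  have "\<exists>l'\<le>l. cube_chain QX (config S (fold_back S (h b))) (config S (fold_back S q)) l'"
  proof (rule "2.IH")
    show "near_star S (r + ?m) (h b)" using seg(1) by (simp only: I(1))
    show "0 < r + ?m" using 2(7) m by linarith
    show "r + ?m + l < 1 / 8" using 2(8) by linarith
  qed
  then obtain l' where l': "l' \<le> l" "cube_chain QX (config S (fold_back S (h b))) (config S (fold_back S q)) l'" by blast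
  obtain m' where m': "m' \<le> ?m" "cube_chain QX (config S (fold_back S (h a))) (config S (fold_back S (h b))) m'"
    using seg(2) by (auto simp: I(1))
  have "cube_chain QX (config S (fold_back S (h a))) (config S (fold_back S q)) (m' + l')"
    using m'(2) l'(2) by (rule cube_chain_trans)
  then show ?case using l'(1) m'(1) by (meson add_mono)
qed

definition cell_point :: "('a set \<Rightarrow> real) \<Rightarrow> 'a set \<Rightarrow> 'a \<Rightarrow> real" where
  "cell_point c \<sigma> = (if \<sigma> \<in> E then edge_point (ori \<sigma>) (c \<sigma>) else vertex_point (the_elem \<sigma>))"

lemma conf_chart_cell_points:
  assumes C: "C \<in> conf_cells n G"
  shows "conf_chart G ori C c = cell_point c ` C"
proof -
  have simp: "\<sigma> \<in> E \<or> (\<exists>v. \<sigma> = {v})" if "\<sigma> \<in> C" for \<sigma>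
    using C that by (auto simp: conf_cells_def simplices_def)
  have nE: "{v} \<notin> E" for v using edge_card[of "{v}"] by auto
  show ?thesis
  proof (intro equalityI subsetI)
    fix q assume "q \<in> conf_chart G ori C c"
    then consider v where "{v} \<in> C" "q = vertex_point v"
      | e where "e \<in> C" "e \<in> E" "q = edge_point (ori e) (c e)"
      by (auto simp: conf_chart_def)
    then show "q \<in> cell_point c ` C"
    proof cases
      case 1
      then have "q = cell_point c {v}" using nE by (simp add: cell_point_def)
      then show ?thesis using 1 by blast
    next
      case 2
      then have "q = cell_point c e" by (simp add: cell_point_def)
      then show ?thesis using 2 by blast
    qed
  next
    fix q assume "q \<in> cell_point c ` C"
    then obtain \<sigma> where s: "\<sigma> \<in> C" "q = cell_point c \<sigma>" by blast
    then show "q \<in> conf_chart G ori C c"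
      using simp[OF s(1)] nE by (auto simp: conf_chart_def cell_point_def)
  qed
qed

lemma cell_point_realization:
  assumes C: "C \<in> conf_cells n G" and c: "c \<in> unit_cube (C \<inter> E)" and s: "\<sigma> \<in> C"
  shows "cell_point c \<sigma> \<in> realization G" "supp (cell_point c \<sigma>) \<subseteq> \<sigma>"
proof -
  have "cell_point c \<sigma> \<in> realization G \<and> supp (cell_point c \<sigma>) \<subseteq> \<sigma>"
  proof (cases "\<sigma> \<in> E")
    case True
    then have "c \<sigma> \<in> {0..1}" using c s by (auto simp: unit_cube_def)
    moreover obtain u w where "\<sigma> = {u, w}" "u \<noteq> w" "ori \<sigma> = (u, w)" using edge_pair[OF True] .
    ultimately show ?thesis
      using True edge_point_realization[of u w "c \<sigma>"] support_edge_point[of "(u, w)" "c \<sigma>"]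
      by (auto simp: cell_point_def)
  next
    case False
    then obtain v where "\<sigma> = {v}" "v \<in> verts G" using C s by (auto simp: conf_cells_def simplices_def)
    then show ?thesis using False by (simp add: cell_point_def)
  qed
  then show "cell_point c \<sigma> \<in> realization G" "supp (cell_point c \<sigma>) \<subseteq> \<sigma>" by auto
qed

lemma cell_point_disjoint:
  assumes C: "C \<in> conf_cells n G" and c: "c \<in> unit_cube (C \<inter> E)" and "\<sigma> \<in> C" "\<tau> \<in> C" "\<sigma> \<noteq> \<tau>"
  shows "supp (cell_point c \<sigma>) \<inter> supp (cell_point c \<tau>) = {}"
  using cell_point_realization(2)[OF C c assms(3)] cell_point_realization(2)[OF C c assms(4)]
    cells_disjoint[OF C assms(3-5)] by blast

lemma cell_point_inj:
  assumes C: "C \<in> conf_cells n G" and c: "c \<in> unit_cube (C \<inter> E)"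
  shows "inj_on (cell_point c) C"
proof (rule inj_onI, rule ccontr)
  fix \<sigma> \<tau> assume st: "\<sigma> \<in> C" "\<tau> \<in> C" "cell_point c \<sigma> = cell_point c \<tau>" "\<sigma> \<noteq> \<tau>"
  have "supp (cell_point c \<sigma>) = {}" using cell_point_disjoint[OF C c st(1,2,4)] st(3) by simp
  then show False using simplexD(2)[OF supp_simplex[OF cell_point_realization(1)[OF C c st(1)]]] by simp
qed

lemma conf_chart_in_X:
  assumes C: "C \<in> conf_cells n G" and c: "c \<in> unit_cube (C \<inter> E)"
  shows "conf_chart G ori C c \<in> X"
  unfolding X_iff conf_chart_cell_points[OF C]
proof (intro conjI ballI impI)
  have fin: "finite C" "card C = n" using C by (simp_all add: conf_cells_def)
  show "finite (cell_point c ` C)" using fin by simp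
  show "card (cell_point c ` C) = n" using card_image[OF cell_point_inj[OF C c]] fin by simp
  show "cell_point c ` C \<subseteq> realization G" using cell_point_realization(1)[OF C c] by auto
  fix q q' assume "q \<in> cell_point c ` C" "q' \<in> cell_point c ` C" "q \<noteq> q'"
  then obtain \<sigma> \<tau> where "\<sigma> \<in> C" "\<tau> \<in> C" "\<sigma> \<noteq> \<tau>" "q = cell_point c \<sigma>" "q' = cell_point c \<tau>" by blast
  then show "supp q \<inter> supp q' = {}" using cell_point_disjoint[OF C c] by simp
qed

lemma star_point_self_ge:
  assumes a: "a \<in> heights S" and s: "s \<in> S" and le: "\<And>e. a e \<le> \<delta>" and "0 \<le> \<delta>"
  shows "1 - \<delta> \<le> star_point S a s s"
  using a s
proof (cases rule: star_point_cases)
  case vertex then show ?thesis using \<open>0 \<le> \<delta>\<close> by (simp add: vertex_point_def)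
next
  case (edge w)
  then have "s \<noteq> w" using s by auto
  then show ?thesis using edge(4) le[of "{s, w}"] by (simp add: edge_point_apply)
qed

lemma height_le:
  assumes a: "a \<in> heights S" and ge: "\<And>s. s \<in> S \<Longrightarrow> 1 - \<delta> \<le> star_point S a s s" and "0 \<le> \<delta>"
  shows "a e \<le> \<delta>"
proof (cases "a e = 0")
  case False
  obtain s w where e: "e = {s, w}" "s \<in> S" "w \<notin> S" "e \<in> E"
    using heightsD(3)[OF a False] by (rule leavingE)
  have "star_point S a s = edge_point (s, w) (a {s, w})"
  proof (rule star_point_edge)
    fix e' assume "s \<in> e'" "e' \<noteq> {s, w}"
    then show "a e' = 0" using heightsD(4)[OF a, of e' e] False e(1) by blast
  qed (use e in auto)
  moreover have "s \<noteq> w" using e by auto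
  ultimately show ?thesis using ge[OF e(2)] e(1) by (simp add: edge_point_apply)
qed (use assms(3) in simp)

text \<open>
  Along a segment the weight at \<open>s\<close> of the point that started at \<open>s\<close> decreases by at most its length, so
  it remains positive and the configuration remains in the open star.
\<close>

lemma star_segment:
  assumes S: "S \<in> corners" and a: "a \<in> star_heights S" and le: "\<And>e. a e \<le> 1 / 2 + r"
    and C: "C \<in> conf_cells n G" and c: "c \<in> unit_cube (C \<inter> E)" and d: "d \<in> unit_cube (C \<inter> E)"
    and eq: "conf_chart G ori C c = config S a"
    and r: "0 \<le> r" "r + L2_set (\<lambda>i. c i - d i) (C \<inter> E) < 1 / 8"
  shows "\<exists>b\<in>star_heights S. conf_chart G ori C d = config S b \<and>
    (\<forall>e. b e \<le> 1 / 2 + (r + L2_set (\<lambda>i. c i - d i) (C \<inter> E)))"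
proof -
  let ?l = "L2_set (\<lambda>i. c i - d i) (C \<inter> E)"
  have aS: "a \<in> heights S" using a by (rule star_heightsD)
  have Sv: "S \<subseteq> verts G" "card S = n" using S by (simp_all add: corners_def)
  have fin: "finite C" "card C = n" using C by (simp_all add: conf_cells_def)
  have "\<exists>\<sigma>\<in>C. star_point S a s = cell_point c \<sigma>" if "s \<in> S" for s
  proof -
    have "star_point S a s \<in> cell_point c ` C"
      using eq that unfolding conf_chart_cell_points[OF C] config_def by simp
    then show ?thesis by blast
  qed
  then obtain g where g: "\<And>s. s \<in> S \<Longrightarrow> g s \<in> C" "\<And>s. s \<in> S \<Longrightarrow> star_point S a s = cell_point c (g s)"
    by metis
  have inj: "inj_on g S"
  proof (rule inj_onI)
    fix s s' assume s: "s \<in> S" "s' \<in> S" "g s = g s'"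
    then have "star_point S a s = star_point S a s'" using g by simp
    then show "s = s'" using inj_on_star_point[OF Sv(1) aS] s by (simp add: inj_on_def)
  qed
  moreover have "g ` S = C"
  proof (rule card_subset_eq)
    show "card (g ` S) = card C" using card_image[OF inj] Sv fin by simp
  qed (use fin g in auto)
  ultimately have bij_g: "bij_betw g S C" by (simp add: bij_betw_def)
  have "bij_betw (cell_point d) C (conf_chart G ori C d)"
    unfolding conf_chart_cell_points[OF C] using cell_point_inj[OF C d] by (rule inj_on_imp_bij_betw)
  from bij_betw_trans[OF bij_g this]
  have bij: "bij_betw (cell_point d \<circ> g) S (conf_chart G ori C d)" .
  have close: "\<bar>cell_point c \<sigma> s - cell_point d \<sigma> s\<bar> \<le> ?l" if s: "\<sigma> \<in> C" for \<sigma> s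
  proof (cases "\<sigma> \<in> E")
    case True
    obtain u w where uw: "\<sigma> = {u, w}" "u \<noteq> w" "ori \<sigma> = (u, w)" using edge_pair[OF True] .
    have "\<bar>cell_point c \<sigma> s - cell_point d \<sigma> s\<bar> \<le> \<bar>c \<sigma> - d \<sigma>\<bar>"
      using True uw by (simp add: cell_point_def edge_point_apply abs_minus_commute)
    also have "\<dots> \<le> ?l"
      using abs_le_L2_set[of "C \<inter> E" \<sigma> "\<lambda>i. c i - d i"] fin s True by simp
    finally show ?thesis .
  qed (simp add: cell_point_def)
  have ge: "1 - (1 / 2 + (r + ?l)) \<le> (cell_point d \<circ> g) s s" if s: "s \<in> S" for s
  proof -
    have "1 - (1 / 2 + r) \<le> star_point S a s s" using star_point_self_ge[OF aS s le] r by simp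
    then show ?thesis using g(2)[OF s] close[OF g(1)[OF s], of s] by simp
  qed
  have pos: "(cell_point d \<circ> g) s s > 0" if "s \<in> S" for s
    using ge[OF that] r by linarith
  obtain b where b: "b \<in> star_heights S" "conf_chart G ori C d = config S b"
    "\<And>s. s \<in> S \<Longrightarrow> star_point S b s = (cell_point d \<circ> g) s"
    using star_configuration[OF conf_chart_in_X[OF C d] S bij pos] by metis
  have "0 \<le> ?l" by simp
  then have "b e \<le> 1 / 2 + (r + ?l)" for e
    using height_le[OF star_heightsD[OF b(1)], of "1 / 2 + (r + ?l)" e] ge b(3) r by simp
  then show ?thesis using b by blast
qed

lemma star_chain:
  assumes "cube_chain QX x y l" and S: "S \<in> corners"
    and "a \<in> star_heights S" "x = config S a" "\<And>e. a e \<le> 1 / 2 + r" "0 \<le> r" "r + l < 1 / 8"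
  shows "\<exists>b\<in>star_heights S. y = config S b \<and> (\<forall>e. b e \<le> 1 / 2 + (r + l))"
  using assms(1,3-7)
proof (induction arbitrary: a r rule: cube_chain.induct)
  case (1 p)
  then show ?case by auto
next
  case (2 I h c d q l)
  let ?m = "L2_set (\<lambda>i. c i - d i) I"
  obtain C where C: "C \<in> conf_cells n G" "I = C \<inter> E" "h = conf_chart G ori C"
    using 2(1) by (auto simp: conf_cubing_def)
  have m: "0 \<le> ?m" by simp
  have l: "0 \<le> l" using 2(4) by (rule cube_chain_nonneg)
  have rm: "r + L2_set (\<lambda>i. c i - d i) (C \<inter> E) < 1 / 8" using 2(10) l by (simp add: C(2))
  obtain b where b: "b \<in> star_heights S" "h d = config S b" "\<And>e. b e \<le> 1 / 2 + (r + ?m)"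
    using star_segment[OF S 2(6,8) C(1) 2(2,3)[unfolded C(2)] 2(7)[unfolded C(3)] 2(9) rm]
    unfolding C(2,3) by metis
  have "0 \<le> r + ?m" "r + ?m + l < 1 / 8" using 2(9,10) m by simp_all
  from "2.IH"[OF b this] show ?case by (simp add: add.assoc)
qed

text \<open>
  Rounding \<open>p\<close> gives heights of at most \<open>1 / 2\<close>, so points at distance less than \<open>1 / 32\<close> have heights of at
  most \<open>1 / 2 + 1 / 32\<close>. A chain in the target shorter than \<open>1 / 16\<close> between their images stays in the range
  where it can be folded back, because \<open>3 / 64 + 1 / 16 < 1 / 8\<close>; a longer chain is no shortcut compared to the way
  through \<open>p\<close>.
\<close>

theorem local_isometry_Phi:
  "local_isometry X (cube_dist QX) (topspace (raag_complex (disjointness_graph G))) (cube_dist QT) (Phi G ori)"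
  unfolding local_isometry_def
proof (intro conjI ballI)
  show "Phi G ori ` X \<subseteq> topspace (raag_complex (disjointness_graph G))"
    using continuous_Phi by (rule continuous_map_image_subset_topspace)
  fix p assume pX: "p \<in> X"
  obtain S a where p: "S \<in> corners" "a \<in> star_heights S" "p = config S a" "\<And>e. a e \<le> 1 / 2"
    using rounded_configuration[OF pX] by metis
  have nearby: "\<exists>l b. l < 1 / 32 \<and> cube_chain QX p x l \<and> b \<in> star_heights S \<and> x = config S b \<and> (\<forall>e. b e \<le> 1 / 2 + 1 / 32)"
    if x: "cube_dist QX p x < ennreal (1 / 32)" for x
  proof -
    obtain l where l: "cube_chain QX p x l" "l < 1 / 32" using cube_dist_less[OF x] .
    obtain b where b: "b \<in> star_heights S" "x = config S b" "\<And>e. b e \<le> 1 / 2 + (0 + l)"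
      using star_chain[OF l(1) p(1,2,3), of 0] p(4) l(2) by auto
    have "b e \<le> 1 / 2 + 1 / 32" for e using b(3)[of e] l(2) by linarith
    then show ?thesis using b l by blast
  qed
  have "cube_dist QT (Phi G ori x) (Phi G ori y) = cube_dist QX x y"
    if x: "cube_dist QX p x < ennreal (1 / 32)" and y: "cube_dist QX p y < ennreal (1 / 32)" for x y
  proof (rule antisym)
    show "cube_dist QT (Phi G ori x) (Phi G ori y) \<le> cube_dist QX x y"
      unfolding cube_dist_def[of QX]
    proof (rule INF_greatest)
      fix l assume "l \<in> {l. cube_chain QX x y l}"
      then have "cube_chain QT (Phi G ori x) (Phi G ori y) l" by (simp add: Phi_chain)
      then show "cube_dist QT (Phi G ori x) (Phi G ori y) \<le> ennreal l" by (rule cube_dist_le)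
    qed
    obtain l1 b where b: "l1 < 1 / 32" "cube_chain QX p x l1" "b \<in> star_heights S" "x = config S b"
      "\<And>e. b e \<le> 1 / 2 + 1 / 32" using nearby[OF x] by metis
    obtain l2 b' where b': "l2 < 1 / 32" "cube_chain QX p y l2" "b' \<in> star_heights S" "y = config S b'"
      "\<And>e. b' e \<le> 1 / 2 + 1 / 32" using nearby[OF y] by metis
    have fold: "fold_back S (Phi G ori x) = b" "fold_back S (Phi G ori y) = b'"
    proof -
      have "b e < 3 / 4" "b' e < 3 / 4" for e using b(5)[of e] b'(5)[of e] by linarith+
      then show "fold_back S (Phi G ori x) = b" "fold_back S (Phi G ori y) = b'"
        using fold_back_Phi b(3,4) b'(3,4) by simp_all
    qed
    show "cube_dist QX x y \<le> cube_dist QT (Phi G ori x) (Phi G ori y)"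
      unfolding cube_dist_def[of QT]
    proof (rule INF_greatest)
      fix l assume "l \<in> {l. cube_chain QT (Phi G ori x) (Phi G ori y) l}"
      then have ch: "cube_chain QT (Phi G ori x) (Phi G ori y) l" by simp
      have "\<exists>l'\<le>l. cube_chain QX x y l'"
      proof (cases "l < 1 / 16")
        case True
        have "b e < 1 / 2 + 3 / 64" for e using b(5)[of e] by linarith
        then have "near_star S (3 / 64) (Phi G ori x)" using near_star_Phi[OF b(3)] b(4) by simp
        from fold_back_chain[OF ch p(1) this] True show ?thesis using fold b(4) b'(4) by simp
      next
        case False
        have "cube_chain QX x y (l1 + l2)" using cube_chain_trans[OF cube_chain_sym[OF b(2)] b'(2)] .
        moreover have "l1 + l2 \<le> l" using False b(1) b'(1) by linarith
        ultimately show ?thesis by blast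
      qed
      then obtain l' where "l' \<le> l" "cube_chain QX x y l'" by blast
      then show "cube_dist QX x y \<le> ennreal l"
        using cube_dist_le[of QX x y l'] by (meson ennreal_leI order_trans)
    qed
  qed
  then show "\<exists>r>0. \<forall>x\<in>X. \<forall>y\<in>X. cube_dist QX p x < ennreal r \<longrightarrow> cube_dist QX p y < ennreal r \<longrightarrow>
    cube_dist QT (Phi G ori x) (Phi G ori y) = cube_dist QX x y"
    by (intro exI[of _ "1 / 32"]) simp
qed

end

section \<open>Homotopies of paths\<close>

definition path_in :: "'b::topological_space set \<Rightarrow> 'b \<Rightarrow> 'b \<Rightarrow> (real \<Rightarrow> 'b) \<Rightarrow> bool" where
  "path_in A x y p \<longleftrightarrow> path p \<and> path_image p \<subseteq> A \<and> p 0 = x \<and> p 1 = y"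

lemma path_inD:
  assumes "path_in A x y p"
  shows "path p" "path_image p \<subseteq> A" "pathstart p = x" "pathfinish p = y" "t \<in> {0..1} \<Longrightarrow> p t \<in> A"
    "p 0 = x" "p 1 = y" "continuous_on {0..1} p"
  using assms by (auto simp: path_in_def pathstart_def pathfinish_def path_image_def path_def)

lemma path_in_iff:
  "path_in A x y p \<longleftrightarrow> continuous_on {0..1} p \<and> (\<forall>t\<in>{0..1}. p t \<in> A) \<and> p 0 = x \<and> p 1 = y"
  by (auto simp: path_in_def path_image_def path_def)

lemma path_in_join: "path_in A x y p \<Longrightarrow> path_in A y z q \<Longrightarrow> path_in A x z (p +++ q)"
  using pathstart_join[of p q] pathfinish_join[of p q]
  by (auto simp: path_in_def path_image_join pathstart_def pathfinish_def)

lemma path_in_reverse: "path_in A x y p \<Longrightarrow> path_in A y x (reversepath p)"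
  by (auto simp: path_in_def) (simp_all add: reversepath_def)

lemma path_in_const: "x \<in> A \<Longrightarrow> path_in A x x (\<lambda>_. x)"
  by (simp add: path_in_iff)

lemma path_in_subset: "path_in A x y p \<Longrightarrow> A \<subseteq> B \<Longrightarrow> path_in B x y p"
  by (auto simp: path_in_def)

lemma path_in_refl: "path_in A x y p \<Longrightarrow> homotopic_paths A p p"
  by (simp add: path_in_def)

text \<open>
  The groupoid laws below are changes of parameter, and any two changes of parameter with the same end
  points are joined by a straight line.
\<close>

lemma homotopic_reparametrizations:
  fixes \<phi> \<psi> :: "real \<Rightarrow> real"
  assumes p: "path_in A x y p"
    and \<phi>: "continuous_on {0..1} \<phi>" "\<And>t. t \<in> {0..1} \<Longrightarrow> \<phi> t \<in> {0..1}"
    and \<psi>: "continuous_on {0..1} \<psi>" "\<And>t. t \<in> {0..1} \<Longrightarrow> \<psi> t \<in> {0..1}"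
    and ends: "\<phi> 0 = \<psi> 0" "\<phi> 1 = \<psi> 1"
  shows "homotopic_paths A (\<lambda>t. p (\<phi> t)) (\<lambda>t. p (\<psi> t))"
proof -
  define h where "h = (\<lambda>x. p ((1 - fst x) * \<phi> (snd x) + fst x * \<psi> (snd x)))"
  have mem: "(1 - s) * \<phi> t + s * \<psi> t \<in> {0..1}" if "s \<in> {0..1}" "t \<in> {0..1}" for s t
    using convexD_alt[of "{0..1::real}" "\<phi> t" "\<psi> t" s] \<phi>(2)[OF that(2)] \<psi>(2)[OF that(2)] that(1) by simp
  have "continuous_on ({0..1} \<times> {0..1}) (\<lambda>x. (1 - fst x) * \<phi> (snd x) + fst x * \<psi> (snd x))"
    by (intro continuous_intros continuous_on_compose2[OF \<phi>(1)] continuous_on_compose2[OF \<psi>(1)]) auto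
  then have "continuous_on ({0..1} \<times> {0..1}) h"
    unfolding h_def by (rule continuous_on_compose2[OF path_inD(8)[OF p]]) (use mem in auto)
  moreover have "h \<in> {0..1} \<times> {0..1} \<rightarrow> A"
    using path_inD(5)[OF p] mem by (auto simp: h_def)
  ultimately show ?thesis
    unfolding homotopic_paths using ends
    by (intro exI[of _ h]) (simp add: h_def pathstart_def pathfinish_def algebra_simps)
qed

lemma homotopic_straight:
  fixes c :: "('i \<Rightarrow> real) \<Rightarrow> 'b::topological_space"
  assumes c: "continuous_on K c" "c ` K \<subseteq> A"
    and K: "\<And>x y s. x \<in> K \<Longrightarrow> y \<in> K \<Longrightarrow> s \<in> {0..1} \<Longrightarrow> (\<lambda>i. (1 - s) * x i + s * y i) \<in> K"
    and \<alpha>: "path_in K x y \<alpha>" and \<beta>: "path_in K x y \<beta>"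
  shows "homotopic_paths A (\<lambda>t. c (\<alpha> t)) (\<lambda>t. c (\<beta> t))"
proof -
  define h where "h = (\<lambda>z. c (\<lambda>i. (1 - fst z) * \<alpha> (snd z) i + fst z * \<beta> (snd z) i))"
  have co: "continuous_on {0..1} (\<lambda>t. \<alpha> t i)" "continuous_on {0..1} (\<lambda>t. \<beta> t i)" for i
    using continuous_on_product_then_coordinatewise[OF path_inD(8)[OF \<alpha>]]
      continuous_on_product_then_coordinatewise[OF path_inD(8)[OF \<beta>]] by auto
  have mem: "(\<lambda>i. (1 - s) * \<alpha> t i + s * \<beta> t i) \<in> K" if "s \<in> {0..1}" "t \<in> {0..1}" for s t
    using K path_inD(5)[OF \<alpha> that(2)] path_inD(5)[OF \<beta> that(2)] that(1) by blast
  have "continuous_on ({0..1} \<times> {0..1}) (\<lambda>z i. (1 - fst z) * \<alpha> (snd z) i + fst z * \<beta> (snd z) i)"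
    by (intro continuous_intros continuous_on_compose2[OF co(1)] continuous_on_compose2[OF co(2)]) auto
  then have "continuous_on ({0..1} \<times> {0..1}) h"
    unfolding h_def by (rule continuous_on_compose2[OF c(1)]) (use mem in auto)
  moreover have "h \<in> {0..1} \<times> {0..1} \<rightarrow> A" using c(2) mem by (auto simp: h_def)
  ultimately show ?thesis
    unfolding homotopic_paths using path_inD(6,7)[OF \<alpha>] path_inD(6,7)[OF \<beta>]
    by (intro exI[of _ h]) (simp add: h_def pathstart_def pathfinish_def algebra_simps)
qed

text \<open>
  In a star-shaped set every path can be pushed to the centre while its end points are dragged
  along the rays; the result \<open>hub\<close> only depends on the end points. During the first and the last third of
  the time the path rests at its ends, which leaves room for the rays.
\<close>

lemma homotopic_star:
  fixes c :: "('i \<Rightarrow> real) \<Rightarrow> 'b::topological_space"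
  assumes c: "continuous_on K c" "c ` K \<subseteq> A"
    and K: "\<And>x s. x \<in> K \<Longrightarrow> s \<in> {0..1} \<Longrightarrow> (\<lambda>i. s * x i) \<in> K"
    and \<alpha>: "path_in K x y \<alpha>" and \<beta>: "path_in K x y \<beta>"
  shows "homotopic_paths A (\<lambda>t. c (\<alpha> t)) (\<lambda>t. c (\<beta> t))"
proof -
  define \<sigma> where "\<sigma> t = max 0 (min 1 (3 * t - 1))" for t :: real
  define d where "d s t = 1 - min s (min (3 * t) (3 * (1 - t)))" for s t :: real
  define hub where "hub = (\<lambda>t. c (\<lambda>i. d 1 t * (if t \<le> 1 / 2 then x i else y i)))"
  have \<sigma>01: "\<sigma> t \<in> {0..1}" for t by (simp add: \<sigma>_def)
  have \<sigma>c: "continuous_on B \<sigma>" for B unfolding \<sigma>_def by (intro continuous_intros)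
  have d01: "d s t \<in> {0..1}" if "s \<in> {0..1}" "t \<in> {0..1}" for s t
    using that by (auto simp: d_def min_def)
  have contract: "homotopic_paths A (\<lambda>t. c (\<gamma> t)) hub" if \<gamma>: "path_in K x y \<gamma>" for \<gamma>
  proof -
    define h where "h = (\<lambda>z. c (\<lambda>i. d (fst z) (snd z) * \<gamma> (\<sigma> (snd z)) i))"
    have co: "continuous_on {0..1} (\<lambda>t. \<gamma> t i)" for i
      using continuous_on_product_then_coordinatewise[OF path_inD(8)[OF \<gamma>]] .
    have mem: "(\<lambda>i. d s t * \<gamma> (\<sigma> t) i) \<in> K" if "s \<in> {0..1}" "t \<in> {0..1}" for s t
      by (rule K[OF path_inD(5)[OF \<gamma> \<sigma>01] d01[OF that]])
    have "continuous_on ({0..1} \<times> {0..1}) (\<lambda>z. \<gamma> (\<sigma> (snd z)) i)" for i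
      by (rule continuous_on_compose2[OF co]) (auto intro!: continuous_on_compose2[OF \<sigma>c] continuous_intros simp: \<sigma>01[simplified])
    then have "continuous_on ({0..1} \<times> {0..1}) (\<lambda>z i. d (fst z) (snd z) * \<gamma> (\<sigma> (snd z)) i)"
      unfolding d_def by (intro continuous_on_coordinatewise_then_product continuous_intros)
    then have "continuous_on ({0..1} \<times> {0..1}) h"
      unfolding h_def by (rule continuous_on_compose2[OF c(1)]) (use mem in auto)
    moreover have "h \<in> {0..1} \<times> {0..1} \<rightarrow> A" using c(2) mem by (auto simp: h_def)
    moreover have "h (1, t) = hub t" if t: "t \<in> {0..1}" for t
    proof -
      consider "t \<le> 1 / 3" | "1 / 3 < t" "t < 2 / 3" | "2 / 3 \<le> t" by linarith
      then have "(\<lambda>i. d 1 t * \<gamma> (\<sigma> t) i) = (\<lambda>i. d 1 t * (if t \<le> 1 / 2 then x i else y i))"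
      proof cases
        case 1
        then have "\<sigma> t = 0" by (simp add: \<sigma>_def)
        then show ?thesis using 1 path_inD(6)[OF \<gamma>] by simp
      next
        case 2
        then have "d 1 t = 0" by (simp add: d_def min_def)
        then show ?thesis by simp
      next
        case 3
        then have "\<sigma> t = 1" by (simp add: \<sigma>_def)
        then show ?thesis using 3 path_inD(7)[OF \<gamma>] by simp
      qed
      then show ?thesis by (simp add: h_def hub_def)
    qed
    ultimately have "homotopic_paths A (\<lambda>t. c (\<gamma> (\<sigma> t))) hub"
      unfolding homotopic_paths
      by (intro exI[of _ h]) (auto simp: h_def d_def pathstart_def pathfinish_def \<sigma>_def)
    moreover have "homotopic_paths A (\<lambda>t. c (\<gamma> t)) (\<lambda>t. c (\<gamma> (\<sigma> t)))"
    proof (rule homotopic_reparametrizations[where \<phi> = "\<lambda>t. t" and \<psi> = \<sigma>])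
      show "path_in A (c x) (c y) (\<lambda>t. c (\<gamma> t))"
        unfolding path_in_iff
      proof (intro conjI ballI)
        have "\<gamma> ` {0..1} \<subseteq> K" using path_inD(5)[OF \<gamma>] by (rule image_subsetI)
        then show "continuous_on {0..1} (\<lambda>t. c (\<gamma> t))"
          by (rule continuous_on_compose2[OF c(1) path_inD(8)[OF \<gamma>]])
        show "c (\<gamma> t) \<in> A" if "t \<in> {0..1}" for t using path_inD(5)[OF \<gamma> that] c(2) by blast
      qed (simp_all add: path_inD(6,7)[OF \<gamma>])
      show "continuous_on {0..1} \<sigma>" by (rule \<sigma>c)
      show "\<sigma> t \<in> {0..1}" for t by (rule \<sigma>01)
      show "0 = \<sigma> 0" "1 = \<sigma> 1" by (simp_all add: \<sigma>_def)
    qed (auto intro: continuous_intros)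
    ultimately show ?thesis by (rule homotopic_paths_trans[rotated])
  qed
  show ?thesis
    using contract[OF \<alpha>] homotopic_paths_sym[OF contract[OF \<beta>]] by (rule homotopic_paths_trans)
qed

lemma homotopic_join_const:
  assumes p: "path_in A x y p"
  shows "homotopic_paths A (p +++ (\<lambda>_. y)) p" "homotopic_paths A ((\<lambda>_. x) +++ p) p"
proof -
  have 1: "p +++ (\<lambda>_. y) = (\<lambda>t. p (min 1 (2 * t)))"
  proof
    fix t :: real
    have "min 1 (2 * t) = (if t \<le> 1 / 2 then 2 * t else 1)" by simp
    then show "(p +++ (\<lambda>_. y)) t = p (min 1 (2 * t))"
      using path_inD(7)[OF p] by (simp add: joinpaths_def)
  qed
  have 2: "(\<lambda>_. x) +++ p = (\<lambda>t. p (max 0 (2 * t - 1)))"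
  proof
    fix t :: real
    have "max 0 (2 * t - 1) = (if t \<le> 1 / 2 then 0 else 2 * t - 1)" by simp
    then show "((\<lambda>_. x) +++ p) t = p (max 0 (2 * t - 1))"
      using path_inD(6)[OF p] by (simp add: joinpaths_def)
  qed
  show "homotopic_paths A (p +++ (\<lambda>_. y)) p"
    unfolding 1 by (rule homotopic_reparametrizations[OF p, where \<psi> = "\<lambda>t. t"]) (auto intro!: continuous_intros)
  show "homotopic_paths A ((\<lambda>_. x) +++ p) p"
    unfolding 2 by (rule homotopic_reparametrizations[OF p, where \<psi> = "\<lambda>t. t"]) (auto intro!: continuous_intros)
qed

lemma homotopic_join_reverse:
  assumes p: "path_in A x y p"
  shows "homotopic_paths A (p +++ reversepath p) (\<lambda>_. x)" "homotopic_paths A (reversepath p +++ p) (\<lambda>_. y)"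
proof -
  have *: "homotopic_paths A (p +++ reversepath p) (\<lambda>_. x)" if p: "path_in A x y p" for x y p
  proof -
    have 1: "p +++ reversepath p = (\<lambda>t. p (min (2 * t) (2 - 2 * t)))"
    proof
      fix t :: real
      have "min (2 * t) (2 - 2 * t) = (if t \<le> 1 / 2 then 2 * t else 1 - (2 * t - 1))" by simp
      then show "(p +++ reversepath p) t = p (min (2 * t) (2 - 2 * t))"
        by (simp add: joinpaths_def reversepath_def)
    qed
    have 2: "(\<lambda>_. x) = (\<lambda>_. p 0)" using path_inD(6)[OF p] by simp
    show ?thesis
      unfolding 1 2
    proof (rule homotopic_reparametrizations[OF p])
      show "continuous_on {0..1} (\<lambda>t::real. min (2 * t) (2 - 2 * t))" by (intro continuous_intros)
    qed auto
  qed
  show "homotopic_paths A (p +++ reversepath p) (\<lambda>_. x)" using *[OF p] .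
  show "homotopic_paths A (reversepath p +++ p) (\<lambda>_. y)" using *[OF path_in_reverse[OF p]] by simp
qed

lemma homotopic_join:
  assumes "homotopic_paths A p p'" "homotopic_paths A q q'" "path_in A x y p" "path_in A y z q"
  shows "homotopic_paths A (p +++ q) (p' +++ q')"
  by (rule homotopic_paths_join[OF assms(1,2)])
    (simp only: path_inD(4)[OF assms(3)] path_inD(3)[OF assms(4)])

lemma homotopic_assoc:
  assumes "path_in A x y p" "path_in A y z q" "path_in A z w r"
  shows "homotopic_paths A ((p +++ q) +++ r) (p +++ (q +++ r))"
proof (rule homotopic_paths_sym, rule homotopic_paths_assoc)
  show "pathfinish p = pathstart q" by (simp only: path_inD(4)[OF assms(1)] path_inD(3)[OF assms(2)])
  show "pathfinish q = pathstart r" by (simp only: path_inD(4)[OF assms(2)] path_inD(3)[OF assms(3)])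
qed (fact path_inD(1,2)[OF assms(1)] path_inD(1,2)[OF assms(2)] path_inD(1,2)[OF assms(3)])+

lemma homotopic_cancel_middle:
  assumes p: "path_in A x y p" and q: "path_in A y z q" and r: "path_in A y w r"
  shows "homotopic_paths A ((p +++ q) +++ (reversepath q +++ r)) (p +++ r)"
proof -
  have q': "path_in A z y (reversepath q)" using q by (rule path_in_reverse)
  have c: "path_in A y y (\<lambda>_. y)" using path_inD(5)[OF q, of 0] path_inD(6)[OF q] by (intro path_in_const) simp
  have 1: "homotopic_paths A (q +++ (reversepath q +++ r)) ((q +++ reversepath q) +++ r)"
    by (rule homotopic_paths_sym[OF homotopic_assoc[OF q q' r]])
  have 2: "homotopic_paths A ((q +++ reversepath q) +++ r) ((\<lambda>_. y) +++ r)"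
    by (rule homotopic_join[OF homotopic_join_reverse(1)[OF q] path_in_refl[OF r] path_in_join[OF q q'] r])
  have 3: "homotopic_paths A (q +++ (reversepath q +++ r)) r"
    using homotopic_paths_trans[OF 1 homotopic_paths_trans[OF 2 homotopic_join_const(2)[OF r]]] .
  have "homotopic_paths A ((p +++ q) +++ (reversepath q +++ r)) (p +++ (q +++ (reversepath q +++ r)))"
    by (rule homotopic_assoc[OF p q path_in_join[OF q' r]])
  also have "homotopic_paths A (p +++ (q +++ (reversepath q +++ r))) (p +++ r)"
    by (rule homotopic_join[OF path_in_refl[OF p] 3 p path_in_join[OF q path_in_join[OF q' r]]])
  finally show ?thesis .
qed

context oriented_graph
begin

section \<open>Paths traced by words\<close>

definition chart :: "'a set \<Rightarrow> ('a set \<Rightarrow> real) \<Rightarrow> 'a set \<Rightarrow> real" where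
  "chart S a = moments (config S a)"

definition corner_point :: "'a set \<Rightarrow> 'a set \<Rightarrow> real" where
  "corner_point S = chart S (\<lambda>_. 0)"

definition unit_height :: "'a set \<Rightarrow> 'a set \<Rightarrow> real" where
  "unit_height e f = (if f = e then 1 else 0)"

definition ray :: "'a set \<Rightarrow> ('a set \<Rightarrow> real) \<Rightarrow> real \<Rightarrow> 'a set \<Rightarrow> real" where
  "ray S a t = chart S (\<lambda>e. t * a e)"

abbreviation "edge_step S e \<equiv> ray S (unit_height e)"

lemma chart_Y: "S \<in> corners \<Longrightarrow> a \<in> heights S \<Longrightarrow> chart S a \<in> Y"
  unfolding chart_def using config_in_X by simp

lemma continuous_chart: "S \<in> corners \<Longrightarrow> continuous_on (heights S) (chart S)"
  using continuous_moments_config by (simp add: chart_def[abs_def])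

lemma scale_heights:
  assumes "a \<in> heights S" "t \<in> {0..1}" shows "(\<lambda>e. t * a e) \<in> heights S"
proof (rule heightsI)
  fix e
  show "0 \<le> t * a e" using heightsD(1)[OF assms(1)] assms(2) by simp
  show "t * a e \<le> 1" using heightsD(1,2)[OF assms(1)] assms(2) by (simp add: mult_le_one)
qed (use heightsD(3,4)[OF assms(1)] in auto)

lemma scale_star_heights:
  assumes "a \<in> star_heights S" "t \<in> {0..1}" shows "(\<lambda>e. t * a e) \<in> star_heights S"
proof -
  have "t * a e < 1" for e
  proof -
    have "t * a e \<le> 1 * a e"
      using assms heightsD(1)[OF star_heightsD[OF assms(1)]] by (intro mult_right_mono) auto
    also have "\<dots> < 1" using assms(1) by (simp add: star_heights_def)
    finally show ?thesis .
  qed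
  then show ?thesis
    using scale_heights[OF star_heightsD[OF assms(1)] assms(2)] by (simp add: star_heights_def)
qed

lemma zero_heights: "(\<lambda>_. 0) \<in> star_heights S"
  by (simp add: star_heights_def heights_def pairwise_def)

lemma unit_heights: "e \<in> leaving S \<Longrightarrow> unit_height e \<in> heights S"
  by (rule heightsI) (auto simp: unit_height_def split: if_splits)

lemma continuous_scale: "continuous_on A (\<lambda>t e. t * a e :: real)"
  by (intro continuous_on_coordinatewise_then_product continuous_intros)

lemma ray_path_in:
  assumes S: "S \<in> corners" and a: "a \<in> heights S"
  shows "path_in Y (corner_point S) (chart S a) (ray S a)"
proof -
  have "continuous_on {0..1} (\<lambda>t. chart S (\<lambda>e. t * a e))"
    by (rule continuous_on_compose2[OF continuous_chart[OF S] continuous_scale]) (auto intro: scale_heights[OF a, simplified])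
  then show ?thesis
    unfolding path_in_iff ray_def[abs_def] corner_point_def
    using chart_Y[OF S scale_heights[OF a]] by simp
qed

definition flip :: "'a set \<Rightarrow> 'a set \<Rightarrow> 'a set" where
  "flip S e = (S - e) \<union> (e - S)"

lemma flip_flip [simp]: "flip (flip S e) e = S"
  by (auto simp: flip_def)

lemma flip_eq: "s \<in> S \<Longrightarrow> w \<notin> S \<Longrightarrow> flip S {s, w} = insert w (S - {s})"
  by (auto simp: flip_def)

lemma flip_corner:
  assumes S: "S \<in> corners" and e: "e \<in> leaving S" shows "flip S e \<in> corners"
proof -
  obtain s w where sw: "e = {s, w}" "s \<in> S" "w \<notin> S" "e \<in> E" using e by (rule leavingE)
  have fin: "finite S" using S by (rule corner_finite)
  have "w \<notin> S - {s}" using sw(3) by simp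
  then have "card (insert w (S - {s})) = Suc (card (S - {s}))"
    using fin by (intro card_insert_disjoint) auto
  then have "card (insert w (S - {s})) = card S" by (simp only: card_Suc_Diff1[OF fin sw(2)])
  moreover have "w \<in> verts G" using edge_subset[OF sw(4)] sw(1) by simp
  ultimately show ?thesis using S sw by (auto simp: corners_def flip_eq)
qed

lemma leaving_flip: "e \<in> leaving S \<Longrightarrow> e \<in> leaving (flip S e)"
  by (auto simp: leaving_def flip_def)

lemma leaving_flip_disjoint: "e \<inter> f = {} \<Longrightarrow> f \<in> leaving (flip S e) \<longleftrightarrow> f \<in> leaving S"
  by (auto simp: leaving_def flip_def)

lemma flip_commute: "e \<inter> f = {} \<Longrightarrow> flip (flip S e) f = flip (flip S f) e"
  by (auto simp: flip_def)

text \<open>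
  A cube may be seen from any of its corners; moving the corner along an edge reverses the coordinate of
  this edge.
\<close>

lemma change_corner:
  assumes e: "e \<in> leaving S" and a: "a \<in> heights S"
    and apart: "\<And>f. a f \<noteq> 0 \<Longrightarrow> f \<noteq> e \<Longrightarrow> f \<inter> e = {}"
  shows "a(e := 1 - a e) \<in> heights (flip S e)" "config (flip S e) (a(e := 1 - a e)) = config S a"
proof -
  let ?a = "a(e := 1 - a e)" and ?S = "flip S e"
  obtain s w where sw: "e = {s, w}" "s \<in> S" "w \<notin> S" "e \<in> E" using e by (rule leavingE)
  have neq: "s \<noteq> w" using sw by auto
  have F: "?S = insert w (S - {s})" using sw by (simp add: flip_eq)
  show "?a \<in> heights ?S"
  proof (rule heightsI)
    fix f
    show "0 \<le> ?a f" "?a f \<le> 1" using heightsD(1,2)[OF a] by auto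
    assume f: "?a f \<noteq> 0"
    show "f \<in> leaving ?S"
    proof (cases "f = e")
      case True then show ?thesis using leaving_flip[OF e] by simp
    next
      case False
      then have "a f \<noteq> 0" using f by simp
      then have "f \<in> leaving S" "e \<inter> f = {}" using heightsD(3)[OF a] apart[of f] False by auto
      then show ?thesis using leaving_flip_disjoint by simp
    qed
  next
    fix f g assume fg: "?a f \<noteq> 0" "?a g \<noteq> 0" "f \<noteq> g"
    show "f \<inter> g = {}"
    proof -
      consider "f = e" "a g \<noteq> 0" "g \<noteq> e" | "g = e" "a f \<noteq> 0" "f \<noteq> e" | "a f \<noteq> 0" "a g \<noteq> 0"
        using fg by (auto split: if_splits)
      then show ?thesis
      proof cases
        case 1 then show ?thesis using apart[OF 1(2,3)] by (simp add: Int_commute)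
      next
        case 2 then show ?thesis using apart[OF 2(2,3)] by simp
      next
        case 3 then show ?thesis using heightsD(4)[OF a 3 fg(3)] by simp
      qed
    qed
  qed
  have moved: "star_point ?S ?a w = star_point S a s"
  proof -
    have "star_point S a s = edge_point (s, w) (a e)"
      unfolding sw(1)
    proof (rule star_point_edge)
      fix f assume "s \<in> f" "f \<noteq> {s, w}"
      then show "a f = 0" using apart[of f] sw(1) by auto
    qed (use sw in auto)
    moreover have "star_point ?S ?a w = edge_point (w, s) (?a {w, s})"
    proof (rule star_point_edge)
      fix f assume "w \<in> f" "f \<noteq> {w, s}"
      then show "?a f = 0" using apart[of f] sw(1) by (auto simp: insert_commute)
    qed (use sw F neq in \<open>auto simp: insert_commute\<close>)
    moreover have "?a {w, s} = 1 - a e" using sw(1) by (simp add: insert_commute)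
    ultimately show ?thesis by (simp add: edge_point_swap)
  qed
  have fixed: "star_point ?S ?a r = star_point S a r" if r: "r \<in> S" "r \<noteq> s" for r
  proof -
    have re: "r \<notin> e" using r sw by auto
    have rS: "r \<in> ?S" using r F by simp
    from a r(1) show ?thesis
    proof (cases rule: star_point_cases)
      case vertex
      have "star_point ?S ?a r = vertex_point r"
      proof (rule star_point_vertex[OF rS])
        fix f assume "r \<in> f" then show "?a f = 0" using vertex(2) re by auto
      qed
      then show ?thesis using vertex(1) by simp
    next
      case (edge v)
      have ne: "{r, v} \<noteq> e" using re by auto
      have v: "v \<notin> ?S" using apart[OF edge(3) ne] edge(2) sw(1) F by auto
      have "star_point ?S ?a r = edge_point (r, v) (?a {r, v})"
      proof (rule star_point_edge[OF edge(1) rS v])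
        fix f assume "r \<in> f" "f \<noteq> {r, v}"
        then show "?a f = 0" using edge(5)[of f] re by auto
      qed
      then show ?thesis using ne edge(4) by simp
    qed
  qed
  have "star_point ?S ?a ` ?S = insert (star_point ?S ?a w) (star_point ?S ?a ` (S - {s}))" by (simp add: F)
  also have "star_point ?S ?a ` (S - {s}) = star_point S a ` (S - {s})" by (rule image_cong[OF refl]) (use fixed in simp)
  also have "insert (star_point ?S ?a w) (star_point S a ` (S - {s})) = star_point S a ` insert s (S - {s})"
    by (simp only: moved image_insert)
  also have "\<dots> = star_point S a ` S" by (simp only: insert_Diff[OF sw(2)])
  finally show "config ?S ?a = config S a" by (simp only: config_def)
qed

definition face :: "'a set set \<Rightarrow> ('a set \<Rightarrow> real) set" where
  "face U = {a. (\<forall>e. 0 \<le> a e \<and> a e \<le> 1) \<and> (\<forall>e. e \<notin> U \<longrightarrow> a e = 0)}"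

lemma face_heights:
  assumes "U \<subseteq> leaving S" "disjoint U" shows "face U \<subseteq> heights S"
proof
  fix a assume a: "a \<in> face U"
  then have U: "e \<in> U" if "a e \<noteq> 0" for e using that by (auto simp: face_def)
  show "a \<in> heights S"
  proof (rule heightsI)
    show "0 \<le> a e" "a e \<le> 1" for e using a by (auto simp: face_def)
    show "e \<in> leaving S" if "a e \<noteq> 0" for e using U[OF that] assms(1) by auto
    show "e \<inter> f = {}" if "a e \<noteq> 0" "a f \<noteq> 0" "e \<noteq> f" for e f
      using pairwiseD[OF assms(2) U[OF that(1)] U[OF that(2)] that(3)] by (simp add: disjnt_def)
  qed
qed

lemma homotopic_in_cube:
  assumes S: "S \<in> corners" and U: "U \<subseteq> leaving S" "disjoint U"
    and \<alpha>: "path_in (face U) x y \<alpha>" and \<beta>: "path_in (face U) x y \<beta>"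
  shows "homotopic_paths Y (\<lambda>t. chart S (\<alpha> t)) (\<lambda>t. chart S (\<beta> t))"
proof (rule homotopic_straight[OF _ _ _ \<alpha> \<beta>])
  show "continuous_on (face U) (chart S)"
    using continuous_on_subset[OF continuous_chart[OF S] face_heights[OF U]] .
  show "chart S ` face U \<subseteq> Y" using chart_Y[OF S] face_heights[OF U] by auto
  fix x y :: "'a set \<Rightarrow> real" and s :: real
  assume xy: "x \<in> face U" "y \<in> face U" "s \<in> {0..1}"
  have "(1 - s) * x i + s * y i \<in> {0..1}" for i
    using convexD_alt[of "{0..1::real}" "x i" "y i" s] xy by (simp add: face_def)
  then show "(\<lambda>i. (1 - s) * x i + s * y i) \<in> face U" using xy by (simp add: face_def)
qed

text \<open>
  A generator acts on corners by the transposition of the two ends of an edge. A letter and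
  its inverse trace the same edge, because a transposition is its own inverse.
\<close>

fun edge_path :: "'a set \<Rightarrow> 'a set word \<Rightarrow> real \<Rightarrow> 'a set \<Rightarrow> real" where
  "edge_path S [] = (\<lambda>_. corner_point S)"
| "edge_path S ((e, b) # u) =
     (if e \<in> leaving S then edge_step S e +++ edge_path (flip S e) u else edge_path S u)"

fun word_end :: "'a set \<Rightarrow> 'a set word \<Rightarrow> 'a set" where
  "word_end S [] = S"
| "word_end S ((e, b) # u) = word_end (if e \<in> leaving S then flip S e else S) u"

lemma word_end_corner: "S \<in> corners \<Longrightarrow> word_end S u \<in> corners"
  by (induction S u rule: word_end.induct) (simp_all add: flip_corner)

lemma word_end_append: "word_end S (u @ v) = word_end (word_end S u) v"
  by (induction S u rule: word_end.induct) simp_all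

lemma chart_change_corner:
  assumes "e \<in> leaving S" "a \<in> heights S" "\<And>f. a f \<noteq> 0 \<Longrightarrow> f \<noteq> e \<Longrightarrow> f \<inter> e = {}"
  shows "chart (flip S e) (a(e := 1 - a e)) = chart S a"
  using change_corner(2)[OF assms] by (simp add: chart_def)

lemma chart_unit: 
  assumes "e \<in> leaving S" shows "chart S (unit_height e) = corner_point (flip S e)"
proof -
  have "(unit_height e)(e := 1 - unit_height e e) = (\<lambda>_. 0)" by (auto simp: unit_height_def)
  then show ?thesis
    using chart_change_corner[OF assms unit_heights[OF assms]] by (simp add: corner_point_def unit_height_def split: if_splits)
qed

lemma edge_step_path_in:
  assumes "S \<in> corners" "e \<in> leaving S"
  shows "path_in Y (corner_point S) (corner_point (flip S e)) (edge_step S e)"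
  using ray_path_in[OF assms(1) unit_heights[OF assms(2)]] by (simp add: chart_unit assms(2))

lemma corner_point_Y: "S \<in> corners \<Longrightarrow> corner_point S \<in> Y"
  unfolding corner_point_def by (rule chart_Y) (use zero_heights star_heightsD in auto)

lemma edge_path_in:
  "S \<in> corners \<Longrightarrow> path_in Y (corner_point S) (corner_point (word_end S u)) (edge_path S u)"
proof (induction S u rule: edge_path.induct)
  case (1 S) then show ?case by (simp add: path_in_const corner_point_Y)
next
  case (2 S e b u)
  show ?case
  proof (cases "e \<in> leaving S")
    case True
    then show ?thesis
      using path_in_join[OF edge_step_path_in[OF 2(3) True]] 2(1)[OF True flip_corner[OF 2(3) True]] by simp
  qed (use 2 in simp)
qed

lemma edge_path_append:
  "S \<in> corners \<Longrightarrow> homotopic_paths Y (edge_path S (u @ v)) (edge_path S u +++ edge_path (word_end S u) v)"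
proof (induction S u rule: edge_path.induct)
  case (1 S)
  then show ?case using homotopic_paths_sym[OF homotopic_join_const(2)[OF edge_path_in[OF 1]]] by simp
next
  case (2 S e b u)
  show ?case
  proof (cases "e \<in> leaving S")
    case True
    have F: "flip S e \<in> corners" using flip_corner[OF 2(3) True] .
    note st = edge_step_path_in[OF 2(3) True] and u = edge_path_in[OF F, of u]
      and v = edge_path_in[OF word_end_corner[OF F], of u v]
    have "homotopic_paths Y (edge_step S e +++ edge_path (flip S e) (u @ v))
        (edge_step S e +++ (edge_path (flip S e) u +++ edge_path (word_end (flip S e) u) v))"
      by (rule homotopic_join[OF path_in_refl[OF st] 2(1)[OF True F] st edge_path_in[OF F]])
    also have "homotopic_paths Y (edge_step S e +++ (edge_path (flip S e) u +++ edge_path (word_end (flip S e) u) v))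
        ((edge_step S e +++ edge_path (flip S e) u) +++ edge_path (word_end (flip S e) u) v)"
      by (rule homotopic_paths_sym[OF homotopic_assoc[OF st u v]])
    finally show ?thesis using True by simp
  qed (use 2 in simp)
qed

lemma edge_path_context:
  assumes S: "S \<in> corners"
    and eq: "\<And>S. S \<in> corners \<Longrightarrow> homotopic_paths Y (edge_path S x) (edge_path S y)"
    and ends: "\<And>S. S \<in> corners \<Longrightarrow> word_end S x = word_end S y"
  shows "homotopic_paths Y (edge_path S (u @ x @ v)) (edge_path S (u @ y @ v))"
proof -
  let ?R = "word_end S u"
  have R: "?R \<in> corners" using S by (rule word_end_corner)
  have split: "homotopic_paths Y (edge_path S (u @ z @ v))
      (edge_path S u +++ (edge_path ?R z +++ edge_path (word_end ?R z) v))" for z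
    using edge_path_append[OF S, of u "z @ v"]
  proof (rule homotopic_paths_trans)
    show "homotopic_paths Y (edge_path S u +++ edge_path ?R (z @ v))
        (edge_path S u +++ (edge_path ?R z +++ edge_path (word_end ?R z) v))"
      by (rule homotopic_join[OF path_in_refl[OF edge_path_in[OF S]] edge_path_append[OF R]
            edge_path_in[OF S] edge_path_in[OF R]])
  qed
  have "homotopic_paths Y (edge_path ?R x +++ edge_path (word_end ?R x) v)
      (edge_path ?R y +++ edge_path (word_end ?R x) v)"
    by (rule homotopic_join[OF eq[OF R] path_in_refl[OF edge_path_in] edge_path_in[OF R] edge_path_in])
      (rule word_end_corner[OF R])+
  then have mid: "homotopic_paths Y (edge_path ?R x +++ edge_path (word_end ?R x) v)
      (edge_path ?R y +++ edge_path (word_end ?R y) v)" by (simp only: ends[OF R])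
  have "homotopic_paths Y (edge_path S u +++ (edge_path ?R x +++ edge_path (word_end ?R x) v))
      (edge_path S u +++ (edge_path ?R y +++ edge_path (word_end ?R y) v))"
    by (rule homotopic_join[OF path_in_refl[OF edge_path_in[OF S]] mid edge_path_in[OF S]
          path_in_join[OF edge_path_in[OF R] edge_path_in[OF word_end_corner[OF R]]]])
  from homotopic_paths_trans[OF split[of x] homotopic_paths_trans[OF this homotopic_paths_sym[OF split[of y]]]]
  show ?thesis .
qed

lemma edge_step_reverse:
  assumes S: "S \<in> corners" and e: "e \<in> leaving S"
  shows "homotopic_paths Y (edge_step (flip S e) e) (reversepath (edge_step S e))"
proof -
  note F = edge_step_path_in[OF flip_corner[OF S e] leaving_flip[OF e]]
  show ?thesis
  proof (rule homotopic_paths_eq[OF path_inD(1,2)[OF F]])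
    fix t :: real assume t: "t \<in> {0..1}"
    define a where "a = (\<lambda>f. (1 - t) * unit_height e f)"
    have "1 - t \<in> {0..1}" using t by simp
    then have a: "a \<in> heights S" unfolding a_def by (rule scale_heights[OF unit_heights[OF e]])
    have eq: "a(e := 1 - a e) = (\<lambda>f. t * unit_height e f)" by (auto simp: a_def unit_height_def)
    have "chart (flip S e) (a(e := 1 - a e)) = chart S a"
      by (rule chart_change_corner[OF e a]) (auto simp: a_def unit_height_def split: if_splits)
    then show "edge_step (flip S e) e t = reversepath (edge_step S e) t"
      unfolding eq by (simp add: ray_def reversepath_def a_def)
  qed
qed

text \<open>
  The second letter crosses the edge in the opposite direction; if the edge does not leave \<open>S\<close>, then
  neither letter moves anything.
\<close>

lemma edge_path_cancel:
  assumes S: "S \<in> corners"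
  shows "homotopic_paths Y (edge_path S [(e, b), (e, c)]) (edge_path S [])" "word_end S [(e, b), (e, c)] = S"
proof -
  show "word_end S [(e, b), (e, c)] = S" using leaving_flip by simp
  show "homotopic_paths Y (edge_path S [(e, b), (e, c)]) (edge_path S [])"
  proof (cases "e \<in> leaving S")
    case True
    note F = flip_corner[OF S True] and L = leaving_flip[OF True]
    note st = edge_step_path_in[OF S True] and return = edge_step_path_in[OF F L, simplified]
    have "homotopic_paths Y (edge_step (flip S e) e +++ (\<lambda>_. corner_point S)) (reversepath (edge_step S e))"
      using homotopic_join_const(1)[OF return] edge_step_reverse[OF S True] by (rule homotopic_paths_trans)
    then have "homotopic_paths Y (edge_step S e +++ (edge_step (flip S e) e +++ (\<lambda>_. corner_point S)))
        (edge_step S e +++ reversepath (edge_step S e))"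
      by (rule homotopic_join[OF path_in_refl[OF st] _ st path_in_join[OF return path_in_const[OF corner_point_Y[OF S]]]])
    from homotopic_paths_trans[OF this homotopic_join_reverse(1)[OF st]]
    show ?thesis using True L by simp
  next
    case False
    then show ?thesis using path_in_refl[OF edge_path_in[OF S, of "[]"]] by simp
  qed
qed

text \<open>
  Both sides run along the boundary of the square of \<open>e\<close> and \<open>f\<close> at the corner \<open>S\<close>.
\<close>

lemma edge_square:
  assumes S: "S \<in> corners" and ef: "e \<in> leaving S" "f \<in> leaving S" "e \<inter> f = {}"
  shows "homotopic_paths Y (edge_step S e +++ edge_step (flip S e) f) (edge_step S f +++ edge_step (flip S f) e)"
proof -
  \<comment> \<open>First along \<open>e\<close>, then along \<open>f\<close>, in the coordinates at \<open>S\<close>.\<close>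
  define two where "two e f = (\<lambda>t. (\<lambda>g. t * unit_height e g)) +++ (\<lambda>t g. unit_height e g + t * unit_height f g)" for e f :: "'a set"
  have key: "path_in (face {e, f}) (\<lambda>_. 0) (\<lambda>g. unit_height e g + unit_height f g) (two e f) \<and>
    homotopic_paths Y (edge_step S e +++ edge_step (flip S e) f) (\<lambda>t. chart S (two e f t))"
    if ef: "e \<in> leaving S" "f \<in> leaving S" "e \<inter> f = {}" for e f
  proof -
    have neq: "e \<noteq> f" using ef by (auto simp: leaving_def)
    have c: "continuous_on {0..1} (\<lambda>t g. unit_height e g + t * unit_height f g :: real)"
      by (intro continuous_on_coordinatewise_then_product continuous_intros)
    have p1: "path_in (face {e, f}) (\<lambda>_. 0) (unit_height e) (\<lambda>t g. t * unit_height e g)"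
      unfolding path_in_iff using continuous_scale by (auto simp: face_def unit_height_def)
    have p2: "path_in (face {e, f}) (unit_height e) (\<lambda>g. unit_height e g + unit_height f g)
        (\<lambda>t g. unit_height e g + t * unit_height f g)"
      unfolding path_in_iff using c neq by (auto simp: face_def unit_height_def)
    have two: "path_in (face {e, f}) (\<lambda>_. 0) (\<lambda>g. unit_height e g + unit_height f g) (two e f)"
      unfolding two_def using p1 p2 by (rule path_in_join)
    have U: "{e, f} \<subseteq> leaving S" "disjoint {e, f}"
      using ef by (auto simp: pairwise_def disjnt_def Int_commute)
    have "f \<in> leaving (flip S e)" using ef leaving_flip_disjoint by simp
    note st = path_in_join[OF edge_step_path_in[OF S ef(1)] edge_step_path_in[OF flip_corner[OF S ef(1)] this]]
    have second: "edge_step (flip S e) f t = chart S (\<lambda>g. unit_height e g + t * unit_height f g)"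
      if t: "t \<in> {0..1}" for t
    proof -
      define a where "a = (\<lambda>g. unit_height e g + t * unit_height f g)"
      have "a \<in> face {e, f}" using path_inD(5)[OF p2 t] by (simp add: a_def)
      then have a: "a \<in> heights S" using face_heights[OF U] by blast
      have eq: "a(e := 1 - a e) = (\<lambda>g. t * unit_height f g)"
        using neq by (auto simp: a_def unit_height_def)
      have "chart (flip S e) (a(e := 1 - a e)) = chart S a"
        by (rule chart_change_corner[OF ef(1) a]) (use ef(3) in \<open>auto simp: a_def unit_height_def split: if_splits\<close>)
      then show ?thesis unfolding eq by (simp add: ray_def a_def)
    qed
    have "homotopic_paths Y (edge_step S e +++ edge_step (flip S e) f) (\<lambda>t. chart S (two e f t))"
    proof (rule homotopic_paths_eq[OF path_inD(1,2)[OF st]])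
      fix t :: real assume "t \<in> {0..1}"
      then show "(edge_step S e +++ edge_step (flip S e) f) t = chart S (two e f t)"
        using second[of "2 * t - 1"] by (auto simp: joinpaths_def two_def ray_def)
    qed
    then show ?thesis using two by simp
  qed
  have U: "{e, f} \<subseteq> leaving S" "disjoint {e, f}"
    using ef by (auto simp: pairwise_def disjnt_def Int_commute)
  have fe: "f \<inter> e = {}" using ef(3) by (simp add: Int_commute)
  have sw: "{f, e} = {e, f}" "(\<lambda>g. unit_height f g + unit_height e g) = (\<lambda>g. unit_height e g + unit_height f g)"
    by (auto simp: add.commute)
  note k1 = key[OF ef] and k2 = key[OF ef(2,1) fe, unfolded sw]
  have "homotopic_paths Y (\<lambda>t. chart S (two e f t)) (\<lambda>t. chart S (two f e t))"
    by (rule homotopic_in_cube[OF S U conjunct1[OF k1] conjunct1[OF k2]])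
  from homotopic_paths_trans[OF conjunct2[OF k1] homotopic_paths_trans[OF this homotopic_paths_sym[OF conjunct2[OF k2]]]]
  show ?thesis .
qed

text \<open>
  If at most one of the edges leaves \<open>S\<close>, then both words trace the same path, because crossing one edge does
  not affect the other.
\<close>

lemma edge_path_commute:
  assumes S: "S \<in> corners" and ef: "e \<inter> f = {}"
  shows "homotopic_paths Y (edge_path S [(e, b), (f, c)]) (edge_path S [(f, c), (e, b)])"
    "word_end S [(e, b), (f, c)] = word_end S [(f, c), (e, b)]"
proof -
  have fe: "f \<inter> e = {}" using ef by (simp add: Int_commute)
  note L = leaving_flip_disjoint[OF ef] leaving_flip_disjoint[OF fe]
  show "word_end S [(e, b), (f, c)] = word_end S [(f, c), (e, b)]"
    using flip_commute[OF ef] by (simp add: L)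
  show "homotopic_paths Y (edge_path S [(e, b), (f, c)]) (edge_path S [(f, c), (e, b)])"
  proof (cases "e \<in> leaving S \<and> f \<in> leaving S")
    case True
    have tail: "homotopic_paths Y (edge_path S [(e, b), (f, c)]) (edge_step S e +++ edge_step (flip S e) f)"
      if "e \<in> leaving S" "f \<in> leaving S" "e \<inter> f = {}" for e f b c
    proof -
      have f: "f \<in> leaving (flip S e)" using that leaving_flip_disjoint by simp
      note p = edge_step_path_in[OF S that(1)] and q = edge_step_path_in[OF flip_corner[OF S that(1)] f]
      note R = flip_corner[OF flip_corner[OF S that(1)] f]
      have "homotopic_paths Y (edge_step S e +++ (edge_step (flip S e) f +++ (\<lambda>_. corner_point (flip (flip S e) f))))
          (edge_step S e +++ edge_step (flip S e) f)"
        by (rule homotopic_join[OF path_in_refl[OF p] homotopic_join_const(1)[OF q] p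
              path_in_join[OF q path_in_const[OF corner_point_Y[OF R]]]])
      then show ?thesis using that f by simp
    qed
    from True tail[of e f b c] tail[of f e c b] edge_square[OF S, of e f] ef fe
    show ?thesis by (meson homotopic_paths_sym homotopic_paths_trans)
  next
    case False
    then have "edge_path S [(e, b), (f, c)] = edge_path S [(f, c), (e, b)]" by (auto simp: L)
    then show ?thesis using path_in_refl[OF edge_path_in[OF S]] by (simp only:)
  qed
qed

lemma edge_path_word_step:
  assumes S: "S \<in> corners" and st: "word_step E (raag_relators (disjointness_graph G)) u v"
  shows "homotopic_paths Y (edge_path S u) (edge_path S v)"
  using st
proof cases
  case (1 e u' w' b)
  show ?thesis
    unfolding 1(1,2) using edge_path_context[OF S edge_path_cancel(1)] edge_path_cancel(2) by simp
next
  case (2 l r u' w')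
  obtain e f where ef: "l = [(e, True), (f, True)]" "r = [(f, True), (e, True)]" "{e, f} \<in> edges (disjointness_graph G)"
    using 2(3) by (auto simp: raag_relators_def)
  have "e \<in> E" "f \<in> E" using 2(3-5) ef(3) by (auto simp: disjointness_graph_def doubleton_eq_iff)
  then have "e \<inter> f = {}" using ef(3) by (simp add: disjointness_edge_iff)
  then show ?thesis
    unfolding 2(1,2) ef(1,2) by (intro edge_path_context[OF S] edge_path_commute)
qed

lemma edge_path_weq:
  assumes S: "S \<in> corners" and "equivclp (word_step E (raag_relators (disjointness_graph G))) u v"
  shows "homotopic_paths Y (edge_path S u) (edge_path S v)"
  using assms(2)
proof (induction rule: equivclp_induct)
  case base show ?case using path_in_refl[OF edge_path_in[OF S]] .
next
  case (step y z)
  then have "homotopic_paths Y (edge_path S y) (edge_path S z)"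
    using edge_path_word_step[OF S] homotopic_paths_sym by blast
  with step(3) show ?case by (rule homotopic_paths_trans)
qed

end

section \<open>Straightening paths\<close>

definition subarc :: "real \<Rightarrow> real \<Rightarrow> (real \<Rightarrow> 'b) \<Rightarrow> real \<Rightarrow> 'b" where
  "subarc u v g t = g ((v - u) * t + u)"

lemma subarc_join_homotopic:
  fixes u v w :: real
  assumes g: "path_in A x y g" and uvw: "0 \<le> u" "u \<le> v" "v \<le> w" "w \<le> 1"
  shows "homotopic_paths A (subarc u v g +++ subarc v w g) (subarc u w g)"
proof -
  define \<phi> where "\<phi> t = u + (v - u) * min 1 (2 * t) + (w - v) * max 0 (2 * t - 1)" for t :: real
  have 1: "subarc u v g +++ subarc v w g = (\<lambda>t. g (\<phi> t))"
  proof
    fix t :: real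
    have "min 1 (2 * t) = (if t \<le> 1 / 2 then 2 * t else 1)" "max 0 (2 * t - 1) = (if t \<le> 1 / 2 then 0 else 2 * t - 1)"
      by simp_all
    then show "(subarc u v g +++ subarc v w g) t = g (\<phi> t)"
      by (simp add: \<phi>_def joinpaths_def subarc_def algebra_simps)
  qed
  have 2: "subarc u w g = (\<lambda>t. g ((w - u) * t + u))" by (simp add: subarc_def fun_eq_iff)
  have r1: "\<phi> t \<in> {0..1}" if "t \<in> {0..1}" for t :: real
  proof -
    define A where "A = (v - u) * min 1 (2 * t)"
    define B where "B = (w - v) * max 0 (2 * t - 1)"
    have "0 \<le> A" "A \<le> (v - u) * 1"
      unfolding A_def using that uvw by (intro mult_nonneg_nonneg mult_left_mono; simp)+
    moreover have "0 \<le> B" "B \<le> (w - v) * 1"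
      unfolding B_def using that uvw by (intro mult_nonneg_nonneg mult_left_mono; simp)+
    moreover have "\<phi> t = u + A + B" by (simp add: \<phi>_def A_def B_def)
    ultimately show ?thesis using uvw by simp
  qed
  have r2: "(w - u) * t + u \<in> {0..1}" if "t \<in> {0..1}" for t :: real
  proof -
    define A where "A = (w - u) * t"
    have "0 \<le> A" "A \<le> (w - u) * 1"
      unfolding A_def using that uvw by (intro mult_nonneg_nonneg mult_left_mono; simp)+
    then have "A + u \<in> {0..1}" using uvw by simp
    then show ?thesis by (simp only: A_def)
  qed
  show ?thesis
    unfolding 1 2
  proof (rule homotopic_reparametrizations[OF g])
    show "continuous_on {0..1} \<phi>" unfolding \<phi>_def by (intro continuous_intros)
    show "continuous_on {0..1} (\<lambda>t. (w - u) * t + u)" by (intro continuous_intros)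
    show "\<phi> t \<in> {0..1}" if "t \<in> {0..1}" for t using that by (rule r1)
    show "(w - u) * t + u \<in> {0..1}" if "t \<in> {0..1}" for t using that by (rule r2)
  qed (simp_all add: \<phi>_def)
qed

lemma subarc_path_in:
  fixes u v :: real
  assumes g: "path_in A x y g" and uv: "0 \<le> u" "u \<le> v" "v \<le> 1" and B: "\<And>t. u \<le> t \<Longrightarrow> t \<le> v \<Longrightarrow> g t \<in> B"
  shows "path_in B (g u) (g v) (subarc u v g)"
proof -
  have r: "u \<le> (v - u) * t + u" "(v - u) * t + u \<le> v" if "t \<in> {0..1}" for t :: real
  proof -
    define A where "A = (v - u) * t"
    have A: "0 \<le> A" "A \<le> (v - u) * 1"
      unfolding A_def using that uv by (intro mult_nonneg_nonneg mult_left_mono; simp)+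
    have "u \<le> A + u" "A + u \<le> v" using A by simp_all
    then show "u \<le> (v - u) * t + u" "(v - u) * t + u \<le> v" by (simp_all only: A_def)
  qed
  have r': "(v - u) * t + u \<in> {0..1}" if "t \<in> {0..1}" for t
    using order_trans[OF uv(1) r(1)[OF that]] order_trans[OF r(2)[OF that] uv(3)] by simp
  have "continuous_on {0..1} (\<lambda>t. (v - u) * t + u)" by (intro continuous_intros)
  moreover have "(\<lambda>t. (v - u) * t + u) ` {0..1} \<subseteq> {0..1}" using r' by (rule image_subsetI)
  ultimately have "continuous_on {0..1} (\<lambda>t. g ((v - u) * t + u))"
    by (rule continuous_on_compose2[OF path_inD(8)[OF g]])
  then show ?thesis
    unfolding path_in_iff subarc_def[abs_def] using B r by simp
qed

lemma homotopic_two_blocks: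
  assumes a: "path_in A x1 x2 a" and b: "path_in A x2 x3 b" and c: "path_in A x3 x4 c"
    and d: "path_in A x3 x5 d" and e: "path_in A x5 x6 e"
  shows "homotopic_paths A ((a +++ (b +++ c)) +++ (reversepath c +++ (d +++ e))) (a +++ ((b +++ d) +++ e))"
proof -
  note c' = path_in_reverse[OF c]
  have "homotopic_paths A ((a +++ (b +++ c)) +++ (reversepath c +++ (d +++ e)))
      (a +++ ((b +++ c) +++ (reversepath c +++ (d +++ e))))"
    by (rule homotopic_assoc[OF a path_in_join[OF b c] path_in_join[OF c' path_in_join[OF d e]]])
  also have "homotopic_paths A (a +++ ((b +++ c) +++ (reversepath c +++ (d +++ e)))) (a +++ (b +++ (d +++ e)))"
    by (rule homotopic_join[OF path_in_refl[OF a] homotopic_cancel_middle[OF b c path_in_join[OF d e]] a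
          path_in_join[OF path_in_join[OF b c] path_in_join[OF c' path_in_join[OF d e]]]])
  also have "homotopic_paths A (a +++ (b +++ (d +++ e))) (a +++ ((b +++ d) +++ e))"
    by (rule homotopic_join[OF path_in_refl[OF a] homotopic_paths_sym[OF homotopic_assoc[OF b d e]] a
          path_in_join[OF b path_in_join[OF d e]]])
  finally show ?thesis .
qed

context oriented_graph
begin

text \<open>
  Every letter crosses an edge, in the direction given by its sign.
\<close>

fun admissible :: "'a set \<Rightarrow> 'a set word \<Rightarrow> bool" where
  "admissible S [] \<longleftrightarrow> True"
| "admissible S ((e, b) # u) \<longleftrightarrow>
     e \<in> leaving S \<and> (b \<longleftrightarrow> fst (ori e) \<in> S) \<and> admissible (flip S e) u"

lemma admissible_append: "admissible S (u @ v) \<longleftrightarrow> admissible S u \<and> admissible (word_end S u) v"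
  by (induction S u rule: admissible.induct) auto

text \<open>
  A vertex \<open>s\<close> of \<open>S\<close> outside \<open>S1\<close> and the vertex of \<open>S1\<close> with the same point of the configuration are the
  ends of an occupied edge. Crossing this edge brings the corner closer to \<open>S1\<close>, and within the cube of
  the configuration the detour via the new corner is homotopic to the edge.
\<close>

lemma transition:
  assumes "S \<in> corners" "S1 \<in> corners" "a \<in> star_heights S" "b \<in> star_heights S1" "config S a = config S1 b"
  shows "\<exists>u. admissible S u \<and> word_end S u = S1 \<and>
    homotopic_paths Y (ray S a +++ reversepath (ray S1 b)) (edge_path S u)"
  using assms(1,3,5)
proof (induction "card (S - S1)" arbitrary: S a rule: less_induct)
  case (less S a)
  have fin: "finite S" "finite S1" and cards: "card S = n" "card S1 = n"
    using corner_finite[OF less.prems(1)] corner_finite[OF assms(2)] less.prems(1) assms(2)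
    by (simp_all add: corners_def)
  note aS = star_heightsD[OF less.prems(2)] and bS = star_heightsD[OF assms(4)]
  show ?case
  proof (cases "S \<subseteq> S1")
    case True
    then have eq: "S = S1" using fin cards by (intro card_subset_eq) simp_all
    have "a = recover S (moments (config S a))" by (rule recover_moments[OF less.prems(1,2), symmetric])
    also have "\<dots> = recover S1 (moments (config S1 b))" by (subst less.prems(3)) (simp only: eq)
    also have "\<dots> = b" by (rule recover_moments[OF assms(2,4)])
    finally have ray: "ray S1 b = ray S a" by (simp only: eq)
    have "homotopic_paths Y (ray S a +++ reversepath (ray S1 b)) (edge_path S [])"
      unfolding ray edge_path.simps
      by (rule homotopic_join_reverse(1)[OF ray_path_in[OF less.prems(1) aS]])
    then show ?thesis using eq by (intro exI[of _ "[]"]) simp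
  next
    case False
    then obtain s where s: "s \<in> S" "s \<notin> S1" by blast
    have "star_point S a s \<in> config S a" unfolding config_def using s(1) by (rule imageI)
    then have "star_point S a s \<in> config S1 b" by (simp only: less.prems(3))
    then obtain s1 where s1: "s1 \<in> S1" "star_point S a s = star_point S1 b s1" by (auto simp: config_def)
    have ne: "s1 \<noteq> s" using s1(1) s(2) by auto
    have pos: "star_point S a s s1 > 0" using star_point_self_pos[OF assms(4) s1(1)] s1(2) by simp
    obtain e where e: "e = {s, s1}" "e \<in> E" "s1 \<notin> S" "a e \<noteq> 0"
      using aS s(1)
    proof (cases rule: star_point_cases)
      case vertex
      then show ?thesis using pos ne by (simp add: vertex_point_def)
    next
      case (edge w)
      then have "s1 = w" using pos ne by (simp add: edge_point_apply split: if_splits)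
      then show ?thesis using edge that[of "{s, w}"] by simp
    qed
    have L: "e \<in> leaving S" using leavingI[of s s1 S] e s by simp
    define S2 where "S2 = flip S e"
    define a' where "a' = a(e := 1 - a e)"
    have S2: "S2 \<in> corners" unfolding S2_def using less.prems(1) L by (rule flip_corner)
    have apart: "f \<inter> e = {}" if "a f \<noteq> 0" "f \<noteq> e" for f using heightsD(4)[OF aS that(1) e(4) that(2)] .
    have a'S: "a' \<in> heights S2" "config S2 a' = config S a"
      unfolding S2_def a'_def using change_corner[OF L aS apart] by auto
    have "a' f < 1" for f
    proof (cases "f = e")
      case True then show ?thesis using heightsD(1)[OF aS, of e] e(4) by (simp add: a'_def)
    next
      case False then show ?thesis using less.prems(2) by (simp add: a'_def star_heights_def)
    qed
    then have a'star: "a' \<in> star_heights S2" using a'S(1) by (simp add: star_heights_def)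
    have "S2 - S1 = (S - S1) - {s}" using e(1,3) s s1(1) by (auto simp: S2_def flip_eq)
    then have "card (S2 - S1) < card (S - S1)" using s fin by (simp add: card_Diff1_less del: card_Diff_insert)
    from less.hyps[OF this S2 a'star] obtain u where u: "admissible S2 u" "word_end S2 u = S1"
      "homotopic_paths Y (ray S2 a' +++ reversepath (ray S1 b)) (edge_path S2 u)"
      using a'S(2) less.prems(3) by auto
    define U where "U = supp a"
    have U: "U \<subseteq> leaving S" "disjoint U" using aS by (auto simp: U_def heights_def)
    \<comment> \<open>The reversed ray from the new corner in the coordinates at the old one: a straight path from \<open>a\<close> to the far end of \<open>e\<close>.\<close>
    define \<alpha>2 where "\<alpha>2 t f = (1 - t) * a f + t * unit_height e f" for t f
    have p1: "path_in (face U) (\<lambda>_. 0) a (\<lambda>t f. t * a f)"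
      unfolding path_in_iff
    proof (intro conjI ballI)
      fix t :: real assume t: "t \<in> {0..1}"
      then show "(\<lambda>f. t * a f) \<in> face U"
        using heightsD(1,2)[OF scale_heights[OF aS t]] by (simp add: face_def U_def)
    qed (simp_all add: continuous_scale)
    have p2: "path_in (face U) a (unit_height e) \<alpha>2"
      unfolding path_in_iff
    proof (intro conjI ballI)
      show "continuous_on {0..1} \<alpha>2"
        unfolding \<alpha>2_def by (intro continuous_on_coordinatewise_then_product continuous_intros)
      fix t :: real assume t: "t \<in> {0..1}"
      have "(1 - t) * a f + t * unit_height e f \<in> {0..1}" for f
        using convexD_alt[of "{0..1::real}" "a f" "unit_height e f" t] t heightsD(1,2)[OF aS, of f]
        by (simp add: unit_height_def)
      then show "\<alpha>2 t \<in> face U" using e(4) by (auto simp: face_def U_def \<alpha>2_def unit_height_def)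
    qed (simp_all add: \<alpha>2_def fun_eq_iff)
    have p3: "path_in (face U) (\<lambda>_. 0) (unit_height e) (\<lambda>t f. t * unit_height e f)"
      unfolding path_in_iff using e(4) continuous_scale by (auto simp: face_def U_def unit_height_def)
    have second: "reversepath (ray S2 a') t = chart S (\<alpha>2 t)" if t: "t \<in> {0..1}" for t
    proof -
      have "\<alpha>2 t \<in> face U" using path_inD(5)[OF p2 t] .
      then have h: "\<alpha>2 t \<in> heights S" using face_heights[OF U] by blast
      have "chart S2 ((\<alpha>2 t)(e := 1 - \<alpha>2 t e)) = chart S (\<alpha>2 t)"
        unfolding S2_def
      proof (rule chart_change_corner[OF L h])
        fix f assume "\<alpha>2 t f \<noteq> 0" "f \<noteq> e"
        then show "f \<inter> e = {}" by (intro apart) (auto simp: \<alpha>2_def unit_height_def)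
      qed
      moreover have "(\<alpha>2 t)(e := 1 - \<alpha>2 t e) = (\<lambda>f. (1 - t) * a' f)"
        by (auto simp: \<alpha>2_def a'_def unit_height_def algebra_simps)
      ultimately show ?thesis by (simp add: reversepath_def ray_def)
    qed
    have end_a': "chart S2 a' = chart S a" using a'S(2) by (simp add: chart_def)
    note r1 = ray_path_in[OF less.prems(1) aS]
    note r2 = ray_path_in[OF S2 a'S(1), unfolded end_a']
    have end_b: "chart S1 b = chart S a" using less.prems(3) by (simp add: chart_def)
    note r3 = path_in_reverse[OF ray_path_in[OF assms(2) bS, unfolded end_b]]
    have "homotopic_paths Y (ray S a +++ reversepath (ray S2 a'))
        (\<lambda>t. chart S (((\<lambda>t f. t * a f) +++ \<alpha>2) t))"
    proof (rule homotopic_paths_eq[OF path_inD(1,2)[OF path_in_join[OF r1 path_in_reverse[OF r2]]]])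
      fix t :: real assume "t \<in> {0..1}"
      then show "(ray S a +++ reversepath (ray S2 a')) t = chart S (((\<lambda>t f. t * a f) +++ \<alpha>2) t)"
        using second[of "2 * t - 1"] by (auto simp: joinpaths_def ray_def)
    qed
    moreover have "homotopic_paths Y (\<lambda>t. chart S (((\<lambda>t f. t * a f) +++ \<alpha>2) t)) (\<lambda>t. chart S (\<lambda>f. t * unit_height e f))"
      by (rule homotopic_in_cube[OF less.prems(1) U path_in_join[OF p1 p2] p3])
    ultimately have "homotopic_paths Y (ray S a +++ reversepath (ray S2 a')) (\<lambda>t. chart S (\<lambda>f. t * unit_height e f))"
      by (rule homotopic_paths_trans)
    moreover have "(\<lambda>t. chart S (\<lambda>f. t * unit_height e f)) = edge_step S e" by (simp add: ray_def fun_eq_iff)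
    ultimately have one: "homotopic_paths Y (ray S a +++ reversepath (ray S2 a')) (edge_step S e)" by simp
    have "homotopic_paths Y (ray S a +++ reversepath (ray S1 b))
        ((ray S a +++ reversepath (ray S2 a')) +++ (ray S2 a' +++ reversepath (ray S1 b)))"
      using homotopic_paths_sym[OF homotopic_cancel_middle[OF r1 path_in_reverse[OF r2] r3]] by simp
    also have "homotopic_paths Y ((ray S a +++ reversepath (ray S2 a')) +++ (ray S2 a' +++ reversepath (ray S1 b)))
        (edge_step S e +++ edge_path S2 u)"
      by (rule homotopic_join[OF one u(3) path_in_join[OF r1 path_in_reverse[OF r2]] path_in_join[OF r2 r3]])
    finally have "homotopic_paths Y (ray S a +++ reversepath (ray S1 b)) (edge_path S ((e, fst (ori e) \<in> S) # u))"
      using L by (simp add: S2_def)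
    then show ?thesis
      using u(1,2) L by (intro exI[of _ "(e, fst (ori e) \<in> S) # u"]) (simp add: S2_def)
  qed
qed

definition star_ray :: "'a set \<Rightarrow> ('a set \<Rightarrow> real) \<Rightarrow> real \<Rightarrow> 'a set \<Rightarrow> real" where
  "star_ray S y = ray S (recover S y)"

lemma recover_star:
  assumes "S \<in> corners" "y \<in> Star S"
  shows "recover S y \<in> star_heights S" "chart S (recover S y) = y"
proof -
  obtain a where a: "a \<in> star_heights S" "y = moments (config S a)" using assms(2) by (auto simp: Star_def)
  then show "recover S y \<in> star_heights S" "chart S (recover S y) = y"
    using recover_moments[OF assms(1) a(1)] by (simp_all add: chart_def)
qed

lemma star_ray_in_star:
  assumes S: "S \<in> corners" and y: "y \<in> Star S"
  shows "path_in (Star S) (corner_point S) y (star_ray S y)"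
proof -
  note r = recover_star[OF S y]
  have "path_in Y (corner_point S) y (star_ray S y)"
    using ray_path_in[OF S star_heightsD[OF r(1)]] r(2) by (simp add: star_ray_def)
  moreover have "star_ray S y t \<in> Star S" if "t \<in> {0..1}" for t
    using scale_star_heights[OF r(1) that] by (simp add: star_ray_def ray_def chart_def Star_def)
  ultimately show ?thesis by (simp add: path_in_iff)
qed

lemma star_ray_in_Y:
  assumes "S \<in> corners" "y \<in> Star S"
  shows "path_in Y (corner_point S) y (star_ray S y)"
  using star_ray_in_star[OF assms] Star_subset[OF assms(1)] by (rule path_in_subset)

lemma continuous_recover:
  assumes S: "S \<in> corners" shows "continuous_on (Star S) (recover S)"
proof (rule continuous_on_coordinatewise_then_product)
  fix e
  have c: "continuous_on (Star S) (\<lambda>y. y \<sigma>)" for \<sigma>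
    by (rule continuous_on_subset[OF continuous_on_product_coordinates]) simp
  show "continuous_on (Star S) (\<lambda>y. recover S y e)"
  proof (cases "e \<in> leaving S")
    case True
    then obtain s w where "e = {s, w}" "s \<in> S" by (rule leavingE)
    then have "foot S e \<in> S" using foot_eq[OF True, of s] by simp
    then have "y {foot S e} \<noteq> 0" if "y \<in> Star S" for y using Star_pos[OF S that] by force
    then show ?thesis using True by (simp add: recover_def c continuous_on_divide)
  qed (simp add: recover_def)
qed

lemma homotopic_in_star:
  assumes S: "S \<in> corners" and g: "path_in (Star S) x y g" and g': "path_in (Star S) x y g'"
  shows "homotopic_paths Y g g'"
proof -
  have lift: "path_in (star_heights S) (recover S x) (recover S y) (\<lambda>t. recover S (g t))"
    if g: "path_in (Star S) x y g" for g
    unfolding path_in_iff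
  proof (intro conjI ballI)
    have "g ` {0..1} \<subseteq> Star S" using path_inD(5)[OF g] by (rule image_subsetI)
    then show "continuous_on {0..1} (\<lambda>t. recover S (g t))"
      by (rule continuous_on_compose2[OF continuous_recover[OF S] path_inD(8)[OF g]])
    show "recover S (g t) \<in> star_heights S" if "t \<in> {0..1}" for t
      using recover_star(1)[OF S path_inD(5)[OF g that]] .
  qed (simp_all add: path_inD(6,7)[OF g])
  have same: "homotopic_paths Y g (\<lambda>t. chart S (recover S (g t)))" if g: "path_in (Star S) x y g" for g
    using path_in_subset[OF g Star_subset[OF S]] recover_star(2)[OF S path_inD(5)[OF g]]
    by (intro homotopic_paths_eq) (simp_all add: path_in_def)
  have sub: "star_heights S \<subseteq> heights S" using star_heightsD by (rule subsetI)
  have "homotopic_paths Y (\<lambda>t. chart S (recover S (g t))) (\<lambda>t. chart S (recover S (g' t)))"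
  proof (rule homotopic_star[OF _ _ _ lift[OF g] lift[OF g']])
    show "continuous_on (star_heights S) (chart S)" using continuous_chart[OF S] sub by (rule continuous_on_subset)
    show "chart S ` star_heights S \<subseteq> Y" using chart_Y[OF S] sub by auto
  qed (rule scale_star_heights)
  from homotopic_paths_trans[OF same[OF g] homotopic_paths_trans[OF this homotopic_paths_sym[OF same[OF g']]]]
  show ?thesis .
qed

text \<open>
  \<open>g\<close> runs from the star of \<open>S\<close> to the star of \<open>word_end S w\<close> and is homotopic to the path that goes to
  the first corner, follows the word, and returns from the last corner.
\<close>

definition straight :: "'a set \<Rightarrow> 'a set word \<Rightarrow> ('a set \<Rightarrow> real) \<Rightarrow> ('a set \<Rightarrow> real) \<Rightarrow> (real \<Rightarrow> 'a set \<Rightarrow> real) \<Rightarrow> bool" where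
  "straight S w x y g \<longleftrightarrow> homotopic_paths Y g
     (reversepath (star_ray S x) +++ (edge_path S w +++ star_ray (word_end S w) y))"

lemma straight_join:
  assumes S: "S \<in> corners" and x: "x \<in> Star S" and y: "y \<in> Star (word_end S u)"
    and z: "z \<in> Star (word_end (word_end S u) v)"
    and f: "path_in Y x y f" and g: "path_in Y y z g"
    and sf: "straight S u x y f" and sg: "straight (word_end S u) v y z g"
  shows "straight S (u @ v) x z (f +++ g)"
proof -
  let ?R = "word_end S u"
  have R: "?R \<in> corners" using S by (rule word_end_corner)
  have Z: "word_end ?R v \<in> corners" using R by (rule word_end_corner)
  note a = path_in_reverse[OF star_ray_in_Y[OF S x]] and b = edge_path_in[OF S, of u]
    and c = star_ray_in_Y[OF R y] and d = edge_path_in[OF R, of v] and e = star_ray_in_Y[OF Z z]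
  have "homotopic_paths Y (f +++ g)
      ((reversepath (star_ray S x) +++ (edge_path S u +++ star_ray ?R y)) +++
       (reversepath (star_ray ?R y) +++ (edge_path ?R v +++ star_ray (word_end ?R v) z)))"
    using sf sg unfolding straight_def by (rule homotopic_join[OF _ _ f g])
  also have "homotopic_paths Y \<dots>
      (reversepath (star_ray S x) +++ ((edge_path S u +++ edge_path ?R v) +++ star_ray (word_end ?R v) z))"
    by (rule homotopic_two_blocks[OF a b c d e])
  also have "homotopic_paths Y \<dots>
      (reversepath (star_ray S x) +++ (edge_path S (u @ v) +++ star_ray (word_end ?R v) z))"
  proof (rule homotopic_join[OF path_in_refl[OF a] _ a path_in_join[OF path_in_join[OF b d] e]])
    show "homotopic_paths Y ((edge_path S u +++ edge_path ?R v) +++ star_ray (word_end ?R v) z)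
        (edge_path S (u @ v) +++ star_ray (word_end ?R v) z)"
      by (rule homotopic_join[OF homotopic_paths_sym[OF edge_path_append[OF S]] path_in_refl[OF e]
            path_in_join[OF b d] e])
  qed
  finally show ?thesis by (simp add: straight_def word_end_append)
qed

lemma straight_in_star:
  assumes S: "S \<in> corners" and g: "path_in (Star S) x y g"
  shows "straight S [] x y g"
proof -
  have x: "x \<in> Star S" "y \<in> Star S" using path_inD(5)[OF g, of 0] path_inD(5)[OF g, of 1] path_inD(6,7)[OF g] by auto
  have c: "corner_point S \<in> Star S"
    using path_inD(5)[OF star_ray_in_star[OF S x(1)], of 0] path_inD(6)[OF star_ray_in_star[OF S x(1)]] by simp
  show ?thesis
    unfolding straight_def edge_path.simps word_end.simps
    by (rule homotopic_in_star[OF S g path_in_join[OF path_in_reverse[OF star_ray_in_star[OF S x(1)]]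
            path_in_join[OF path_in_const[OF c] star_ray_in_star[OF S x(2)]]]])
qed

text \<open>
  A resting path is straightened by moving between two corners whose stars contain the point.
\<close>

lemma straight_change:
  assumes S: "S \<in> corners" "S1 \<in> corners" and y: "y \<in> Star S" "y \<in> Star S1"
  obtains u where "admissible S u" "word_end S u = S1" "straight S u y y (\<lambda>_. y)"
proof -
  note r = star_ray_in_Y[OF S(1) y(1)] and r1 = star_ray_in_Y[OF S(2) y(2)]
  note a = recover_star[OF S(1) y(1)] and b = recover_star[OF S(2) y(2)]
  have "config S (recover S y) = config S1 (recover S1 y)"
  proof (rule inj_onD[OF inj_moments])
    show "moments (config S (recover S y)) = moments (config S1 (recover S1 y))" using a(2) b(2) by (simp add: chart_def)
  qed (rule config_in_X[OF S(1) star_heightsD[OF a(1)]] config_in_X[OF S(2) star_heightsD[OF b(1)]])+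
  from transition[OF S a(1) b(1) this]
  obtain u where u: "admissible S u" "word_end S u = S1"
    "homotopic_paths Y (star_ray S y +++ reversepath (star_ray S1 y)) (edge_path S u)"
    unfolding star_ray_def by metis
  note r1' = path_in_reverse[OF r1] and E = edge_path_in[OF S(1), of u, unfolded u(2)]
  have yY: "y \<in> Y" using y(1) Star_subset[OF S(1)] by blast
  have "homotopic_paths Y (\<lambda>_. y) (reversepath (star_ray S y) +++ star_ray S y)"
    by (rule homotopic_paths_sym[OF homotopic_join_reverse(2)[OF r]])
  also have "homotopic_paths Y \<dots> (reversepath (star_ray S y) +++ (edge_path S u +++ star_ray S1 y))"
  proof (rule homotopic_join[OF path_in_refl[OF path_in_reverse[OF r]] _ path_in_reverse[OF r] r])
    have "homotopic_paths Y (star_ray S y) (star_ray S y +++ (\<lambda>_. y))"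
      by (rule homotopic_paths_sym[OF homotopic_join_const(1)[OF r]])
    also have "homotopic_paths Y \<dots> (star_ray S y +++ (reversepath (star_ray S1 y) +++ star_ray S1 y))"
      by (rule homotopic_join[OF path_in_refl[OF r] homotopic_paths_sym[OF homotopic_join_reverse(2)[OF r1]] r
            path_in_const[OF yY]])
    also have "homotopic_paths Y \<dots> ((star_ray S y +++ reversepath (star_ray S1 y)) +++ star_ray S1 y)"
      by (rule homotopic_paths_sym[OF homotopic_assoc[OF r r1' r1]])
    also have "homotopic_paths Y \<dots> (edge_path S u +++ star_ray S1 y)"
      by (rule homotopic_join[OF u(3) path_in_refl[OF r1] path_in_join[OF r r1'] r1])
    finally show "homotopic_paths Y (star_ray S y) (edge_path S u +++ star_ray S1 y)" .
  qed
  finally have "straight S u y y (\<lambda>_. y)" by (simp add: straight_def u(2))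
  with u(1,2) show thesis by (rule that)
qed

text \<open>
  Bisection. The property is inherited by concatenations, because words with matching corners can be
  joined. A short piece stays in a single open star, where only the end points of a path matter; changes of corner at its
  two ends adapt it to the prescribed stars.
\<close>

lemma straighten:
  assumes g: "path_in Y x y g" and S: "S \<in> corners" "S' \<in> corners" and ends: "x \<in> Star S" "y \<in> Star S'"
  obtains w where "admissible S w" "word_end S w = S'" "straight S w x y g"
proof -
  define P where "P a b \<longleftrightarrow> (0 \<le> a \<longrightarrow> a \<le> b \<longrightarrow> b \<le> 1 \<longrightarrow>
    (\<forall>S\<in>corners. \<forall>S'\<in>corners. g a \<in> Star S \<longrightarrow> g b \<in> Star S' \<longrightarrow>
      (\<exists>w. admissible S w \<and> word_end S w = S' \<and> straight S w (g a) (g b) (subarc a b g))))" for a b :: real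
  have gY: "g t \<in> Y" if "0 \<le> t" "t \<le> 1" for t using path_inD(5)[OF g, of t] that by simp
  have sub: "path_in Y (g a) (g b) (subarc a b g)" if "0 \<le> a" "a \<le> b" "b \<le> 1" for a b
    by (rule subarc_path_in[OF g that]) (use that in \<open>auto intro!: gY\<close>)
  have "P 0 1"
  proof (rule Bolzano)
    show "(0::real) \<le> 1" by simp
  next
    fix a b c :: real assume P: "P a b" "P b c" "a \<le> b" "b \<le> c"
    show "P a c"
      unfolding P_def
    proof (intro impI ballI)
      fix S S' assume ac: "0 \<le> a" "a \<le> c" "c \<le> 1" and S: "S \<in> corners" "S' \<in> corners" "g a \<in> Star S" "g c \<in> Star S'"
      have "g b \<in> Y" using gY[of b] ac P by linarith
      then obtain R where R: "R \<in> corners" "g b \<in> Star R" by (rule rounded_Star)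
      obtain u where u: "admissible S u" "word_end S u = R" "straight S u (g a) (g b) (subarc a b g)"
        using P(1) P(3,4) ac S R unfolding P_def by (meson order_trans)
      obtain v where v: "admissible R v" "word_end R v = S'" "straight R v (g b) (g c) (subarc b c g)"
        using P(2) P(3,4) ac S R unfolding P_def by (meson order_trans)
      have ab: "0 \<le> b" "b \<le> 1" using ac P by linarith+
      have "straight S (u @ v) (g a) (g c) (subarc a b g +++ subarc b c g)"
        using straight_join[OF S(1,3), of "g b" u "g c" v, unfolded u(2) v(2), OF R(2) S(4)
            sub[OF ac(1) P(3) ab(2)] sub[OF ab(1) P(4) ac(3)] u(3) v(3)] .
      then have "straight S (u @ v) (g a) (g c) (subarc a c g)"
        using homotopic_paths_sym[OF subarc_join_homotopic[OF g ac(1) P(3,4) ac(3)]]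
        unfolding straight_def by (rule homotopic_paths_trans[rotated])
      then show "\<exists>w. admissible S w \<and> word_end S w = S' \<and> straight S w (g a) (g c) (subarc a c g)"
        using u v by (intro exI[of _ "u @ v"]) (simp add: admissible_append word_end_append)
    qed
  next
    fix x :: real assume x: "0 \<le> x" "x \<le> 1"
    obtain R where R: "R \<in> corners" "g x \<in> Star R" using rounded_Star[OF gY[OF x]] by metis
    obtain B where B: "open B" "Star R = Y \<inter> B" using Star_open[OF R(1)] by metis
    have "g x \<in> B" using R(2) B(2) by blast
    moreover have "continuous (at x within {0..1}) g"
      using path_inD(8)[OF g] x by (simp add: continuous_on_eq_continuous_within)
    ultimately have "eventually (\<lambda>t. g t \<in> B) (at x within {0..1})"
      using B(1) unfolding continuous_within by (rule topological_tendstoD[rotated 2])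
    then obtain d where d: "d > 0" "\<And>t. t \<in> {0..1} \<Longrightarrow> t \<noteq> x \<Longrightarrow> dist t x < d \<Longrightarrow> g t \<in> B"
      unfolding eventually_at by blast
    have near: "g t \<in> Star R" if "0 \<le> t" "t \<le> 1" "\<bar>t - x\<bar> < d" for t
      using d(2)[of t] that \<open>g x \<in> B\<close> gY[OF that(1,2)] B(2) by (cases "t = x") (auto simp: dist_real_def)
    have "P a b" if ab: "a \<le> x" "x \<le> b" "b - a < d" for a b
      unfolding P_def
    proof (intro impI ballI)
      fix S S' assume ab': "0 \<le> a" "a \<le> b" "b \<le> 1" and S: "S \<in> corners" "S' \<in> corners" "g a \<in> Star S" "g b \<in> Star S'"
      have gR: "path_in (Star R) (g a) (g b) (subarc a b g)"
        by (rule subarc_path_in[OF g ab']) (use ab ab' in \<open>auto intro!: near\<close>)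
      then have aR: "g a \<in> Star R" and bR: "g b \<in> Star R" using near ab ab' by auto
      obtain u where u: "admissible S u" "word_end S u = R" "straight S u (g a) (g a) (\<lambda>_. g a)"
        using straight_change[OF S(1) R(1) S(3) aR] by metis
      obtain v where v: "admissible R v" "word_end R v = S'" "straight R v (g b) (g b) (\<lambda>_. g b)"
        using straight_change[OF R(1) S(2) bR S(4)] by metis
      note ca = path_in_const[of "g a" Y] and cb = path_in_const[of "g b" Y]
      have Ya: "g a \<in> Y" "g b \<in> Y" using gY ab ab' by auto
      note gab = path_in_subset[OF gR Star_subset[OF R(1)]]
      have "straight R ([] @ v) (g a) (g b) (subarc a b g +++ (\<lambda>_. g b))"
        using straight_join[OF R(1) aR, of "g b" "[]" "g b" v, unfolded word_end.simps v(2), OF bR S(4) gab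
            cb[OF Ya(2)] straight_in_star[OF R(1) gR] v(3)] .
      then have "straight R v (g a) (g b) (subarc a b g +++ (\<lambda>_. g b))" by simp
      from straight_join[OF S(1,3), of "g a" u "g b" v, unfolded u(2) v(2), OF aR S(4) ca[OF Ya(1)]
          path_in_join[OF gab cb[OF Ya(2)]] u(3) this]
      have "straight S (u @ v) (g a) (g b) ((\<lambda>_. g a) +++ (subarc a b g +++ (\<lambda>_. g b)))" .
      moreover have "homotopic_paths Y (subarc a b g) ((\<lambda>_. g a) +++ (subarc a b g +++ (\<lambda>_. g b)))"
        using homotopic_paths_trans[OF homotopic_join_const(2)[OF path_in_join[OF gab cb[OF Ya(2)]]]
            homotopic_join_const(1)[OF gab]] by (rule homotopic_paths_sym)
      ultimately have "straight S (u @ v) (g a) (g b) (subarc a b g)"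
        unfolding straight_def by (rule homotopic_paths_trans[rotated])
      then show "\<exists>w. admissible S w \<and> word_end S w = S' \<and> straight S w (g a) (g b) (subarc a b g)"
        using u v by (intro exI[of _ "u @ v"]) (simp add: admissible_append word_end_append)
    qed
    then show "\<exists>d>0. \<forall>a b. a \<le> x \<and> x \<le> b \<and> b - a < d \<longrightarrow> P a b" using d(1) by blast
  qed
  moreover have "g 0 \<in> Star S" "g 1 \<in> Star S'" using ends path_inD(6,7)[OF g] by simp_all
  ultimately have "\<exists>w. admissible S w \<and> word_end S w = S' \<and> straight S w (g 0) (g 1) (subarc 0 1 g)"
    using S unfolding P_def by simp
  then obtain w where w: "admissible S w" "word_end S w = S'" "straight S w (g 0) (g 1) (subarc 0 1 g)"
    by (elim exE conjE)
  have "subarc 0 1 g = g" by (simp add: subarc_def fun_eq_iff)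
  then have "straight S w x y g" using w(3) path_inD(6,7)[OF g] by simp
  with w(1,2) show thesis by (rule that)
qed

end

section \<open>Fundamental groups\<close>

lemma loop_homotopic_iff:
  "loop_homotopic A x0 p q \<longleftrightarrow>
     (\<exists>h. continuous_map (top_of_set ({0..1::real} \<times> {0..1::real})) A h \<and>
        (\<forall>t\<in>{0..1}. h (0, t) = p t \<and> h (1, t) = q t) \<and> (\<forall>s\<in>{0..1}. h (s, 0) = x0 \<and> h (s, 1) = x0))"
proof -
  have "(h 0 = x0 \<and> h 1 = x0) \<longleftrightarrow> (k 0 = x0 \<and> k 1 = x0)"
    if "\<And>t. t \<in> topspace (top_of_set {0..1::real}) \<Longrightarrow> h t = k t" for h k :: "real \<Rightarrow> 'a"
    using that[of 0] that[of 1] by simp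
  from homotopic_with[where P = "\<lambda>r. r 0 = x0 \<and> r 1 = x0" and X = "top_of_set {0..1::real}" and Y = A, OF this]
  show ?thesis by (simp add: loop_homotopic_def ball_conj_distrib conj_assoc)
qed

lemma loop_homotopic_refl: "loop_at A x0 p \<Longrightarrow> loop_homotopic A x0 p p"
  by (simp add: loop_homotopic_def loop_at_def pathin_def)

lemma loop_homotopic_sym: "loop_homotopic A x0 p q \<Longrightarrow> loop_homotopic A x0 q p"
  unfolding loop_homotopic_def by (rule homotopic_with_symD)

lemma loop_homotopic_trans:
  "loop_homotopic A x0 p q \<Longrightarrow> loop_homotopic A x0 q r \<Longrightarrow> loop_homotopic A x0 p r"
  unfolding loop_homotopic_def by (rule homotopic_with_trans)

lemma loop_class_eq_iff:
  assumes "loop_at A x0 p" "loop_at A x0 q"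
  shows "loop_class A x0 p = loop_class A x0 q \<longleftrightarrow> loop_homotopic A x0 p q"
proof
  assume "loop_class A x0 p = loop_class A x0 q"
  moreover have "q \<in> loop_class A x0 q" using assms(2) by (simp add: loop_class_def loop_homotopic_refl)
  ultimately have "q \<in> loop_class A x0 p" by simp
  then show "loop_homotopic A x0 p q" by (simp add: loop_class_def)
next
  assume *: "loop_homotopic A x0 p q"
  have "loop_homotopic A x0 p r \<longleftrightarrow> loop_homotopic A x0 q r" for r
    using * loop_homotopic_sym loop_homotopic_trans by metis
  then show "loop_class A x0 p = loop_class A x0 q" by (simp add: loop_class_def)
qed

lemma loop_class_self: "loop_at A x0 p \<Longrightarrow> p \<in> loop_class A x0 p"
  by (simp add: loop_class_def loop_homotopic_refl)

lemma loop_at_concat: "loop_at A x0 p \<Longrightarrow> loop_at A x0 q \<Longrightarrow> loop_at A x0 (loop_concat p q)"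
  unfolding loop_at_def by (auto intro: pathin_loop_concat) (simp_all add: loop_concat_def)

lemma loop_homotopic_concat:
  assumes "loop_homotopic A x0 p p'" "loop_homotopic A x0 q q'"
  shows "loop_homotopic A x0 (loop_concat p q) (loop_concat p' q')"
proof -
  let ?I = "{0..1::real}"
  obtain h where "continuous_map (top_of_set (?I \<times> ?I)) A h \<and> (\<forall>t\<in>?I. h (0, t) = p t \<and> h (1, t) = p' t) \<and>
      (\<forall>s\<in>?I. h (s, 0) = x0 \<and> h (s, 1) = x0)"
    using assms(1) unfolding loop_homotopic_iff by (rule exE)
  then have h: "continuous_map (top_of_set (?I \<times> ?I)) A h" "\<And>t. t \<in> ?I \<Longrightarrow> h (0, t) = p t \<and> h (1, t) = p' t"
    "\<And>s. s \<in> ?I \<Longrightarrow> h (s, 0) = x0 \<and> h (s, 1) = x0" by simp_all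
  obtain k where "continuous_map (top_of_set (?I \<times> ?I)) A k \<and> (\<forall>t\<in>?I. k (0, t) = q t \<and> k (1, t) = q' t) \<and>
      (\<forall>s\<in>?I. k (s, 0) = x0 \<and> k (s, 1) = x0)"
    using assms(2) unfolding loop_homotopic_iff by (rule exE)
  then have k: "continuous_map (top_of_set (?I \<times> ?I)) A k" "\<And>t. t \<in> ?I \<Longrightarrow> k (0, t) = q t \<and> k (1, t) = q' t"
    "\<And>s. s \<in> ?I \<Longrightarrow> k (s, 0) = x0 \<and> k (s, 1) = x0" by simp_all
  let ?D = "top_of_set (?I \<times> ?I)"
  \<comment> \<open>The two homotopies side by side.\<close>
  define m where "m z = (if snd z \<le> 1 / 2 then h (fst z, 2 * snd z) else k (fst z, 2 * snd z - 1))" for z :: "real \<times> real"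
  have "continuous_map ?D A m"
    unfolding m_def
  proof (rule continuous_map_cases_le)
    show "continuous_map ?D euclideanreal snd" by (auto intro!: continuous_intros)
    show "continuous_map ?D euclideanreal (\<lambda>_. 1 / 2)" by simp
    have "continuous_map (subtopology ?D {z \<in> topspace ?D. snd z \<le> 1 / 2}) ?D (\<lambda>z. (fst z, 2 * snd z))"
      by (auto simp: subtopology_subtopology intro!: continuous_intros)
    from continuous_map_compose[OF this h(1)]
    show "continuous_map (subtopology ?D {z \<in> topspace ?D. snd z \<le> 1 / 2}) A (\<lambda>z. h (fst z, 2 * snd z))"
      by (simp add: o_def)
    have "continuous_map (subtopology ?D {z \<in> topspace ?D. 1 / 2 \<le> snd z}) ?D (\<lambda>z. (fst z, 2 * snd z - 1))"
      by (auto simp: subtopology_subtopology intro!: continuous_intros)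
    from continuous_map_compose[OF this k(1)]
    show "continuous_map (subtopology ?D {z \<in> topspace ?D. 1 / 2 \<le> snd z}) A (\<lambda>z. k (fst z, 2 * snd z - 1))"
      by (simp add: o_def)
    fix z assume z: "z \<in> topspace ?D" "snd z = 1 / 2"
    then have "fst z \<in> ?I" "2 * snd z = 1" "2 * snd z - 1 = 0" by auto
    then show "h (fst z, 2 * snd z) = k (fst z, 2 * snd z - 1)"
      using h(3)[of "fst z"] k(3)[of "fst z"] by (simp only:)
  qed
  moreover have "m (0, t) = loop_concat p q t \<and> m (1, t) = loop_concat p' q' t" if "t \<in> ?I" for t
    using that h(2)[of "2 * t"] k(2)[of "2 * t - 1"] by (simp add: m_def loop_concat_def)
  moreover have "m (s, 0) = x0 \<and> m (s, 1) = x0" if "s \<in> ?I" for s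
    using h(3)[OF that] k(3)[OF that] by (simp add: m_def)
  ultimately show ?thesis unfolding loop_homotopic_iff by (intro exI[of _ m]) simp
qed

lemma pi1_carrier: "carrier (pi1 A x0) = {loop_class A x0 p | p. loop_at A x0 p}"
  by (simp add: pi1_def)

lemma union_classes_const:
  assumes "P \<noteq> {}" "\<And>p. p \<in> P \<Longrightarrow> F p = C" shows "(\<Union>p\<in>P. F p) = C"
  using assms by auto

lemma pi1_mult:
  assumes p: "loop_at A x0 p" and q: "loop_at A x0 q"
  shows "loop_class A x0 p \<otimes>\<^bsub>pi1 A x0\<^esub> loop_class A x0 q = loop_class A x0 (loop_concat p q)"
proof -
  have same: "loop_class A x0 (loop_concat p' q') = loop_class A x0 (loop_concat p q)"
    if "p' \<in> loop_class A x0 p" "q' \<in> loop_class A x0 q" for p' q'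
  proof -
    have l: "loop_at A x0 p'" "loop_homotopic A x0 p p'" "loop_at A x0 q'" "loop_homotopic A x0 q q'"
      using that by (simp_all add: loop_class_def)
    have "loop_homotopic A x0 (loop_concat p' q') (loop_concat p q)"
      by (rule loop_homotopic_concat[OF loop_homotopic_sym[OF l(2)] loop_homotopic_sym[OF l(4)]])
    then show ?thesis
      using loop_class_eq_iff[OF loop_at_concat[OF l(1,3)] loop_at_concat[OF p q]] by simp
  qed
  have ne: "loop_class A x0 p \<noteq> {}" "loop_class A x0 q \<noteq> {}"
    using loop_class_self[OF p] loop_class_self[OF q] by blast+
  have "(\<Union>p'\<in>loop_class A x0 p. \<Union>q'\<in>loop_class A x0 q. loop_class A x0 (loop_concat p' q'))
      = loop_class A x0 (loop_concat p q)"
    by (intro union_classes_const ne) (rule same)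
  then show ?thesis by (simp add: pi1_def)
qed

lemma comp_loop_concat: "f \<circ> loop_concat p q = loop_concat (f \<circ> p) (f \<circ> q)"
  by (auto simp: loop_concat_def)

lemma loop_at_compose:
  assumes "continuous_map A B f" "loop_at A x0 p" shows "loop_at B (f x0) (f \<circ> p)"
  using assms continuous_map_compose[of "top_of_set {0..1}" A p B f] by (simp add: loop_at_def pathin_def)

lemma loop_homotopic_compose:
  assumes f: "continuous_map A B f" and pq: "loop_homotopic A x0 p q"
  shows "loop_homotopic B (f x0) (f \<circ> p) (f \<circ> q)"
  using pq unfolding loop_homotopic_def
  by (rule homotopic_with_compose_continuous_map_left[OF _ f]) simp

lemma pi1_map_class:
  assumes f: "continuous_map A B f" and p: "loop_at A x0 p"
  shows "pi1_map B f x0 (loop_class A x0 p) = loop_class B (f x0) (f \<circ> p)"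
  unfolding pi1_map_def
proof (rule union_classes_const)
  show "loop_class A x0 p \<noteq> {}" using loop_class_self[OF p] by blast
  fix q assume "q \<in> loop_class A x0 p"
  then have q: "loop_at A x0 q" "loop_homotopic A x0 p q" by (simp_all add: loop_class_def)
  show "loop_class B (f x0) (f \<circ> q) = loop_class B (f x0) (f \<circ> p)"
    using loop_class_eq_iff[OF loop_at_compose[OF f q(1)] loop_at_compose[OF f p]]
      loop_homotopic_compose[OF f loop_homotopic_sym[OF q(2)]] by simp
qed

lemma pi1_map_hom:
  assumes f: "continuous_map A B f"
  shows "pi1_map B f x0 \<in> hom (pi1 A x0) (pi1 B (f x0))"
proof (rule homI)
  fix a assume "a \<in> carrier (pi1 A x0)"
  then obtain p where "loop_at A x0 p" "a = loop_class A x0 p" by (auto simp: pi1_carrier)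
  then show "pi1_map B f x0 a \<in> carrier (pi1 B (f x0))"
    using pi1_map_class[OF f] loop_at_compose[OF f] unfolding pi1_carrier by blast
next
  fix a b assume "a \<in> carrier (pi1 A x0)" "b \<in> carrier (pi1 A x0)"
  then obtain p q where p: "loop_at A x0 p" "a = loop_class A x0 p" and q: "loop_at A x0 q" "b = loop_class A x0 q"
    by (auto simp: pi1_carrier)
  show "pi1_map B f x0 (a \<otimes>\<^bsub>pi1 A x0\<^esub> b) = pi1_map B f x0 a \<otimes>\<^bsub>pi1 B (f x0)\<^esub> pi1_map B f x0 b"
    by (simp add: p q pi1_mult pi1_map_class[OF f] loop_at_concat comp_loop_concat loop_at_compose[OF f])
qed

context finite_raag
begin

lemma path_word_cong:
  assumes "\<And>t. t \<in> {0..1} \<Longrightarrow> p t = q t" shows "path_word p = path_word q"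
proof -
  have "mesh p N = mesh q N" for N
    unfolding mesh_def by (intro conj_cong ball_cong imp_cong refl) (simp only: assms)
  then have "mesh p = mesh q" by (rule ext)
  moreover have "grid_word p N = grid_word q N" for N
    unfolding grid_word_def
  proof (rule trace_cong)
    fix i assume "i \<le> N"
    then have "real i / real N \<in> {0..1}" by (cases "N = 0") (simp_all add: divide_le_eq_1)
    then show "p (real i / real N) = q (real i / real N)" by (rule assms)
  qed
  ultimately show ?thesis by (simp add: path_word_def)
qed

lemma path_word_const: "path_word (\<lambda>_. x) = []"
proof -
  have "jump_trace (\<lambda>_. x) m = []" for m by (induction m) (simp_all add: trace_Suc)
  then show ?thesis by (simp add: path_word_def grid_word_def)
qed

lemma path_word_loop_homotopic:
  assumes "loop_homotopic T z0 p q" shows "path_word p \<simeq> path_word q"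
proof -
  obtain h where "continuous_map (top_of_set ({0..1::real} \<times> {0..1::real})) T h \<and>
      (\<forall>t\<in>{0..1}. h (0, t) = p t \<and> h (1, t) = q t) \<and> (\<forall>s\<in>{0..1}. h (s, 0) = z0 \<and> h (s, 1) = z0)"
    using assms unfolding loop_homotopic_iff by (rule exE)
  then have h: "continuous_map (top_of_set ({0..1} \<times> {0..1})) T h"
    "\<forall>t\<in>{0..1}. h (0, t) = p t \<and> h (1, t) = q t" "\<forall>s\<in>{0..1}. h (s, 0) = z0 \<and> h (s, 1) = z0"
    by simp_all
  have "path_word (\<lambda>t. h (0, t)) \<simeq> path_word (\<lambda>t. h (1, t))"
    by (rule path_word_homotopy[OF h(1)]) (use h(3) in blast)
  moreover have "path_word (\<lambda>t. h (0, t)) = path_word p" "path_word (\<lambda>t. h (1, t)) = path_word q"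
    by (rule path_word_cong; use h(2) in blast)+
  ultimately show ?thesis by simp
qed

lemma concat_single:
  assumes "distinct vs" "v \<in> set vs" "\<And>u. u \<in> set vs \<Longrightarrow> u \<noteq> v \<Longrightarrow> f u = []"
  shows "concat (map f vs) = f v"
  using assms
proof (induction vs)
  case (Cons u vs)
  show ?case
  proof (cases "u = v")
    case True
    then have "concat (map f vs) = []" using Cons.prems by auto
    then show ?thesis using True by simp
  next
    case False
    then show ?thesis using Cons by auto
  qed
qed simp

lemma jump_single:
  assumes v: "v \<in> V" and same: "\<And>u. u \<in> V \<Longrightarrow> u \<noteq> v \<Longrightarrow> x u = y u"
  shows "jump x y = power_word v (crossing (x v) (y v))"
  unfolding jump_def
proof (rule concat_single)
  fix u assume "u \<in> set vertex_list" "u \<noteq> v"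
  then show "power_word u (crossing (x u) (y u)) = []" using same[of u] by (simp add: vertex_list power_word_def)
qed (use v vertex_list in auto)

lemma crossing_RZ:
  assumes "0 \<le> s" "s \<le> t" "t \<le> 1" "t - s \<le> 1 / 4"
  shows "crossing (RZ s) (RZ t) = (if s < 1 / 2 \<and> 1 / 2 \<le> t then 1 else 0)"
proof (cases "t = 1")
  case True
  have "frac s = 0 \<or> 3 / 4 \<le> frac s"
    using assms True frac_eq[of s] by (cases "s = 1") auto
  moreover have "\<not> s < 1 / 2" using assms True by linarith
  ultimately show ?thesis using True by (auto simp: crossing_def)
next
  case False
  then have "frac s = s" "frac t = t" using assms by (simp_all add: frac_eq)
  then show ?thesis using assms by (auto simp: crossing_def)
qed

text \<open>
  Among all steps of the grid only the one passing the midpoint of the circle is recorded.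
\<close>

lemma path_word_circle:
  assumes p: "pathin T p" and v: "v \<in> V"
    and pv: "\<And>t. t \<in> {0..1} \<Longrightarrow> p t v = RZ t" and pu: "\<And>t u. t \<in> {0..1} \<Longrightarrow> u \<in> V \<Longrightarrow> u \<noteq> v \<Longrightarrow> p t u = RZ 0"
  shows "path_word p \<simeq> [(v, True)]"
proof -
  obtain N0 where "mesh p N0" using mesh_exists[OF p] .
  then have N: "mesh p (N0 + 4)" by (rule mesh_mono) simp
  \<comment> \<open>Steps of at most \<open>1 / 4\<close> keep the last one, whose end has representative \<open>0\<close>, away from the midpoint.\<close>
  define N where "N = N0 + 4"
  have N4: "real N \<ge> 4" by (simp add: N_def)
  have "jump_trace (\<lambda>i. p (i / N)) m = (if 1 / 2 \<le> m / N then [(v, True)] else [])" if "m \<le> N" for m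
    using that
  proof (induction m)
    case (Suc m)
    have r: "real m / N \<in> {0..1}" "real (Suc m) / N \<in> {0..1}" using Suc.prems N4 by (simp_all add: divide_le_eq_1)
    have step: "real (Suc m) / N - real m / N = 1 / N" by (simp add: diff_divide_distrib[symmetric])
    have small: "1 / real N \<le> 1 / 4" "0 < 1 / real N" using N4 by (simp_all add: field_simps)
    have "jump (p (m / N)) (p (Suc m / N)) = power_word v (crossing (p (m / N) v) (p (Suc m / N) v))"
      by (rule jump_single[OF v]) (use pu r in simp)
    also have "\<dots> = power_word v (crossing (RZ (m / N)) (RZ (Suc m / N)))" using pv r by simp
    also have "crossing (RZ (m / N)) (RZ (Suc m / N)) = (if m / N < 1 / 2 \<and> 1 / 2 \<le> Suc m / N then 1 else 0)"
    proof (rule crossing_RZ)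
      show "0 \<le> real m / N" "real (Suc m) / N \<le> 1" using r by (simp_all only: atLeastAtMost_iff)
      show "real m / N \<le> real (Suc m) / N" "real (Suc m) / N - real m / N \<le> 1 / 4"
        using step small by linarith+
    qed
    finally have j: "jump (p (m / N)) (p (Suc m / N)) =
      (if m / N < 1 / 2 \<and> 1 / 2 \<le> Suc m / N then [(v, True)] else [])" by (simp add: power_word_def)
    have IH: "jump_trace (\<lambda>i. p (i / N)) m = (if 1 / 2 \<le> m / N then [(v, True)] else [])" using Suc by simp
    have mono: "real m / N < real (Suc m) / N" using step small by linarith
    show ?case
      unfolding trace_Suc IH j using mono by (simp del: of_nat_Suc)
  qed simp
  from this[of N] have "grid_word p N = [(v, True)]" using N4 by (simp add: grid_word_def)
  then show ?thesis using path_word_grid[OF p N] by (simp add: N_def)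
qed

end

sublocale oriented_graph \<subseteq> R: finite_raag "disjointness_graph G"
proof
  show "finite (verts (disjointness_graph G))" using finite_E by simp
  show "e \<subseteq> verts (disjointness_graph G)" if "e \<in> edges (disjointness_graph G)" for e
    using that by (auto simp: disjointness_graph_def)
qed

context oriented_graph
begin

text \<open>
  Paths of configurations are represented by their images under \<open>moments\<close>, so \<open>\<Phi>\<close> is applied to the
  configurations recovered from them.
\<close>

definition reading :: "(real \<Rightarrow> 'a set \<Rightarrow> real) \<Rightarrow> 'a set word" where
  "reading g = R.path_word (\<lambda>t. Phi G ori (unmoments (g t)))"

lemma reading_in [simp]: "reading g \<in> lists (E \<times> UNIV)"
  using R.path_word_in by (simp add: reading_def)

lemma continuous_Phi_unmoments:
  "continuous_map (top_of_set Y) (raag_complex (disjointness_graph G)) (\<lambda>y. Phi G ori (unmoments y))"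
  using continuous_map_compose[OF continuous_unmoments continuous_Phi] by (simp add: o_def)

lemma reading_pathin:
  assumes g: "path_in Y x y g"
  shows "pathin (raag_complex (disjointness_graph G)) (\<lambda>t. Phi G ori (unmoments (g t)))"
proof -
  have "continuous_map (top_of_set {0..1}) (top_of_set Y) g"
    using path_inD(8)[OF g] path_inD(5)[OF g] by (simp add: continuous_map_in_subtopology image_subset_iff)
  from continuous_map_compose[OF this continuous_Phi_unmoments] show ?thesis by (simp add: pathin_def o_def)
qed

lemma reading_homotopic:
  assumes "homotopic_paths Y g g'" shows "R.weq (reading g) (reading g')"
proof -
  obtain h where h: "continuous_on ({0..1::real} \<times> {0..1::real}) h" "h \<in> {0..1} \<times> {0..1} \<rightarrow> Y"
    "\<forall>t\<in>{0..1}. h (0, t) = g t" "\<forall>t\<in>{0..1}. h (1, t) = g' t"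
    "\<forall>s\<in>{0..1}. pathstart (h \<circ> Pair s) = pathstart g \<and> pathfinish (h \<circ> Pair s) = pathfinish g"
    using assms unfolding homotopic_paths by blast
  have "continuous_map (top_of_set ({0..1} \<times> {0..1})) (top_of_set Y) h"
    using h(1,2) by (simp add: continuous_map_in_subtopology image_subset_iff_funcset)
  from continuous_map_compose[OF this continuous_Phi_unmoments]
  have c: "continuous_map (top_of_set ({0..1} \<times> {0..1})) (raag_complex (disjointness_graph G))
      (\<lambda>z. Phi G ori (unmoments (h z)))" by (simp add: o_def)
  have "R.weq (R.path_word (\<lambda>t. Phi G ori (unmoments (h (0, t))))) (R.path_word (\<lambda>t. Phi G ori (unmoments (h (1, t)))))"
    proof (rule R.path_word_homotopy[OF c])
    show "Phi G ori (unmoments (h (s, 0))) = Phi G ori (unmoments (g 0)) \<and>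
        Phi G ori (unmoments (h (s, 1))) = Phi G ori (unmoments (g 1))" if "s \<in> {0..1}" for s
      using h(5) that by (simp add: pathstart_def pathfinish_def)
  qed
  moreover have "R.path_word (\<lambda>t. Phi G ori (unmoments (h (0, t)))) = reading g"
    "R.path_word (\<lambda>t. Phi G ori (unmoments (h (1, t)))) = reading g'"
    unfolding reading_def by (rule R.path_word_cong; use h(3,4) in simp)+
  ultimately show ?thesis by simp
qed

lemma reading_join:
  assumes f: "path_in Y x y f" and g: "path_in Y y z g"
  shows "R.weq (reading (f +++ g)) (reading f @ reading g)"
proof -
  have "(\<lambda>t. Phi G ori (unmoments ((f +++ g) t))) =
      loop_concat (\<lambda>t. Phi G ori (unmoments (f t))) (\<lambda>t. Phi G ori (unmoments (g t)))"
    by (auto simp: joinpaths_def loop_concat_def)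
  moreover have "Phi G ori (unmoments (f 1)) = Phi G ori (unmoments (g 0))"
    using path_inD(7)[OF f] path_inD(6)[OF g] by simp
  ultimately show ?thesis
    using R.path_word_concat[OF reading_pathin[OF f] reading_pathin[OF g]] by (simp add: reading_def)
qed

lemma reading_const: "reading (\<lambda>_. y) = []"
  by (simp add: reading_def R.path_word_const)

lemma reading_reverse:
  assumes g: "path_in Y x y g"
  shows "R.weq (reading g @ reading (reversepath g)) []" "R.weq (reading (reversepath g) @ reading g) []"
proof -
  note r = path_in_reverse[OF g]
  show "R.weq (reading g @ reading (reversepath g)) []"
    using R.weq_trans[OF R.weq_sym[OF reading_join[OF g r]] reading_homotopic[OF homotopic_join_reverse(1)[OF g]]]
    by (simp add: reading_const)
  show "R.weq (reading (reversepath g) @ reading g) []"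
    using R.weq_trans[OF R.weq_sym[OF reading_join[OF r g]] reading_homotopic[OF homotopic_join_reverse(2)[OF g]]]
    by (simp add: reading_const)
qed

lemma reading_edge_forward:
  assumes S: "S \<in> corners" and e: "e \<in> leaving S" and "fst (ori e) \<in> S"
  shows "R.weq (reading (edge_step S e)) [(e, True)]"
  unfolding reading_def
proof (rule R.path_word_circle)
  show "pathin (raag_complex (disjointness_graph G)) (\<lambda>t. Phi G ori (unmoments (edge_step S e t)))"
    by (rule reading_pathin[OF edge_step_path_in[OF S e]])
  have val: "Phi G ori (unmoments (edge_step S e t)) =
      (\<lambda>f\<in>E. RZ (if fst (ori f) \<in> S then t * unit_height e f else - (t * unit_height e f)))" if t: "t \<in> {0..1}" for t
  proof -
    have h: "(\<lambda>f. t * unit_height e f) \<in> heights S" using scale_heights[OF unit_heights[OF e] t] .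
    have "unmoments (edge_step S e t) = config S (\<lambda>f. t * unit_height e f)"
      using config_in_X[OF S h] by (simp add: ray_def chart_def)
    then show ?thesis by (simp add: Phi_config[OF h])
  qed
  show "e \<in> verts (disjointness_graph G)" using leaving_E[OF e] by simp
  show "Phi G ori (unmoments (edge_step S e t)) e = RZ t" if "t \<in> {0..1}" for t
    using val[OF that] assms(3) leaving_E[OF e] by (simp add: unit_height_def)
  show "Phi G ori (unmoments (edge_step S e t)) f = RZ 0"
    if "t \<in> {0..1}" "f \<in> verts (disjointness_graph G)" "f \<noteq> e" for t f
    using val[OF that(1)] that(2,3) by (simp add: unit_height_def)
qed

text \<open>
  An edge traversed against its orientation is the reverse of the edge at the opposite corner, and reverse
  paths spell inverse words.
\<close>

lemma reading_edge:
  assumes S: "S \<in> corners" and e: "e \<in> leaving S"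
  shows "R.weq (reading (edge_step S e)) [(e, fst (ori e) \<in> S)]"
proof (cases "fst (ori e) \<in> S")
  case True
  then show ?thesis using reading_edge_forward[OF S e] by simp
next
  case False
  note F = flip_corner[OF S e] and L = leaving_flip[OF e]
  have "fst (ori e) \<in> e" using edge_ends(1)[OF leaving_E[OF e]] by (metis insertI1)
  then have "fst (ori e) \<in> flip S e" using False by (simp add: flip_def)
  then have fwd: "R.weq (reading (edge_step (flip S e) e)) [(e, True)]" by (rule reading_edge_forward[OF F L])
  let ?r = "reading (edge_step S e)"
  have eE: "e \<in> E" using leaving_E[OF e] .
  have "R.weq (reading (edge_step (flip S e) e)) (reading (reversepath (edge_step S e)))"
    by (rule reading_homotopic[OF edge_step_reverse[OF S e]])
  then have rev: "R.weq [(e, True)] (reading (reversepath (edge_step S e)))"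
    by (rule R.weq_trans[OF R.weq_sym[OF fwd]])
  have c: "R.weq [(e, False), (e, True)] []" using R.weq_cancel[of e False] eE by simp
  \<comment> \<open>The reading is an inverse of the reading of the reverse path, which is the generator itself.\<close>
  have "R.weq ?r ([(e, False), (e, True)] @ ?r)"
    using R.weq_context[OF R.weq_sym[OF c], of "[]" ?r] by simp
  also have "R.weq ([(e, False), (e, True)] @ ?r) ([(e, False)] @ reading (reversepath (edge_step S e)) @ ?r)"
    using R.weq_context[OF rev, of "[(e, False)]" ?r] eE by simp
  also have "R.weq \<dots> [(e, False)]"
    using R.weq_context[OF reading_reverse(2)[OF edge_step_path_in[OF S e]], of "[(e, False)]" "[]"] eE by simp
  finally show ?thesis using False by simp
qed

lemma reading_edge_path:
  assumes "S \<in> corners" "admissible S w"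
  shows "R.weq (reading (edge_path S w)) w"
  using assms
proof (induction S w rule: admissible.induct)
  case (1 S) then show ?case by (simp add: reading_const)
next
  case (2 S e b u)
  then have e: "e \<in> leaving S" "b = (fst (ori e) \<in> S)" "admissible (flip S e) u" by simp_all
  note F = flip_corner[OF 2(2) e(1)]
  have "R.weq (reading (edge_path S ((e, b) # u))) (reading (edge_step S e) @ reading (edge_path (flip S e) u))"
    using reading_join[OF edge_step_path_in[OF 2(2) e(1)] edge_path_in[OF F]] e(1) by simp
  also have "R.weq \<dots> ([(e, b)] @ u)"
    using reading_edge[OF 2(2) e(1)] 2(1)[OF F e(3)] leaving_E[OF e(1)]
    by (intro R.weq_append) (simp_all add: e(2))
  finally show ?case by simp
qed

lemma reading_straight:
  assumes S: "S \<in> corners" and x: "x \<in> Star S" and y: "y \<in> Star (word_end S w)"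
    and w: "admissible S w" and g: "straight S w x y g"
  shows "R.weq (reading g) (reading (reversepath (star_ray S x)) @ w @ reading (star_ray (word_end S w) y))"
proof -
  let ?R = "word_end S w"
  note a = path_in_reverse[OF star_ray_in_Y[OF S x]] and b = edge_path_in[OF S, of w]
    and c = star_ray_in_Y[OF word_end_corner[OF S] y]
  have "R.weq (reading g) (reading (reversepath (star_ray S x) +++ (edge_path S w +++ star_ray ?R y)))"
    using g unfolding straight_def by (rule reading_homotopic)
  also have "R.weq \<dots> (reading (reversepath (star_ray S x)) @ reading (edge_path S w +++ star_ray ?R y))"
    by (rule reading_join[OF a path_in_join[OF b c]])
  also have "R.weq \<dots> (reading (reversepath (star_ray S x)) @ (reading (edge_path S w) @ reading (star_ray ?R y)))"
    using R.weq_context[OF reading_join[OF b c], of "reading (reversepath (star_ray S x))" "[]"] by simp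
  also have "R.weq \<dots> (reading (reversepath (star_ray S x)) @ (w @ reading (star_ray ?R y)))"
    using R.weq_context[OF reading_edge_path[OF S w], of "reading (reversepath (star_ray S x))" "reading (star_ray ?R y)"]
    by simp
  finally show ?thesis .
qed

lemma loop_moments:
  assumes p: "loop_at (conf_space n G) x0 p"
  shows "path_in Y (moments x0) (moments x0) (\<lambda>t. moments (p t))"
    "reading (\<lambda>t. moments (p t)) = R.path_word (Phi G ori \<circ> p)" "moments x0 \<in> Y"
proof -
  have c: "continuous_map (top_of_set {0..1}) (conf_space n G) p" and e: "p 0 = x0" "p 1 = x0"
    using p by (simp_all add: loop_at_def pathin_def)
  have X: "p t \<in> X" if "t \<in> {0..1}" for t using c that by (auto simp: continuous_map_def)
  have "continuous_on {0..1} (\<lambda>t. moments (p t))"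
    using continuous_map_compose[OF c continuous_moments] by (simp add: o_def)
  then show path: "path_in Y (moments x0) (moments x0) (\<lambda>t. moments (p t))"
    using X e by (simp add: path_in_iff)
  show "reading (\<lambda>t. moments (p t)) = R.path_word (Phi G ori \<circ> p)"
    unfolding reading_def by (rule R.path_word_cong) (simp add: X)
  show "moments x0 \<in> Y" using path_inD(5)[OF path, of 0] e by simp
qed

text \<open>
  Straighten both loops from the same corner. Their readings are conjugates of the resulting words by the
  same element, so these words are equal in the Artin group and trace homotopic paths.
\<close>

lemma Phi_loops_injective:
  assumes p: "loop_at (conf_space n G) x0 p" and q: "loop_at (conf_space n G) x0 q"
    and eq: "R.weq (R.path_word (Phi G ori \<circ> p)) (R.path_word (Phi G ori \<circ> q))"
  shows "loop_homotopic (conf_space n G) x0 p q"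
proof -
  let ?y = "moments x0" and ?p = "\<lambda>t. moments (p t)" and ?q = "\<lambda>t. moments (q t)"
  note P = loop_moments[OF p] and Q = loop_moments[OF q]
  obtain S where S: "S \<in> corners" "?y \<in> Star S" using rounded_Star[OF P(3)] .
  obtain u where u: "admissible S u" "word_end S u = S" "straight S u ?y ?y ?p"
    using straighten[OF P(1) S(1) S(1) S(2) S(2)] .
  obtain v where v: "admissible S v" "word_end S v = S" "straight S v ?y ?y ?q"
    using straighten[OF Q(1) S(1) S(1) S(2) S(2)] .
  note r = star_ray_in_Y[OF S]
  let ?r = "reading (star_ray S ?y)" and ?r' = "reading (reversepath (star_ray S ?y))"
  have W: "w \<in> lists (E \<times> UNIV)" if "admissible S w" for w S
    using that by (induction S w rule: admissible.induct) (auto simp: leaving_E)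
  have conj: "R.weq (?r @ (?r' @ w @ ?r) @ ?r') w" if "w \<in> lists (E \<times> UNIV)" for w
  proof -
    have "R.weq (?r @ (?r' @ w @ ?r) @ ?r') (w @ ?r @ ?r')"
      using R.weq_context[OF reading_reverse(1)[OF r], of "[]" "w @ ?r @ ?r'"] that by simp
    also have "R.weq \<dots> w"
      using R.weq_context[OF reading_reverse(1)[OF r], of w "[]"] that by simp
    finally show ?thesis .
  qed
  have ru: "R.weq (reading ?p) (?r' @ u @ ?r)"
    using reading_straight[OF S, of ?y u ?p] S(2) u by simp
  have rv: "R.weq (reading ?q) (?r' @ v @ ?r)"
    using reading_straight[OF S, of ?y v ?q] S(2) v by simp
  have "R.weq (reading ?p) (reading ?q)" using eq by (simp only: P(2) Q(2))
  from R.weq_trans[OF R.weq_trans[OF R.weq_sym[OF ru] this] rv]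
  have "R.weq (?r @ (?r' @ u @ ?r) @ ?r') (?r @ (?r' @ v @ ?r) @ ?r')"
    by (rule R.weq_context) simp_all
  from R.weq_trans[OF R.weq_trans[OF R.weq_sym[OF conj[OF W[OF u(1)]]] this] conj[OF W[OF v(1)]]]
  have "R.weq u v" .
  then have uv: "homotopic_paths Y (edge_path S u) (edge_path S v)"
    using edge_path_weq[OF S(1)] by (simp add: R.weq_def)
  note r' = path_in_reverse[OF r] and E = edge_path_in[OF S(1), of u, unfolded u(2)]
  have "homotopic_paths Y ?p (reversepath (star_ray S ?y) +++ (edge_path S u +++ star_ray S ?y))"
    using u(3) by (simp add: straight_def u(2))
  also have "homotopic_paths Y \<dots> (reversepath (star_ray S ?y) +++ (edge_path S v +++ star_ray S ?y))"
    by (rule homotopic_join[OF path_in_refl[OF r'] homotopic_join[OF uv path_in_refl[OF r] E r] r' path_in_join[OF E r]])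
  also have "homotopic_paths Y \<dots> ?q"
    by (rule homotopic_paths_sym) (use v(3) in \<open>simp add: straight_def v(2)\<close>)
  finally have "homotopic_paths Y ?p ?q" .
  then obtain h where h: "continuous_on ({0..1::real} \<times> {0..1::real}) h" "h \<in> {0..1} \<times> {0..1} \<rightarrow> Y"
    "\<forall>t\<in>{0..1}. h (0, t) = ?p t" "\<forall>t\<in>{0..1}. h (1, t) = ?q t"
    "\<forall>s\<in>{0..1}. pathstart (h \<circ> Pair s) = pathstart ?p \<and> pathfinish (h \<circ> Pair s) = pathfinish ?p"
    unfolding homotopic_paths by blast
  have "continuous_map (top_of_set ({0..1} \<times> {0..1})) (top_of_set Y) h"
    using h(1,2) by (simp add: continuous_map_in_subtopology image_subset_iff_funcset)
  from continuous_map_compose[OF this continuous_unmoments]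
  have c: "continuous_map (top_of_set ({0..1} \<times> {0..1})) (conf_space n G) (unmoments \<circ> h)" .
  have pX: "p t \<in> X" "q t \<in> X" if "t \<in> {0..1}" for t
    using p q that by (auto simp: loop_at_def intro: pathin_mem)
  have x0: "x0 \<in> X" "p 0 = x0" "p 1 = x0" using pX(1)[of 0] p by (simp_all add: loop_at_def)
  show ?thesis
    unfolding loop_homotopic_iff
    by (intro exI[of _ "unmoments \<circ> h"]) (use c h(3-5) pX x0 in \<open>simp add: pathstart_def pathfinish_def\<close>)
qed

lemma Phi_pi1_injective: "pi1_injective (conf_space n G) (raag_complex (disjointness_graph G)) (Phi G ori)"
  unfolding pi1_injective_def
proof (intro conjI ballI continuous_Phi)
  fix x0 assume "x0 \<in> X"
  let ?C = "conf_space n G" and ?T = "raag_complex (disjointness_graph G)"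
  have "inj_on (pi1_map ?T (Phi G ori) x0) (carrier (pi1 ?C x0))"
  proof (rule inj_onI)
    fix a b assume ab: "a \<in> carrier (pi1 ?C x0)" "b \<in> carrier (pi1 ?C x0)"
      "pi1_map ?T (Phi G ori) x0 a = pi1_map ?T (Phi G ori) x0 b"
    obtain p q where p: "loop_at ?C x0 p" "a = loop_class ?C x0 p" and q: "loop_at ?C x0 q" "b = loop_class ?C x0 q"
      using ab(1,2) by (auto simp: pi1_carrier)
    have "loop_class ?T (Phi G ori x0) (Phi G ori \<circ> p) = loop_class ?T (Phi G ori x0) (Phi G ori \<circ> q)"
      using ab(3) p q by (simp add: pi1_map_class[OF continuous_Phi])
    then have "loop_homotopic ?T (Phi G ori x0) (Phi G ori \<circ> p) (Phi G ori \<circ> q)"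
      using loop_class_eq_iff[OF loop_at_compose[OF continuous_Phi p(1)] loop_at_compose[OF continuous_Phi q(1)]] by simp
    then have "loop_homotopic ?C x0 p q"
      by (intro Phi_loops_injective[OF p(1) q(1)] R.path_word_loop_homotopic)
    then show "a = b" using loop_class_eq_iff[OF p(1) q(1)] p(2) q(2) by simp
  qed
  then show "pi1_map ?T (Phi G ori) x0 \<in> mon (pi1 ?C x0) (pi1 ?T (Phi G ori x0))"
    using pi1_map_hom[OF continuous_Phi] by (simp add: mon_def)
qed

text \<open>
  Homotopic loops spell equivalent words, so any representative of the class may be chosen.
\<close>

definition raag_embedding :: "(real \<Rightarrow> ('a \<Rightarrow> real) set) set \<Rightarrow> 'a set word set" where
  "raag_embedding a = word_class E (raag_relators (disjointness_graph G)) (R.path_word (Phi G ori \<circ> (SOME p. p \<in> a)))"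

lemma raag_embedding_class:
  assumes p: "loop_at (conf_space n G) x0 p"
  shows "raag_embedding (loop_class (conf_space n G) x0 p) =
    word_class E (raag_relators (disjointness_graph G)) (R.path_word (Phi G ori \<circ> p))"
proof -
  define q where "q = (SOME q. q \<in> loop_class (conf_space n G) x0 p)"
  have "q \<in> loop_class (conf_space n G) x0 p" unfolding q_def
    by (rule someI[where P = "\<lambda>q. q \<in> loop_class (conf_space n G) x0 p", OF loop_class_self[OF p]])
  then have "loop_homotopic (conf_space n G) x0 q p" by (simp add: loop_class_def loop_homotopic_sym)
  then have "R.weq (R.path_word (Phi G ori \<circ> q)) (R.path_word (Phi G ori \<circ> p))"
    by (rule R.path_word_loop_homotopic[OF loop_homotopic_compose[OF continuous_Phi]])
  then show ?thesis
    using R.word_class_eq_iff by (simp add: raag_embedding_def q_def)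
qed

lemma raag_embedding_mon:
  "raag_embedding \<in> mon (reduced_braid_group n G x0) (raag (disjointness_graph G))"
  unfolding reduced_braid_group_def mon_def
proof (intro CollectI conjI homI inj_onI)
  let ?C = "conf_space n G" and ?T = "raag_complex (disjointness_graph G)"
  fix a assume "a \<in> carrier (pi1 ?C x0)"
  then obtain p where p: "loop_at ?C x0 p" "a = loop_class ?C x0 p" by (auto simp: pi1_carrier)
  show "raag_embedding a \<in> carrier (raag (disjointness_graph G))"
    using R.path_word_in unfolding R.raag_carrier p(2) raag_embedding_class[OF p(1)] verts_disjointness by blast
next
  let ?C = "conf_space n G" and ?T = "raag_complex (disjointness_graph G)"
  fix a b assume ab: "a \<in> carrier (pi1 ?C x0)" "b \<in> carrier (pi1 ?C x0)"
  obtain p q where p: "loop_at ?C x0 p" "a = loop_class ?C x0 p" and q: "loop_at ?C x0 q" "b = loop_class ?C x0 q"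
    using ab by (auto simp: pi1_carrier)
  have "pathin ?T (Phi G ori \<circ> p)" "pathin ?T (Phi G ori \<circ> q)" "(Phi G ori \<circ> p) 1 = (Phi G ori \<circ> q) 0"
    using loop_at_compose[OF continuous_Phi p(1)] loop_at_compose[OF continuous_Phi q(1)] by (simp_all add: loop_at_def)
  then have "R.weq (R.path_word (Phi G ori \<circ> loop_concat p q)) (R.path_word (Phi G ori \<circ> p) @ R.path_word (Phi G ori \<circ> q))"
    unfolding comp_loop_concat by (rule R.path_word_concat)
  then have "word_class E (raag_relators (disjointness_graph G)) (R.path_word (Phi G ori \<circ> loop_concat p q)) =
      word_class E (raag_relators (disjointness_graph G)) (R.path_word (Phi G ori \<circ> p) @ R.path_word (Phi G ori \<circ> q))"
    using R.word_class_eq_iff by simp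
  also have "\<dots> = raag_embedding a \<otimes>\<^bsub>raag (disjointness_graph G)\<^esub> raag_embedding b"
    using R.raag_mult[OF R.path_word_in R.path_word_in] unfolding p(2) q(2) raag_embedding_class[OF p(1)]
      raag_embedding_class[OF q(1)] verts_disjointness by simp
  finally show "raag_embedding (a \<otimes>\<^bsub>pi1 ?C x0\<^esub> b) = raag_embedding a \<otimes>\<^bsub>raag (disjointness_graph G)\<^esub> raag_embedding b"
    unfolding p(2) q(2) pi1_mult[OF p(1) q(1)] raag_embedding_class[OF loop_at_concat[OF p(1) q(1)]] .
next
  let ?C = "conf_space n G" and ?T = "raag_complex (disjointness_graph G)"
  fix a b assume ab: "a \<in> carrier (pi1 ?C x0)" "b \<in> carrier (pi1 ?C x0)" "raag_embedding a = raag_embedding b"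
  obtain p q where p: "loop_at ?C x0 p" "a = loop_class ?C x0 p" and q: "loop_at ?C x0 q" "b = loop_class ?C x0 q"
    using ab(1,2) by (auto simp: pi1_carrier)
  have "R.weq (R.path_word (Phi G ori \<circ> p)) (R.path_word (Phi G ori \<circ> q))"
    using ab(3) R.word_class_eq_iff unfolding p(2) q(2) raag_embedding_class[OF p(1)] raag_embedding_class[OF q(1)]
    by simp
  then have "loop_homotopic ?C x0 p q" by (rule Phi_loops_injective[OF p(1) q(1)])
  then show "a = b" using loop_class_eq_iff[OF p(1) q(1)] p(2) q(2) by simp
qed

end

theorem theorem2:
  fixes G :: "'a ugraph" and n :: nat and ori :: "'a set \<Rightarrow> 'a \<times> 'a"
  assumes "finite_graph G" and "orientation G ori"
  shows "local_isometry
           (topspace (conf_space n G)) (cube_dist (conf_cubing n G ori))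
           (topspace (raag_complex (disjointness_graph G)))
           (cube_dist (raag_cubing (disjointness_graph G)))
           (Phi G ori)
       \<and> pi1_injective (conf_space n G) (raag_complex (disjointness_graph G)) (Phi G ori)
       \<and> (\<forall>x0 \<in> topspace (conf_space n G).
            \<exists>\<phi>. \<phi> \<in> mon (reduced_braid_group n G x0) (raag (disjointness_graph G)))"
proof -
  interpret oriented_graph G ori n using assms by unfold_locales
  show ?thesis using local_isometry_Phi Phi_pi1_injective raag_embedding_mon by blast
qed

end
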